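(* Let $N\ge 7$ and $\frac{N(N-2)}{4}<\lambda<\left(\frac{N-1}{2}\right)^2$. Then the equation $$-\Delta_{\mathbb{B}^N}u-\lambda u=|u|^{2^*-2}u,\qquad u\in H^1(\mathbb{B}^N),$$ has infinitely many distinct nontrivial radial sign-changing (weak) solutions.
   Context: $\mathbb{B}^N=\{x\in\mathbb{R}^N:|x|<1\}$ with the hyperbolic metric $g_{ij}=\left(\frac{2}{1-|x|^2}\right)^2\delta_{ij}$; $dV_{\mathbb{B}^N}=\left(\frac{2}{1-|x|^2}\right)^N dx$; $|\nabla_{\mathbb{B}^N}u|_g^2=\left(\frac{1-|x|^2}{2}\right)^2|\nabla u|^2$; $\Delta_{\mathbb{B}^N}u=\left(\frac{1-|x|^2}{2}\right)^2\Delta u+(N-2)\frac{1-|x|^2}{2}\,x\cdot\nabla u$. $H^1(\mathbb{B}^N)$ is the completion of $C_c^\infty(\mathbb{B}^N)$ under $\left(\int(|\nabla_{\mathbb{B}^N}u|_g^2+u^2)\,dV_{\mathbb{B}^N}\right)^{1/2}$; $2^*=\frac{2N}{N-2}$. Radial means $u(x)$ depends only on $|x|$; sign-changing means $u$ takes both strictly positive and strictly negative values. *)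

theory Defs
  imports "HOL-Analysis.Analysis"
begin

text \<open>Poincare ball model of hyperbolic space on a Euclidean space of dimension N = DIM('a).\<close>

definition hyp_ball :: "'a::euclidean_space set" where
  "hyp_ball = ball 0 1"

text \<open>Conformal factor 2/(1-|x|^2), so g_ij = (hyp_conf x)^2 delta_ij.\<close>
definition hyp_conf :: "'a::euclidean_space \<Rightarrow> real" where
  "hyp_conf x = 2 / (1 - (norm x)\<^sup>2)"

definition hyp_vol :: "'a::euclidean_space measure" where
  "hyp_vol = density (restrict_space lebesgue hyp_ball)
               (\<lambda>x. ennreal (hyp_conf x ^ DIM('a)))"

coinductive smooth_on :: "'a::euclidean_space set \<Rightarrow> ('a \<Rightarrow> real) \<Rightarrow> bool" where
  "open S \<Longrightarrow> continuous_on S f \<Longrightarrow> f differentiable_on S \<Longrightarrow>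
   (\<forall>v. smooth_on S (\<lambda>x. frechet_derivative f (at x) v)) \<Longrightarrow> smooth_on S f"

definition egrad :: "('a::euclidean_space \<Rightarrow> real) \<Rightarrow> 'a \<Rightarrow> 'a" where
  "egrad f x = (\<Sum>b\<in>Basis. frechet_derivative f (at x) b *\<^sub>R b)"

definition test_fun :: "('a::euclidean_space \<Rightarrow> real) \<Rightarrow> bool" where
  "test_fun \<phi> \<longleftrightarrow> smooth_on hyp_ball \<phi> \<and>
     compact (closure {x. \<phi> x \<noteq> 0}) \<and> closure {x. \<phi> x \<noteq> 0} \<subseteq> hyp_ball"

text \<open>u belongs to H^1(B^N) (the completion of the test functions under the norm
  (int |grad_B u|_g^2 + u^2 dV)^(1/2)) with (Euclidean) weak gradient G: u is the
  H^1-limit of a sequence of test functions whose Euclidean gradients converge to G.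
  Note |grad_B f|_g^2 = ((1-|x|^2)/2)^2 |grad f|^2.\<close>
definition H1_with_grad :: "('a::euclidean_space \<Rightarrow> real) \<Rightarrow> ('a \<Rightarrow> 'a) \<Rightarrow> bool" where
  "H1_with_grad u G \<longleftrightarrow> u \<in> borel_measurable hyp_vol \<and> G \<in> borel_measurable hyp_vol \<and>
     (\<exists>\<phi> :: nat \<Rightarrow> 'a \<Rightarrow> real. (\<forall>k. test_fun (\<phi> k)) \<and>
        (\<lambda>k. \<integral>\<^sup>+ x. ennreal (((1 - (norm x)\<^sup>2) / 2)\<^sup>2 * (norm (egrad (\<phi> k) x - G x))\<^sup>2
                              + (\<phi> k x - u x)\<^sup>2) \<partial>hyp_vol) \<longlonglongrightarrow> 0)"

definition in_H1 :: "('a::euclidean_space \<Rightarrow> real) \<Rightarrow> bool" where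
  "in_H1 u \<longleftrightarrow> (\<exists>G. H1_with_grad u G)"

definition crit_exp :: "nat \<Rightarrow> real" where
  "crit_exp N = 2 * real N / (real N - 2)"

text \<open>Weak solution of  -Delta_B u - lambda u = |u|^(2*-2) u,  u in H^1(B^N):
  for every test function phi,
  int <grad_B u, grad_B phi>_g dV - lambda int u phi dV = int |u|^(2*-2) u phi dV,
  where <grad_B u, grad_B phi>_g = ((1-|x|^2)/2)^2 (grad u . grad phi).\<close>
definition weak_solution :: "real \<Rightarrow> ('a::euclidean_space \<Rightarrow> real) \<Rightarrow> bool" where
  "weak_solution lam u \<longleftrightarrow> (\<exists>G. H1_with_grad u G \<and>
     (\<forall>\<phi>. test_fun \<phi> \<longrightarrow>
        integrable hyp_vol (\<lambda>x. ((1 - (norm x)\<^sup>2) / 2)\<^sup>2 * (G x \<bullet> egrad \<phi> x)) \<and>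
        integrable hyp_vol (\<lambda>x. u x * \<phi> x) \<and>
        integrable hyp_vol (\<lambda>x. \<bar>u x\<bar> powr (crit_exp DIM('a) - 2) * u x * \<phi> x) \<and>
        (\<integral>x. ((1 - (norm x)\<^sup>2) / 2)\<^sup>2 * (G x \<bullet> egrad \<phi> x) \<partial>hyp_vol)
          - lam * (\<integral>x. u x * \<phi> x \<partial>hyp_vol)
        = (\<integral>x. \<bar>u x\<bar> powr (crit_exp DIM('a) - 2) * u x * \<phi> x \<partial>hyp_vol)))"

definition radial :: "('a::euclidean_space \<Rightarrow> real) \<Rightarrow> bool" where
  "radial u \<longleftrightarrow> (\<forall>x\<in>hyp_ball. \<forall>y\<in>hyp_ball. norm x = norm y \<longrightarrow> u x = u y)"

definition nontrivial :: "('a::euclidean_space \<Rightarrow> real) \<Rightarrow> bool" where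
  "nontrivial u \<longleftrightarrow> \<not> (AE x in hyp_vol. u x = 0)"

definition sign_changing :: "('a::euclidean_space \<Rightarrow> real) \<Rightarrow> bool" where
  "sign_changing u \<longleftrightarrow> emeasure hyp_vol {x \<in> space hyp_vol. u x > 0} > 0 \<and>
                         emeasure hyp_vol {x \<in> space hyp_vol. u x < 0} > 0"

end

theory Submission
  imports Defs
begin

text \<open>
  A radial solution is a function w of the hyperbolic distance r to the origin with
  w'' + (N - 1) coth r w' + \<lambda> w + |w|^q w = 0, q = 4 / (N - 2), w'(0) = 0, and is determined by
  w(0) = \<alpha>. The proof shoots in \<alpha>.

  (1) In Emden--Fowler variables y = (sinh r)^m w, t = ln (tanh (r / 2)), m = (N - 2) / 2, the
  equation becomes y'' = (m^2 - \<phi>) y - |y|^q y with \<phi> = (\<lambda> - N (N - 2) / 4) / sinh^2 t. Because \<phi>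
  increases, the energy is increasing, and it tends to 0 at t = -\<infinity>, so it is positive and the orbit
  stays outside the homoclinic loop of the autonomous equation. A bubble at time t raises the energy
  to at least c exp (2 t), and with this energy the next bubble, of opposite sign, comes within time
  (2 / m1) |t| + C, for any m1 < m. As m > 2 exactly when N \<ge> 7, and the first bubble moves to t = -\<infinity> as \<alpha> grows, the
  number of sign changes tends to infinity with \<alpha>.

  (2) As \<lambda> < ((N - 1) / 2)^2, at infinity either w decays faster than exp (- c r) for some
  c > (N - 1) / 2, or w keeps its sign from some radius on, uniformly for neighbouring \<alpha>. If only the
  second case occurred on an interval of initial values, the limiting Pruefer angle, counted in half
  turns, would be locally constant there, contradicting (1). Hence fast solutions exist for
  arbitrarily large \<alpha>.

  (3) Fast solutions lie in H^1 (approximation by smooth cutoffs times polynomials in |x|^2) and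
  solve the equation weakly, by the divergence theorem for the field conf^(N-2) grad u.
\<close>

section \<open>Radial solutions\<close>

text \<open>The estimates on bubbles must be uniform in the initial value \<alpha>, since the number
  of sign changes is to grow with \<alpha>. Hence the constants live in \<open>ef_params\<close>,
  which knows only m, lt and q, and the first bubble is found by scaling: w stays above \<alpha> / 2
  up to a radius of order \<open>\<alpha> powr (- qq / 2)\<close> for large \<alpha>, and
  \<open>mm * qq = 2\<close> bounds y there from below independently of \<alpha>. The alternative at
  infinity is decided at one radius. With \<open>ex\<close> strictly between (N - 1) / 2 and the
  faster decay rate of w'' + (N - 1) w' + lam w = 0, the product of w exp (ex r) and its derivative,
  once positive at small energy, stays positive. This is an open condition in \<alpha>, so without
  fast solutions the sign count could not jump. The coefficient coth r is singular at the origin;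
  working with the flux z, a weighted integral of the nonlinearity, keeps everything continuous down
  to r = 0. On the ball the profile is a function of s = |x|^2, since polynomials in s are smooth
  functions of x and the flux becomes a continuous radial vector field.\<close>

lemma continuous_on_Ici_integral:
  fixes f :: "real \<Rightarrow> real"
  assumes "continuous_on {0..} f"
  shows "continuous_on {0..} (\<lambda>r. integral {0..r} f)"
proof -
  have "continuous (at r within {0..}) (\<lambda>r. integral {0..r} f)" if "r \<ge> 0" for r
  proof -
    have "continuous_on {0..r+1} (\<lambda>r. integral {0..r} f)"
      by (intro indefinite_integral_continuous_1 integrable_continuous_real continuous_on_subset[OF assms]) auto
    then have "continuous (at r within {0..r+1}) (\<lambda>r. integral {0..r} f)"
      using that by (auto simp: continuous_on_eq_continuous_within)
    moreover have "at r within {0..r+1} = at r within {0..}"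
      by (rule at_within_nhd[of _ "{..<r+1}"]) auto
    ultimately show ?thesis by (simp add: continuous_within)
  qed
  then show ?thesis by (auto simp: continuous_on_eq_continuous_within)
qed

lemma integral_Ici_has_real_derivative:
  fixes f :: "real \<Rightarrow> real"
  assumes "continuous_on {0..} f" "0 < r"
  shows "((\<lambda>x. integral {0..x} f) has_real_derivative f r) (at r)"
proof -
  have "((\<lambda>x. integral {0..x} f) has_real_derivative f r) (at r within {0..r+1})"
    by (intro integral_has_real_derivative continuous_on_subset[OF assms(1)]) (use assms in auto)
  moreover have "at r within {0..r+1} = at r"
    by (rule at_within_interior) (use assms in auto)
  ultimately show ?thesis by simp
qed

lemma integral_exp_bound:
  fixes f :: "real \<Rightarrow> real"
  assumes cont: "continuous_on {0..r} f" and "0 \<le> r" "0 < \<beta>" "0 \<le> C"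
    and bd: "\<And>s. s \<in> {0..r} \<Longrightarrow> \<bar>f s\<bar> \<le> C * exp (\<beta> * s)"
  shows "\<bar>integral {0..r} f\<bar> \<le> C / \<beta> * exp (\<beta> * r)"
proof -
  have I: "((\<lambda>s. C * exp (\<beta> * s)) has_integral (C/\<beta> * exp (\<beta> * r) - C/\<beta> * exp (\<beta> * 0))) {0..r}"
    by (rule fundamental_theorem_of_calculus)
       (use assms in \<open>auto intro!: derivative_eq_intros simp: has_real_derivative_iff_has_vector_derivative[symmetric]\<close>)
  have "norm (integral {0..r} f) \<le> integral {0..r} (\<lambda>s. C * exp (\<beta> * s))"
    by (rule Henstock_Kurzweil_Integration.integral_norm_bound_integral)
       (use bd integrable_continuous_real[OF cont] I in auto)
  also have "\<dots> = C/\<beta> * exp (\<beta> * r) - C/\<beta>" using I by (simp only: integral_unique) simp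
  also have "\<dots> \<le> C/\<beta> * exp (\<beta> * r)" using assms by simp
  finally show ?thesis by simp
qed

lemma sinh_power_mono: "0 \<le> x \<Longrightarrow> x \<le> s \<Longrightarrow> sinh x ^ d \<le> sinh (s::real) ^ d"
  by (intro power_mono) auto

text \<open>As sinh increases on the nonnegative axis, its power can be taken out of the integral at
  the upper limit; dividing by \<open>sinh s ^ d\<close> later cancels it, so the singular weight
  does no harm near 0.\<close>

lemma flux_bound_exp:
  fixes g :: "real \<Rightarrow> real"
  assumes "continuous_on {0..s} g" "0 \<le> s" "0 < \<beta>" "0 \<le> C"
    "\<And>x. x \<in> {0..s} \<Longrightarrow> \<bar>g x\<bar> \<le> C * exp (\<beta> * x)"
  shows "\<bar>integral {0..s} (\<lambda>x. sinh x ^ d * g x)\<bar> \<le> sinh s ^ d * (C / \<beta> * exp (\<beta> * s))"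
proof -
  have "\<bar>integral {0..s} (\<lambda>x. sinh x ^ d * g x)\<bar> \<le> (sinh s ^ d * C) / \<beta> * exp (\<beta> * s)"
  proof (rule integral_exp_bound)
    show "continuous_on {0..s} (\<lambda>x. sinh x ^ d * g x)"
      by (intro continuous_intros assms)
    fix x assume x: "x \<in> {0..s}"
    have "\<bar>sinh x ^ d * g x\<bar> = sinh x ^ d * \<bar>g x\<bar>" using x by (simp add: abs_mult)
    also have "\<dots> \<le> sinh s ^ d * (C * exp (\<beta> * x))"
      by (intro mult_mono assms sinh_power_mono) (use x in auto)
    finally show "\<bar>sinh x ^ d * g x\<bar> \<le> sinh s ^ d * C * exp (\<beta> * x)" by (simp add: mult.assoc)
  qed (use assms in auto)
  then show ?thesis by (simp add: field_simps)
qed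

lemma flux_bound:
  fixes g :: "real \<Rightarrow> real"
  assumes "continuous_on {0..s} g" "0 \<le> s" "\<And>x. x \<in> {0..s} \<Longrightarrow> \<bar>g x\<bar> \<le> C"
  shows "\<bar>integral {0..s} (\<lambda>x. sinh x ^ d * g x)\<bar> \<le> sinh s ^ d * (C * s)"
proof -
  have "norm (integral {0..s} (\<lambda>x. sinh x ^ d * g x)) \<le> (sinh s ^ d * C) * (s - 0)"
  proof (rule integral_bound)
    show "continuous_on {0..s} (\<lambda>x. sinh x ^ d * g x)"
      by (intro continuous_intros assms)
    fix x assume x: "x \<in> {0..s}"
    have "\<bar>sinh x ^ d * g x\<bar> = sinh x ^ d * \<bar>g x\<bar>" using x by (simp add: abs_mult)
    also have "\<dots> \<le> sinh s ^ d * C"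
      by (intro mult_mono assms sinh_power_mono) (use x in auto)
    finally show "norm (sinh x ^ d * g x) \<le> sinh s ^ d * C" by simp
  qed (use assms in auto)
  then show ?thesis by (simp add: field_simps)
qed

text \<open>Only s = 0 needs care: \<open>flux_bound\<close> squeezes the quotient by C * s, and its
  value at 0 is 0 because the integral there is over a point.\<close>

lemma continuous_on_flux_quotient:
  fixes g :: "real \<Rightarrow> real"
  assumes "continuous_on {0..} g" "d \<ge> 1"
  shows "continuous_on {0..} (\<lambda>s. integral {0..s} (\<lambda>x. sinh x ^ d * g x) / sinh s ^ d)"
proof -
  let ?f = "\<lambda>s. integral {0..s} (\<lambda>x. sinh x ^ d * g x) / sinh s ^ d"
  have c: "continuous_on {0..} (\<lambda>s. integral {0..s} (\<lambda>x. sinh x ^ d * g x))"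
    by (intro continuous_on_Ici_integral continuous_intros assms)
  have "continuous (at s within {0..}) ?f" if "s \<ge> 0" for s
  proof (cases "s = 0")
    case False
    have "continuous (at s within {0..}) (\<lambda>s. integral {0..s} (\<lambda>x. sinh x ^ d * g x))"
      using c that by (auto simp: continuous_on_eq_continuous_within)
    then show ?thesis using False that
      by (intro continuous_intros) auto
  next
    case True
    have "compact (g ` {0..1})"
      by (intro compact_continuous_image continuous_on_subset[OF assms(1)]) auto
    then have "bounded (g ` {0..1})" by (rule compact_imp_bounded)
    then obtain C where C: "\<And>x. x \<in> {0..1} \<Longrightarrow> \<bar>g x\<bar> \<le> C"
      unfolding bounded_iff by fastforce
    have bd: "\<bar>?f x\<bar> \<le> C * x" if "x \<in> {0..1}" for x
    proof (cases "x = 0")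
      case False
      have "\<bar>integral {0..x} (\<lambda>x. sinh x ^ d * g x)\<bar> \<le> sinh x ^ d * (C * x)"
        by (rule flux_bound) (use that C in \<open>auto intro: continuous_on_subset[OF assms(1)]\<close>)
      then show ?thesis using False that by (simp add: field_simps abs_mult)
    qed simp
    have ev: "eventually (\<lambda>x::real. x \<in> {0..1}) (at 0 within {0..})"
      unfolding eventually_at by (rule exI[of _ 1]) (auto simp: dist_real_def)
    have "(?f \<longlongrightarrow> 0) (at 0 within {0..})"
    proof (rule Lim_null_comparison)
      show "\<forall>\<^sub>F x in at 0 within {0..}. norm (?f x) \<le> C * x"
        using ev by eventually_elim (use bd in auto)
      show "((\<lambda>x. C * x) \<longlongrightarrow> 0) (at 0 within {0..})" by (auto intro!: tendsto_eq_intros)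
    qed
    then show ?thesis using True by (simp add: continuous_within)
  qed
  then show ?thesis by (auto simp: continuous_on_eq_continuous_within)
qed

text \<open>The equation w'' + d coth r w' + H(w) = 0 as a first order system, with the flux
  z = - (sinh r)^d w'. At r = 0 the coefficients are singular and only continuity is asked for.\<close>

definition radial_sol :: "nat \<Rightarrow> (real \<Rightarrow> real) \<Rightarrow> (real \<Rightarrow> real) \<Rightarrow> (real \<Rightarrow> real) \<Rightarrow> bool" where
  "radial_sol d H w z \<longleftrightarrow> continuous_on {0..} w \<and> continuous_on {0..} z \<and> z 0 = 0 \<and>
     (\<forall>r>0. (w has_real_derivative - z r / sinh r ^ d) (at r) \<and>
            (z has_real_derivative sinh r ^ d * H (w r)) (at r))"

text \<open>The interior form of the fundamental theorem asks for derivatives at r > 0 and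
  continuity at 0, which is all that \<open>radial_sol\<close> provides.\<close>

lemma radial_sol_flux_eq:
  assumes sol: "radial_sol d H w z" and "r \<ge> 0" and H: "continuous_on UNIV H"
  shows "z r = integral {0..r} (\<lambda>x. sinh x ^ d * H (w x))"
proof -
  have cw: "continuous_on {0..} w" and cz: "continuous_on {0..} z" using sol by (auto simp: radial_sol_def)
  have cH: "continuous_on {0..} (\<lambda>x. H (w x))"
    by (rule continuous_on_compose2[OF H cw]) auto
  have "((\<lambda>x. sinh x ^ d * H (w x)) has_integral (z r - z 0)) {0..r}"
    by (rule fundamental_theorem_of_calculus_interior)
       (use sol assms in \<open>auto simp: radial_sol_def has_real_derivative_iff_has_vector_derivative intro: continuous_on_subset\<close>)
  then show ?thesis using sol by (simp add: radial_sol_def integral_unique)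
qed

lemma radial_sol_value_eq:
  assumes sol: "radial_sol d H w z" and "r \<ge> 0"
  shows "w r = w 0 - integral {0..r} (\<lambda>x. z x / sinh x ^ d)"
proof -
  have cw: "continuous_on {0..} w" using sol by (auto simp: radial_sol_def)
  have "((\<lambda>x. - z x / sinh x ^ d) has_integral (w r - w 0)) {0..r}"
    by (rule fundamental_theorem_of_calculus_interior)
       (use sol assms in \<open>auto simp: radial_sol_def has_real_derivative_iff_has_vector_derivative intro: continuous_on_subset[OF cw]\<close>)
  then have "((\<lambda>x. z x / sinh x ^ d) has_integral - (w r - w 0)) {0..r}"
    by (auto dest: has_integral_neg)
  then show ?thesis by (simp add: integral_unique)
qed

text \<open>Recovers w'(0) = 0, which \<open>radial_sol\<close> does not state, in quantitative
  form.\<close>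

lemma radial_sol_velocity_bound:
  assumes sol: "radial_sol d H w z" and "r \<ge> 0" and H: "continuous_on UNIV H"
    and C: "\<And>x. x \<in> {0..r} \<Longrightarrow> \<bar>H (w x)\<bar> \<le> C"
  shows "\<bar>z r / sinh r ^ d\<bar> \<le> C * r"
proof (cases "r = 0")
  case True then show ?thesis using sol by (simp add: radial_sol_def)
next
  case False
  have cw: "continuous_on {0..} w" using sol by (auto simp: radial_sol_def)
  have cH: "continuous_on {0..r} (\<lambda>x. H (w x))"
    by (rule continuous_on_compose2[OF H continuous_on_subset[OF cw]]) auto
  have "\<bar>z r\<bar> \<le> sinh r ^ d * (C * r)"
    unfolding radial_sol_flux_eq[OF assms(1-3)] by (rule flux_bound[OF cH assms(2) C])
  then show ?thesis using False assms(2) by (simp add: field_simps abs_mult)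
qed

lemma radial_sol_velocity_continuous:
  assumes sol: "radial_sol d H w z" and H: "continuous_on UNIV H" and "d \<ge> 1"
  shows "continuous_on {0..} (\<lambda>r. z r / sinh r ^ d)"
proof -
  have cw: "continuous_on {0..} w" using sol by (auto simp: radial_sol_def)
  have "continuous_on {0..} (\<lambda>s. integral {0..s} (\<lambda>x. sinh x ^ d * H (w x)) / sinh s ^ d)"
    by (intro continuous_on_flux_quotient continuous_on_compose2[OF H cw] assms) auto
  then show ?thesis
    by (rule continuous_on_eq) (use radial_sol_flux_eq[OF sol _ H] in auto)
qed

section \<open>Global solutions and dependence on the initial value for a Lipschitz
  nonlinearity\<close>

locale radial_lipschitz =
  fixes d :: nat and H :: "real \<Rightarrow> real" and L :: real
  assumes d1: "d \<ge> 1" and L0: "L > 0" and lip: "\<And>a b. \<bar>H a - H b\<bar> \<le> L * \<bar>a - b\<bar>"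
begin

text \<open>Each of the two integrations in \<open>Pic\<close> gains a factor 1 / wt on functions
  bounded by exp (wt r), and L / wt^2 = 1 / 2.\<close>

definition "wt = sqrt (2 * L)"

lemma wt_pos: "wt > 0" and wt_sq: "wt * wt = 2 * L"
  using L0 by (auto simp: wt_def)

lemma cont_H: "continuous_on S H"
proof (rule lipschitz_on_continuous_on)
  show "L-lipschitz_on S H" using lip L0 by (intro lipschitz_onI) (auto simp: dist_real_def)
qed

definition Flux :: "(real \<Rightarrow> real) \<Rightarrow> real \<Rightarrow> real" where
  "Flux w r = integral {0..r} (\<lambda>x. sinh x ^ d * H (w x))"

definition Pic :: "real \<Rightarrow> (real \<Rightarrow> real) \<Rightarrow> real \<Rightarrow> real" where
  "Pic \<alpha> w r = \<alpha> - integral {0..r} (\<lambda>s. Flux w s / sinh s ^ d)"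

lemma cont_Hw: "continuous_on S w \<Longrightarrow> continuous_on S (\<lambda>x. H (w x))"
  by (rule continuous_on_compose2[OF cont_H[of UNIV]]) auto

lemma cont_vel: "continuous_on {0..} w \<Longrightarrow> continuous_on {0..} (\<lambda>s. Flux w s / sinh s ^ d)"
  unfolding Flux_def by (intro continuous_on_flux_quotient cont_Hw d1)

lemma cont_Pic: "continuous_on {0..} w \<Longrightarrow> continuous_on {0..} (Pic \<alpha> w)"
  unfolding Pic_def by (intro continuous_intros continuous_on_Ici_integral cont_vel)

lemma Flux_diff:
  assumes c1: "continuous_on {0..} w1" and c2: "continuous_on {0..} w2" and "D \<ge> 0" "r \<ge> 0"
    and D: "\<And>s. s \<ge> 0 \<Longrightarrow> \<bar>w1 s - w2 s\<bar> \<le> D * exp (wt * s)"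
  shows "\<bar>Flux w1 r - Flux w2 r\<bar> \<le> sinh r ^ d * (L * D / wt * exp (wt * r))"
proof -
  have c: "continuous_on {0..r} w1" "continuous_on {0..r} w2"
    using c1 c2 by (auto intro: continuous_on_subset)
  have "Flux w1 r - Flux w2 r = integral {0..r} (\<lambda>x. sinh x ^ d * H (w1 x) - sinh x ^ d * H (w2 x))"
    unfolding Flux_def by (rule integral_diff[symmetric]; intro integrable_continuous_real continuous_intros cont_Hw c)
  also have "\<dots> = integral {0..r} (\<lambda>x. sinh x ^ d * (H (w1 x) - H (w2 x)))"
    by (simp add: algebra_simps)
  also have "\<bar>\<dots>\<bar> \<le> sinh r ^ d * (L * D / wt * exp (wt * r))"
  proof (rule flux_bound_exp)
    show "continuous_on {0..r} (\<lambda>x. H (w1 x) - H (w2 x))" by (intro continuous_intros cont_Hw c)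
    fix x assume x: "x \<in> {0..r}"
    have "\<bar>H (w1 x) - H (w2 x)\<bar> \<le> L * \<bar>w1 x - w2 x\<bar>" by (rule lip)
    also have "\<dots> \<le> L * (D * exp (wt * x))" using D[of x] x L0 by (intro mult_left_mono) auto
    finally show "\<bar>H (w1 x) - H (w2 x)\<bar> \<le> L * D * exp (wt * x)" by simp
  qed (use assms wt_pos L0 in auto)
  finally show ?thesis .
qed

text \<open>Two initial values are allowed so that one estimate serves both the iteration and the
  dependence on the initial value.\<close>

lemma Pic_diff:
  assumes c1: "continuous_on {0..} w1" and c2: "continuous_on {0..} w2" and "D \<ge> 0" "r \<ge> 0"
    and D: "\<And>s. s \<ge> 0 \<Longrightarrow> \<bar>w1 s - w2 s\<bar> \<le> D * exp (wt * s)"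
  shows "\<bar>Pic \<alpha> w1 r - Pic \<beta> w2 r\<bar> \<le> \<bar>\<alpha> - \<beta>\<bar> + D / 2 * exp (wt * r)"
proof -
  have c: "continuous_on {0..r} (\<lambda>s. Flux w1 s / sinh s ^ d)" "continuous_on {0..r} (\<lambda>s. Flux w2 s / sinh s ^ d)"
    by (rule continuous_on_subset[OF cont_vel[OF c1]] continuous_on_subset[OF cont_vel[OF c2]]; auto)+
  have "integral {0..r} (\<lambda>s. Flux w1 s / sinh s ^ d) - integral {0..r} (\<lambda>s. Flux w2 s / sinh s ^ d)
      = integral {0..r} (\<lambda>s. Flux w1 s / sinh s ^ d - Flux w2 s / sinh s ^ d)" (is "?I1 - ?I2 = _")
    by (rule integral_diff[symmetric]; intro integrable_continuous_real c)
  also have "\<bar>\<dots>\<bar> \<le> (L * D / wt) / wt * exp (wt * r)"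
  proof (rule integral_exp_bound)
    show "continuous_on {0..r} (\<lambda>s. Flux w1 s / sinh s ^ d - Flux w2 s / sinh s ^ d)"
      by (intro continuous_intros c)
    fix s assume s: "s \<in> {0..r}"
    show "\<bar>Flux w1 s / sinh s ^ d - Flux w2 s / sinh s ^ d\<bar> \<le> L * D / wt * exp (wt * s)"
    proof (cases "s = 0")
      case False
      have "\<bar>Flux w1 s - Flux w2 s\<bar> \<le> sinh s ^ d * (L * D / wt * exp (wt * s))"
        using s by (intro Flux_diff assms) auto
      then show ?thesis using False s by (simp add: diff_divide_distrib[symmetric] abs_mult divide_le_eq mult.commute)
    qed (use L0 wt_pos assms d1 in \<open>simp add: Flux_def\<close>)
  qed (use assms wt_pos L0 in auto)
  also have "(L * D / wt) / wt = D / 2" using wt_sq wt_pos L0 by (simp add: field_simps)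
  finally have *: "\<bar>?I1 - ?I2\<bar> \<le> D / 2 * exp (wt * r)" .
  have "Pic \<alpha> w1 r - Pic \<beta> w2 r = (\<alpha> - \<beta>) - (?I1 - ?I2)" by (simp add: Pic_def)
  then show ?thesis using * by linarith
qed

text \<open>Picard iteration converges in the weighted norm \<^term>\<open>SUP r. \<bar>w r\<bar> / exp (wt * r)\<close>,
  in which the Picard operator contracts by the factor 1/2.\<close>

primrec iter :: "real \<Rightarrow> nat \<Rightarrow> real \<Rightarrow> real" where
  "iter \<alpha> 0 = (\<lambda>_. \<alpha>)"
| "iter \<alpha> (Suc k) = Pic \<alpha> (iter \<alpha> k)"

lemma cont_iter: "continuous_on {0..} (iter \<alpha> k)"
  by (induction k) (auto intro: cont_Pic continuous_intros)

definition "D0 \<alpha> = \<bar>H \<alpha>\<bar> / L"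

lemma iter_step: "r \<ge> 0 \<Longrightarrow> \<bar>iter \<alpha> (Suc k) r - iter \<alpha> k r\<bar> \<le> D0 \<alpha> / 2 ^ k * exp (wt * r)"
proof (induction k arbitrary: r)
  case 0
  have "\<bar>integral {0..r} (\<lambda>s. Flux (\<lambda>_. \<alpha>) s / sinh s ^ d)\<bar> \<le> (\<bar>H \<alpha>\<bar> / wt) / wt * exp (wt * r)"
  proof (rule integral_exp_bound)
    show "continuous_on {0..r} (\<lambda>s. Flux (\<lambda>_. \<alpha>) s / sinh s ^ d)"
      by (rule continuous_on_subset[OF cont_vel]) (auto intro: continuous_intros)
    fix s assume s: "s \<in> {0..r}"
    show "\<bar>Flux (\<lambda>_. \<alpha>) s / sinh s ^ d\<bar> \<le> \<bar>H \<alpha>\<bar> / wt * exp (wt * s)"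
    proof (cases "s = 0")
      case False
      have "\<bar>Flux (\<lambda>_. \<alpha>) s\<bar> \<le> sinh s ^ d * (\<bar>H \<alpha>\<bar> / wt * exp (wt * s))"
        unfolding Flux_def
        by (rule flux_bound_exp) (use s wt_pos in \<open>auto intro!: continuous_intros simp: mult_le_cancel_left1\<close>)
      then show ?thesis using False s by (simp add: abs_mult divide_le_eq mult.commute)
    qed (use d1 wt_pos in \<open>simp add: Flux_def\<close>)
  qed (use 0 wt_pos in auto)
  also have "(\<bar>H \<alpha>\<bar> / wt) / wt = D0 \<alpha> / 2" using wt_sq wt_pos L0 by (simp add: D0_def field_simps)
  also have "D0 \<alpha> / 2 * exp (wt * r) \<le> D0 \<alpha> * exp (wt * r)"
    using L0 by (intro mult_right_mono) (auto simp: D0_def field_simps)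
  finally show ?case by (simp add: Pic_def)
next
  case (Suc k)
  have "\<bar>Pic \<alpha> (iter \<alpha> (Suc k)) r - Pic \<alpha> (iter \<alpha> k) r\<bar> \<le> \<bar>\<alpha> - \<alpha>\<bar> + (D0 \<alpha> / 2 ^ k) / 2 * exp (wt * r)"
    by (rule Pic_diff) (use Suc L0 cont_iter in \<open>auto simp: D0_def simp del: iter.simps\<close>)
  then show ?case by (simp add: field_simps)
qed

definition sol :: "real \<Rightarrow> real \<Rightarrow> real" where
  "sol \<alpha> r = lim (\<lambda>k. iter \<alpha> k r)"

text \<open>The geometric sum of the steps with its exact remainder; the subtracted term is what
  lets the induction on j close.\<close>

lemma iter_close: "r \<ge> 0 \<Longrightarrow> \<bar>iter \<alpha> (k + j) r - iter \<alpha> k r\<bar> \<le> 2 * D0 \<alpha> * (1 / 2 ^ k - 1 / 2 ^ (k+j)) * exp (wt * r)"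
proof (induction j)
  case (Suc j)
  have "\<bar>iter \<alpha> (k + Suc j) r - iter \<alpha> k r\<bar> \<le> \<bar>iter \<alpha> (Suc (k + j)) r - iter \<alpha> (k + j) r\<bar> + \<bar>iter \<alpha> (k + j) r - iter \<alpha> k r\<bar>"
    by simp
  also have "\<dots> \<le> D0 \<alpha> / 2 ^ (k + j) * exp (wt * r) + 2 * D0 \<alpha> * (1 / 2 ^ k - 1 / 2 ^ (k+j)) * exp (wt * r)"
    using iter_step[OF Suc.prems, of \<alpha> "k+j"] Suc by linarith
  also have "\<dots> = 2 * D0 \<alpha> * (1 / 2 ^ k - 1 / 2 ^ (k + Suc j)) * exp (wt * r)"
    by (simp add: field_simps)
  finally show ?case .
qed simp

lemma D0_nonneg: "D0 \<alpha> \<ge> 0" using L0 by (simp add: D0_def)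

lemma iter_close': "r \<ge> 0 \<Longrightarrow> \<bar>iter \<alpha> (k + j) r - iter \<alpha> k r\<bar> \<le> 2 * D0 \<alpha> / 2 ^ k * exp (wt * r)"
proof -
  assume r: "r \<ge> 0"
  have "2 * D0 \<alpha> * (1 / 2 ^ k - 1 / 2 ^ (k+j)) * exp (wt * r) \<le> 2 * D0 \<alpha> * (1 / 2 ^ k) * exp (wt * r)"
    by (intro mult_right_mono mult_left_mono) (use D0_nonneg in auto)
  with iter_close[OF r, of \<alpha> k j] show ?thesis by simp
qed

lemma iter_lim: assumes "r \<ge> 0" shows "(\<lambda>k. iter \<alpha> k r) \<longlonglongrightarrow> sol \<alpha> r"
proof -
  have "Cauchy (\<lambda>k. iter \<alpha> k r)"
  proof (rule CauchyI')
    fix e :: real assume e: "e > 0"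
    have "(\<lambda>k. 2 * D0 \<alpha> / 2 ^ k * exp (wt * r)) \<longlonglongrightarrow> 2 * D0 \<alpha> * 0 * exp (wt * r)"
      unfolding divide_inverse power_inverse[symmetric]
      by (intro tendsto_intros LIMSEQ_power_zero) auto
    then have "(\<lambda>k. 2 * D0 \<alpha> / 2 ^ k * exp (wt * r)) \<longlonglongrightarrow> 0" by simp
    then have "\<forall>\<^sub>F k in sequentially. 2 * D0 \<alpha> / 2 ^ k * exp (wt * r) < e"
      using e by (rule order_tendstoD)
    then obtain M where M: "2 * D0 \<alpha> / 2 ^ M' * exp (wt * r) < e" if "M' \<ge> M" for M'
      by (auto simp: eventually_sequentially)
    have "dist (iter \<alpha> a r) (iter \<alpha> b r) < e" if "a \<ge> M" "b > a" for a b
      using iter_close'[OF assms, of \<alpha> a "b - a"] M[of a] that by (simp add: dist_real_def)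
    then show "\<exists>M. \<forall>m\<ge>M. \<forall>n>m. dist (iter \<alpha> m r) (iter \<alpha> n r) < e" by blast
  qed
  then show ?thesis
    unfolding sol_def using Cauchy_convergent_iff convergent_LIMSEQ_iff by blast
qed

lemma sol_close: assumes "r \<ge> 0" shows "\<bar>sol \<alpha> r - iter \<alpha> k r\<bar> \<le> 2 * D0 \<alpha> / 2 ^ k * exp (wt * r)"
proof (rule LIMSEQ_le_const2)
  show "(\<lambda>j. \<bar>iter \<alpha> (j + k) r - iter \<alpha> k r\<bar>) \<longlonglongrightarrow> \<bar>sol \<alpha> r - iter \<alpha> k r\<bar>"
    by (intro tendsto_intros LIMSEQ_ignore_initial_segment iter_lim assms)
  show "\<exists>N. \<forall>n\<ge>N. \<bar>iter \<alpha> (n + k) r - iter \<alpha> k r\<bar> \<le> 2 * D0 \<alpha> / 2 ^ k * exp (wt * r)"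
    using iter_close'[OF assms, of \<alpha> k] by (simp add: add.commute)
qed

lemma weight_to_0: "(\<lambda>k. C / 2 ^ k * (E::real)) \<longlonglongrightarrow> 0"
proof -
  have "(\<lambda>k. C * (1/2) ^ k * E) \<longlonglongrightarrow> C * 0 * E"
    by (intro tendsto_intros LIMSEQ_power_zero) auto
  then show ?thesis by (simp add: power_divide)
qed

lemma cont_sol: "continuous_on {0..} (sol \<alpha>)"
proof -
  have c: "continuous_on {0..R} (sol \<alpha>)" for R
  proof (rule uniform_limit_theorem[where F = sequentially])
    show "\<forall>\<^sub>F k in sequentially. continuous_on {0..R} (iter \<alpha> k)"
      by (intro always_eventually allI continuous_on_subset[OF cont_iter]) auto
    show "uniform_limit {0..R} (iter \<alpha>) (sol \<alpha>) sequentially"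
    proof (rule uniform_limitI)
      fix e :: real assume "e > 0"
      then have "\<forall>\<^sub>F k in sequentially. 2 * D0 \<alpha> / 2 ^ k * exp (wt * R) < e"
        using weight_to_0 by (rule order_tendstoD[rotated])
      then show "\<forall>\<^sub>F k in sequentially. \<forall>x\<in>{0..R}. dist (iter \<alpha> k x) (sol \<alpha> x) < e"
      proof eventually_elim
        case (elim k)
        show ?case
        proof
          fix x assume x: "x \<in> {0..R}"
          have "\<bar>sol \<alpha> x - iter \<alpha> k x\<bar> \<le> 2 * D0 \<alpha> / 2 ^ k * exp (wt * x)" using sol_close x by auto
          also have "\<dots> \<le> 2 * D0 \<alpha> / 2 ^ k * exp (wt * R)"
            using x wt_pos D0_nonneg by (intro mult_left_mono) auto
          finally show "dist (iter \<alpha> k x) (sol \<alpha> x) < e" using elim by (simp add: dist_real_def abs_minus_commute)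
        qed
      qed
    qed
  qed auto
  have "continuous (at r within {0..}) (sol \<alpha>)" if "r \<ge> 0" for r
  proof -
    have "continuous (at r within {0..r+1}) (sol \<alpha>)"
      using c[of "r+1"] that by (auto simp: continuous_on_eq_continuous_within)
    moreover have "at r within {0..r+1} = at r within {0..}"
      by (rule at_within_nhd[of _ "{..<r+1}"]) auto
    ultimately show ?thesis by (simp add: continuous_within)
  qed
  then show ?thesis by (auto simp: continuous_on_eq_continuous_within)
qed

lemma sol_fixed: assumes "r \<ge> 0" shows "Pic \<alpha> (sol \<alpha>) r = sol \<alpha> r"
proof -
  have "(\<lambda>k. iter \<alpha> (Suc k) r - Pic \<alpha> (sol \<alpha>) r) \<longlonglongrightarrow> 0"
  proof (rule Lim_null_comparison)
    show "\<forall>\<^sub>F k in sequentially. norm (iter \<alpha> (Suc k) r - Pic \<alpha> (sol \<alpha>) r) \<le> 2 * D0 \<alpha> / 2 ^ k * (exp (wt * r) / 2)"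
    proof (intro always_eventually allI)
      fix k
      have "\<bar>Pic \<alpha> (iter \<alpha> k) r - Pic \<alpha> (sol \<alpha>) r\<bar> \<le> \<bar>\<alpha> - \<alpha>\<bar> + (2 * D0 \<alpha> / 2 ^ k) / 2 * exp (wt * r)"
        by (rule Pic_diff)
           (use sol_close cont_iter cont_sol D0_nonneg assms in \<open>auto simp: abs_minus_commute\<close>)
      then show "norm (iter \<alpha> (Suc k) r - Pic \<alpha> (sol \<alpha>) r) \<le> 2 * D0 \<alpha> / 2 ^ k * (exp (wt * r) / 2)" by simp
    qed
  qed (rule weight_to_0)
  then have "(\<lambda>k. iter \<alpha> (Suc k) r) \<longlonglongrightarrow> Pic \<alpha> (sol \<alpha>) r" by (simp add: LIM_zero_iff)
  moreover have "(\<lambda>k. iter \<alpha> (Suc k) r) \<longlonglongrightarrow> sol \<alpha> r"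
    using LIMSEQ_Suc[OF iter_lim[OF assms]] .
  ultimately show ?thesis by (rule LIMSEQ_unique)
qed

lemma sol_0: "sol \<alpha> 0 = \<alpha>"
  using sol_fixed[of 0 \<alpha>] by (simp add: Pic_def)

lemma radial_sol_sol: "radial_sol d H (sol \<alpha>) (Flux (sol \<alpha>))"
proof -
  have c: "continuous_on {0..} (\<lambda>x. sinh x ^ d * H (sol \<alpha> x))"
    by (intro continuous_intros cont_Hw cont_sol)
  have "(sol \<alpha> has_real_derivative - Flux (sol \<alpha>) r / sinh r ^ d) (at r)" if "r > 0" for r
  proof -
    have "(Pic \<alpha> (sol \<alpha>) has_real_derivative 0 - Flux (sol \<alpha>) r / sinh r ^ d) (at r)"
      unfolding Pic_def
      by (intro DERIV_diff DERIV_const integral_Ici_has_real_derivative cont_vel cont_sol that)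
    moreover have "\<forall>\<^sub>F x in nhds r. Pic \<alpha> (sol \<alpha>) x = sol \<alpha> x"
    proof -
      have "\<forall>\<^sub>F x in nhds r. x \<in> {0<..}" by (rule eventually_nhds_in_open) (use that in auto)
      then show ?thesis by eventually_elim (auto intro: sol_fixed)
    qed
    ultimately show ?thesis by (subst (asm) DERIV_cong_ev[OF refl _ refl]) auto
  qed
  moreover have "(Flux (sol \<alpha>) has_real_derivative sinh r ^ d * H (sol \<alpha> r)) (at r)" if "r > 0" for r
    unfolding Flux_def using integral_Ici_has_real_derivative[OF c that] .
  moreover have "continuous_on {0..} (Flux (sol \<alpha>))"
    unfolding Flux_def by (rule continuous_on_Ici_integral[OF c])
  ultimately show ?thesis by (auto simp: radial_sol_def cont_sol Flux_def)
qed

lemma radial_sol_Flux: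
  assumes "radial_sol d H w z" "r \<ge> 0" shows "z r = Flux w r"
  using radial_sol_flux_eq[OF assms cont_H] by (simp add: Flux_def)

lemma radial_sol_Pic:
  assumes "radial_sol d H w z" "r \<ge> 0" shows "w r = Pic (w 0) w r"
proof -
  have "integral {0..r} (\<lambda>x. z x / sinh x ^ d) = integral {0..r} (\<lambda>x. Flux w x / sinh x ^ d)"
    by (rule integral_cong) (use radial_sol_Flux[OF assms(1)] in auto)
  then show ?thesis using radial_sol_value_eq[OF assms] by (simp add: Pic_def)
qed

text \<open>Each use of \<open>Pic_diff\<close> halves D, while the contributions of the initial
  values sum to at most twice their distance; k to infinity removes D. Some finite D must be known
  beforehand, so a growth bound is part of the hypotheses.\<close>

lemma radial_sol_dependence:
  assumes s1: "radial_sol d H w1 z1" and s2: "radial_sol d H w2 z2"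
    and D: "\<And>r. r \<ge> 0 \<Longrightarrow> \<bar>w1 r - w2 r\<bar> \<le> D * exp (wt * r)" and "r \<ge> 0"
  shows "\<bar>w1 r - w2 r\<bar> \<le> 2 * \<bar>w1 0 - w2 0\<bar> * exp (wt * r)"
proof -
  define a where "a = \<bar>w1 0 - w2 0\<bar>"
  have "0 \<le> D" using D[of 0] by simp
  have c: "continuous_on {0..} w1" "continuous_on {0..} w2" using s1 s2 by (auto simp: radial_sol_def)
  have *: "\<bar>w1 r - w2 r\<bar> \<le> (2 * a + D / 2 ^ k) * exp (wt * r)" if "r \<ge> 0" for r k
    using that
  proof (induction k arbitrary: r)
    case 0
    have "D * exp (wt * r) \<le> (2 * a + D / 2 ^ 0) * exp (wt * r)"
      by (intro mult_right_mono) (auto simp: a_def)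
    then show ?case using D[OF 0] by linarith
  next
    case (Suc k)
    have "\<bar>w1 r - w2 r\<bar> = \<bar>Pic (w1 0) w1 r - Pic (w2 0) w2 r\<bar>"
      using radial_sol_Pic[OF s1 Suc.prems] radial_sol_Pic[OF s2 Suc.prems] by simp
    also have "\<dots> \<le> a + (2 * a + D / 2 ^ k) / 2 * exp (wt * r)"
      unfolding a_def by (rule Pic_diff[OF c]) (use Suc \<open>0 \<le> D\<close> in \<open>auto simp: a_def\<close>)
    finally have "\<bar>w1 r - w2 r\<bar> \<le> a + (2 * a + D / 2 ^ k) / 2 * exp (wt * r)" .
    moreover have "a \<le> a * exp (wt * r)"
      using Suc.prems wt_pos by (auto simp: a_def mult_le_cancel_left1)
    ultimately have "\<bar>w1 r - w2 r\<bar> \<le> a * exp (wt * r) + (2 * a + D / 2 ^ k) / 2 * exp (wt * r)" by linarith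
    also have "\<dots> = (2 * a + D / 2 ^ Suc k) * exp (wt * r)" by (simp add: field_simps)
    finally show ?case .
  qed
  have "(\<lambda>k. 2 * a * exp (wt * r) + D / 2 ^ k * exp (wt * r)) \<longlonglongrightarrow> 2 * a * exp (wt * r) + 0"
    by (intro tendsto_intros weight_to_0)
  then show ?thesis
    unfolding a_def[symmetric] using *[OF assms(4)]
    by (intro LIMSEQ_le_const[where X = "\<lambda>k. 2 * a * exp (wt * r) + D / 2 ^ k * exp (wt * r)"])
       (auto simp: distrib_right)
qed

lemma sol_growth: "r \<ge> 0 \<Longrightarrow> \<bar>sol \<alpha> r\<bar> \<le> (\<bar>\<alpha>\<bar> + 2 * D0 \<alpha>) * exp (wt * r)"
proof -
  assume r: "r \<ge> 0"
  have "\<bar>\<alpha>\<bar> \<le> \<bar>\<alpha>\<bar> * exp (wt * r)" using r wt_pos by (simp add: mult_le_cancel_left1)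
  then show ?thesis using sol_close[OF r, of \<alpha> 0] by (simp add: algebra_simps abs_le_iff)
qed

lemma sol_lipschitz:
  assumes "r \<ge> 0" shows "\<bar>sol \<alpha> r - sol \<beta> r\<bar> \<le> 2 * \<bar>\<alpha> - \<beta>\<bar> * exp (wt * r)"
proof -
  have "\<bar>sol \<alpha> s - sol \<beta> s\<bar> \<le> (\<bar>\<alpha>\<bar> + 2 * D0 \<alpha> + (\<bar>\<beta>\<bar> + 2 * D0 \<beta>)) * exp (wt * s)" if "s \<ge> 0" for s
    using sol_growth[OF that, of \<alpha>] sol_growth[OF that, of \<beta>]
    by (simp only: distrib_right[of "\<bar>\<alpha>\<bar> + 2 * D0 \<alpha>"])
  from radial_sol_dependence[OF radial_sol_sol radial_sol_sol this assms] show ?thesis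
    by (simp only: sol_0)
qed

lemma sol_flux_lipschitz:
  assumes "r \<ge> 0"
  shows "\<bar>Flux (sol \<alpha>) r - Flux (sol \<beta>) r\<bar> \<le> sinh r ^ d * (L * (2 * \<bar>\<alpha> - \<beta>\<bar>) / wt * exp (wt * r))"
proof (rule Flux_diff[OF cont_sol cont_sol])
  show "\<bar>sol \<alpha> s - sol \<beta> s\<bar> \<le> 2 * \<bar>\<alpha> - \<beta>\<bar> * exp (wt * s)" if "s \<ge> 0" for s
    by (rule sol_lipschitz[OF that])
qed (use assms in auto)

text \<open>Boundedness supplies the finite weighted distance that
  \<open>radial_sol_dependence\<close> asks for; equal initial values then make the distance
  0.\<close>

lemma bounded_radial_sol_unique:
  assumes s: "radial_sol d H w z" and bd: "\<And>r. r \<ge> 0 \<Longrightarrow> \<bar>w r\<bar> \<le> B" and "r \<ge> 0"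
  shows "w r = sol (w 0) r" "z r = Flux (sol (w 0)) r"
proof -
  have *: "w r = sol (w 0) r" if "r \<ge> 0" for r
  proof -
    have B: "B \<ge> 0" using bd[of 0] by simp
    have "\<bar>w s - sol (w 0) s\<bar> \<le> (B + (\<bar>w 0\<bar> + 2 * D0 (w 0))) * exp (wt * s)" if "s \<ge> 0" for s
    proof -
      have "B \<le> B * exp (wt * s)" using B that wt_pos by (simp add: mult_le_cancel_left1)
      then show ?thesis using bd[OF that] sol_growth[OF that, of "w 0"]
        unfolding distrib_right[of B] by linarith
    qed
    from radial_sol_dependence[OF s radial_sol_sol this that] show ?thesis by (simp add: sol_0)
  qed
  show "w r = sol (w 0) r" by (rule *[OF \<open>r \<ge> 0\<close>])
  have "Flux w r = Flux (sol (w 0)) r"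
    unfolding Flux_def by (rule integral_cong) (metis * atLeastAtMost_iff)
  then show "z r = Flux (sol (w 0)) r" using radial_sol_Flux[OF s \<open>r \<ge> 0\<close>] by simp
qed

end

section \<open>The Emden--Fowler equation\<close>

lemma arsinh_real_nonneg: "x \<ge> 0 \<Longrightarrow> arsinh (x::real) \<ge> 0"
proof -
  assume "x \<ge> 0"
  then show ?thesis by (cases "x = 0") (auto simp: less_imp_le)
qed

lemma first_time:
  fixes f :: "real \<Rightarrow> real"
  assumes "continuous_on {a..b} f" "a \<le> b" "f a < 0" "f b \<ge> 0"
  obtains t where "a < t" "t \<le> b" "f t = 0" "\<And>s. a \<le> s \<Longrightarrow> s < t \<Longrightarrow> f s < 0"
proof -
  define S where "S = {a..b} \<inter> f -` {0..}"
  have cl: "closed S" unfolding S_def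
    by (rule continuous_closed_preimage[OF assms(1)]) auto
  have ne: "b \<in> S" using assms by (auto simp: S_def)
  have bb: "bdd_below S" by (rule bdd_belowI[of _ a]) (auto simp: S_def)
  define t where "t = Inf S"
  have tS: "t \<in> S" unfolding t_def by (rule closed_contains_Inf) (use cl ne bb in auto)
  have less: "f s < 0" if "a \<le> s" "s < t" for s
  proof (rule ccontr)
    assume "\<not> f s < 0"
    then have "s \<in> S" using that tS by (auto simp: S_def)
    then have "t \<le> s" unfolding t_def by (rule cInf_lower) (rule bb)
    then show False using that by simp
  qed
  have ta: "a < t" using tS assms(3) by (auto simp: S_def order.order_iff_strict)
  have "\<exists>x\<ge>a. x \<le> t \<and> f x = 0"
    by (rule IVT') (use tS assms ta in \<open>auto simp: S_def intro: continuous_on_subset\<close>)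
  then obtain x where x: "a \<le> x" "x \<le> t" "f x = 0" by blast
  then have "x = t" using less[of x] by force
  then show ?thesis using that[of t] ta tS x less by (auto simp: S_def)
qed

lemma last_time:
  fixes f :: "real \<Rightarrow> real"
  assumes "continuous_on {a..b} f" "a \<le> b" "f a \<ge> 0" "f b < 0"
  obtains t where "a \<le> t" "t < b" "f t = 0" "\<And>s. t < s \<Longrightarrow> s \<le> b \<Longrightarrow> f s < 0"
proof -
  have c: "continuous_on {-b..-a} (\<lambda>s. f (-s))"
    by (rule continuous_on_compose2[OF assms(1)]) (auto intro!: continuous_intros)
  obtain t where t: "-b < t" "t \<le> -a" "f (-t) = 0" "\<And>s. -b \<le> s \<Longrightarrow> s < t \<Longrightarrow> f (-s) < 0"
    using first_time[OF c] assms by auto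
  have "f s < 0" if "-t < s" "s \<le> b" for s using t(4)[of "-s"] that by auto
  then show ?thesis using that[of "-t"] t by auto
qed

lemma DERIV_abs_powr:
  fixes a :: real assumes "a > 0"
  shows "((\<lambda>u. \<bar>u\<bar> powr (a + 2) / (a + 2)) has_real_derivative \<bar>u\<bar> powr a * u) (at u)"
proof -
  consider "u > 0" | "u < 0" | "u = 0" by linarith
  then show ?thesis
  proof cases
    case 1
    have "((\<lambda>u. u powr (a + 2) / (a + 2)) has_real_derivative u powr a * u) (at u)"
    proof (rule DERIV_cong[OF DERIV_cdivide[OF has_real_derivative_powr[OF 1]]])
      have "u powr (a + 2 - 1) = u powr a * u" using 1 by (simp add: powr_add[of u a 1, simplified] add_diff_eq[symmetric])
      then show "(a + 2) * u powr (a + 2 - 1) / (a + 2) = u powr a * u" using assms by simp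
    qed
    moreover have "\<forall>\<^sub>F x in nhds u. x > 0" using 1 by (rule eventually_nhds_in_open[of "{0<..}", simplified, rotated]) auto
    then have "\<forall>\<^sub>F x in nhds u. \<bar>x\<bar> powr (a + 2) / (a + 2) = x powr (a + 2) / (a + 2)"
      by eventually_elim simp
    ultimately show ?thesis using 1 by (subst DERIV_cong_ev[OF refl _ refl]) auto
  next
    case 2
    have "((\<lambda>u. (-u) powr (a + 2) / (a + 2)) has_real_derivative (-u) powr a * u) (at u)"
    proof -
      have u: "-u > 0" using 2 by simp
      have "((\<lambda>u. (-u) powr (a + 2)) has_real_derivative ((a + 2) * (-u) powr (a + 2 - 1)) * (-1)) (at u)"
        by (rule DERIV_chain2[where f = "\<lambda>x. x powr (a + 2)" and g = uminus, OF has_real_derivative_powr[OF u]]) (auto intro!: derivative_eq_intros)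
      from DERIV_cdivide[OF this, of "a + 2"] show ?thesis
      proof (rule DERIV_cong)
        have "(-u) powr (a + 2 - 1) = (-u) powr a * (-u)" using u by (simp add: powr_add[of "-u" a 1, simplified] add_diff_eq[symmetric])
        then show "(a + 2) * (-u) powr (a + 2 - 1) * (-1) / (a + 2) = (-u) powr a * u" using assms by simp
      qed
    qed
    moreover have "\<forall>\<^sub>F x in nhds u. x < 0" using 2 by (rule eventually_nhds_in_open[of "{..<0}", simplified, rotated]) auto
    then have "\<forall>\<^sub>F x in nhds u. \<bar>x\<bar> powr (a + 2) / (a + 2) = (-x) powr (a + 2) / (a + 2)"
      by eventually_elim simp
    ultimately show ?thesis using 2 by (subst DERIV_cong_ev[OF refl _ refl]) auto
  next
    case 3
    have "((\<lambda>h. \<bar>h\<bar> powr (a + 1) / (a + 2)) \<longlongrightarrow> 0 powr (a + 1) / (a + 2)) (at 0)"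
      using assms by (intro tendsto_intros) (auto intro!: tendsto_eq_intros)
    then have "((\<lambda>h. \<bar>h\<bar> powr (a + 1) / (a + 2)) \<longlongrightarrow> 0) (at 0)" by simp
    moreover have "\<bar>(\<bar>h\<bar> powr (a + 2) / (a + 2)) / h\<bar> = \<bar>h\<bar> powr (a + 1) / (a + 2)" if "h \<noteq> 0" for h
      using that assms by (simp add: powr_add abs_mult power2_eq_square)
    then have "\<forall>\<^sub>F h in at 0. norm ((\<bar>h\<bar> powr (a + 2) / (a + 2)) / h) \<le> \<bar>h\<bar> powr (a + 1) / (a + 2)"
      by (auto simp: eventually_at_filter)
    ultimately have "((\<lambda>h. (\<bar>h\<bar> powr (a + 2) / (a + 2)) / h) \<longlongrightarrow> 0) (at 0)"
      by (rule Lim_null_comparison[rotated])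
    then show ?thesis using 3 by (simp add: DERIV_def)
  qed
qed

text \<open>The levels \<open>b1 < b2\<close> and the rates are chosen such that, for t \<le> - TT: y'^2 dominates
  2 En + m1^2 y^2 for |y| \<le> b1 (with m1 > 2) and 2 En + k2^2 y^2 for |y| \<le> b2, while for |y| \<ge> b2 the
  orbit is turned back with frequency kap. CC bounds the time between bubbles.\<close>

locale ef_params =
  fixes m lt q :: real
  assumes m2: "m > 2" and lt0: "lt > 0" and q0: "q > 0"
begin

definition "phi t = lt / sinh t ^ 2"
text \<open>The autonomous equation has its equilibria at |y|^q = m^2 and the tip of its homoclinic
  loop at |y|^q = m^2 (1 + q / 2). The level \<open>b2\<close> is halfway between them in |y|^q, so
  above it the restoring force dominates strictly, and at it an orbit of zero energy still
  moves.\<close>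

definition "b2 = (m\<^sup>2 * (1 + q / 4)) powr (1 / q)"
text \<open>From m^2 - 2 b2^q / (q + 2) = 2 k2^2: one half gives the rate, the other half is
  reserved for \<open>phi\<close>.\<close>

definition "k2 = sqrt (m\<^sup>2 * q / (4 * (q + 2)))"
definition "m1 = (m + 2) / 2"
definition "b1 = ((m\<^sup>2 - m1\<^sup>2) / 2) powr (1 / q)"
text \<open>The share of the potential that \<open>phi\<close> may use up in
  \<open>mid_bound\<close> and in \<open>low_bound\<close>; \<open>TT\<close> marks the time before
  which it stays within this share.\<close>

definition "nu = min (k2\<^sup>2) ((m\<^sup>2 - m1\<^sup>2) / 2)"
definition "TT = sqrt (lt / nu)"
definition "kap = sqrt (m\<^sup>2 * q / 4)"
text \<open>Bounds the speed while |y| \<le> b2 and the energy is at most 1.\<close>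

definition "BB = sqrt (2 + m\<^sup>2 * b2\<^sup>2)"
text \<open>The energy gained during a climb from b2 / 2 to b2, as computed in \<open>gain\<close>;
  the cap 1 covers the case that the energy is already at least 1.\<close>

definition "cc = min 1 (lt * b2 ^ 3 / (2 * BB) * exp (- 2 / k2))"

text \<open>Time pi / kap spent above \<open>b2\<close>, plus what remains of the crossing time
  \<open>2 * gg s b2\<close> after its term (2 / m1) |t| has been split off.\<close>

definition "CC = pi / kap + 2 * (ln (2 * m1 * b2 / sqrt cc + 1) / m1 + b2 / (k2 * b1))"

lemma m1_gt: "m1 > 2" and m1_lt: "m1\<^sup>2 < m\<^sup>2"
proof -
  show "m1 > 2" using m2 by (simp add: m1_def)
  then show "m1\<^sup>2 < m\<^sup>2" using m2 by (intro power_strict_mono) (auto simp: m1_def)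
qed

lemma b2_pos: "b2 > 0" and b1_pos: "b1 > 0" and k2_pos: "k2 > 0" and kap_pos: "kap > 0" and BB_pos: "BB > 0"
  and nu_pos: "nu > 0" and TT_pos: "TT > 0"
proof -
  show b2: "b2 > 0" using m2 q0 by (auto simp: b2_def intro!: add_pos_pos)
  show "b1 > 0" using m1_lt by (auto simp: b1_def)
  show k: "k2 > 0" using m2 q0 by (auto simp: k2_def)
  show "kap > 0" using m2 q0 by (auto simp: kap_def)
  show "BB > 0" by (auto simp: BB_def intro!: add_pos_nonneg)
  show nu: "nu > 0" using k m1_lt by (auto simp: nu_def)
  show "TT > 0" using nu lt0 by (simp add: TT_def)
qed

lemma b2_powr: "b2 powr q = m\<^sup>2 * (1 + q / 4)"
proof -
  have "m\<^sup>2 * (1 + q / 4) > 0" using m2 q0 by (intro mult_pos_pos) auto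
  then show ?thesis using q0 by (simp add: b2_def powr_powr)
qed

lemma b1_powr: "b1 powr q = (m\<^sup>2 - m1\<^sup>2) / 2"
  using m1_lt q0 by (simp add: b1_def powr_powr)

lemma k2_sq: "k2\<^sup>2 = m\<^sup>2 * q / (4 * (q + 2))"
  using q0 by (simp add: k2_def)

lemma cc_pos: "cc > 0" and cc_le: "cc \<le> 1"
  using lt0 b2_pos BB_pos by (auto simp: cc_def)

lemma phi_nonneg: "phi t \<ge> 0" using lt0 by (simp add: phi_def)

lemma sinh_ge_self: "x \<ge> 0 \<Longrightarrow> sinh x \<ge> (x::real)"
proof -
  assume x: "x \<ge> 0"
  have "(\<lambda>x::real. sinh x - x) 0 \<le> (\<lambda>x. sinh x - x) x"
    by (rule DERIV_nonneg_imp_nondecreasing[OF x]) (auto intro!: derivative_eq_intros exI simp: cosh_real_ge_1)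
  then show ?thesis by simp
qed

lemma phi_le: assumes "t \<le> - TT" shows "phi t \<le> nu"
proof -
  have t: "-t \<ge> TT" "-t > 0" using assms TT_pos by auto
  have "lt / nu = TT\<^sup>2" using lt0 nu_pos by (simp add: TT_def)
  also have "\<dots> \<le> (-t)\<^sup>2" using t TT_pos by (intro power_mono) auto
  also have "\<dots> \<le> (sinh (-t))\<^sup>2" using t by (intro power_mono sinh_ge_self) auto
  finally have "lt / nu \<le> (sinh t)\<^sup>2" by simp
  moreover have "(sinh t)\<^sup>2 > 0" using t by (simp add: zero_less_power2)
  ultimately show ?thesis using nu_pos by (simp add: phi_def field_simps)
qed

definition "dphi t = - 2 * lt * cosh t / sinh t ^ 3"

lemma phi_deriv: "t < 0 \<Longrightarrow> (phi has_real_derivative dphi t) (at t)"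
  unfolding phi_def[abs_def] dphi_def
  by (auto intro!: derivative_eq_intros simp: field_simps power2_eq_square eval_nat_numeral)

text \<open>With x = - t this is coth x \<ge> 1 and sinh x \<le> exp x / 2. The exponent 2 found
  here is the one that m has to exceed.\<close>

lemma dphi_ge: assumes "t < 0" shows "dphi t \<ge> 8 * lt * exp (2 * t)"
proof -
  define x where "x = - t"
  have x: "x > 0" using assms by (simp add: x_def)
  have sx: "sinh x > 0" using x by simp
  have e: "dphi t = 2 * lt * (cosh x / sinh x) / sinh x ^ 2"
    by (simp add: dphi_def x_def field_simps power2_eq_square eval_nat_numeral)
  have "sinh x \<le> exp x / 2" by (simp add: sinh_field_def)
  then have "sinh x ^ 2 \<le> (exp x / 2) ^ 2" using sx by (intro power_mono) auto
  also have "\<dots> = exp (2 * x) / 4" by (simp add: power2_eq_square exp_add[symmetric])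
  finally have "sinh x ^ 2 \<le> exp (2 * x) / 4" .
  then have i: "1 / sinh x ^ 2 \<ge> 1 / (exp (2 * x) / 4)"
    using sx by (intro divide_left_mono) auto
  have "sinh x \<le> cosh x" by (rule sinh_le_cosh_real)
  then have c: "cosh x / sinh x \<ge> 1" using sx by simp
  have "8 * lt * exp (2 * t) = 2 * lt * 1 * (1 / (exp (2 * x) / 4))"
    by (simp add: x_def exp_minus field_simps)
  also have "\<dots> \<le> 2 * lt * (cosh x / sinh x) * (1 / sinh x ^ 2)"
    using i c lt0 sx by (intro mult_mono mult_left_mono) auto
  also have "\<dots> = dphi t" by (simp add: e)
  finally show ?thesis .
qed

end

locale emden_fowler = ef_params +
  fixes y yd :: "real \<Rightarrow> real"
  assumes dy: "t < 0 \<Longrightarrow> (y has_real_derivative yd t) (at t)"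
    and dyd: "t < 0 \<Longrightarrow> (yd has_real_derivative (m\<^sup>2 - phi t - \<bar>y t\<bar> powr q) * y t) (at t)"
begin

definition "En t = (yd t)\<^sup>2 / 2 - m\<^sup>2 * (y t)\<^sup>2 / 2 + phi t * (y t)\<^sup>2 / 2 + \<bar>y t\<bar> powr (q + 2) / (q + 2)"

lemma cont_y: "b < 0 \<Longrightarrow> continuous_on {a..b} y" and cont_yd: "b < 0 \<Longrightarrow> continuous_on {a..b} yd"
  by (auto intro!: continuous_at_imp_continuous_on DERIV_isCont dy dyd)

text \<open>The autonomous part of the energy is conserved; only the explicit time dependence of
  \<open>phi\<close> survives.\<close>

lemma En_deriv: assumes "t < 0" shows "(En has_real_derivative dphi t * (y t)\<^sup>2 / 2) (at t)"
proof -
  have p: "((\<lambda>t. \<bar>y t\<bar> powr (q + 2) / (q + 2)) has_real_derivative (\<bar>y t\<bar> powr q * y t) * yd t) (at t)"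
    using DERIV_chain2[OF DERIV_abs_powr[OF q0] dy[OF assms]] .
  show ?thesis unfolding En_def[abs_def]
    by (rule DERIV_cong, (rule DERIV_add DERIV_diff DERIV_mult DERIV_power DERIV_cdivide DERIV_cmult dy dyd phi_deriv p assms)+)
       (simp add: algebra_simps power2_eq_square add_divide_distrib diff_divide_distrib)
qed

lemma En_mono: assumes "s \<le> t" "t < 0" shows "En s \<le> En t"
proof (rule DERIV_nonneg_imp_nondecreasing[OF assms(1)])
  fix x assume "s \<le> x" "x \<le> t"
  then have x: "x < 0" using assms by simp
  have "dphi x \<ge> 0" using order_trans[OF _ dphi_ge[OF x]] lt0 by simp
  then show "\<exists>y. (En has_real_derivative y) (at x) \<and> 0 \<le> y"
    using En_deriv[OF x] by (intro exI[of _ "dphi x * (y x)\<^sup>2 / 2"]) auto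
qed

text \<open>All bounds on the speed come from estimating the bracket on the right.\<close>

lemma yd_sq: "(yd t)\<^sup>2 = 2 * En t + (m\<^sup>2 - phi t - 2 * \<bar>y t\<bar> powr q / (q + 2)) * (y t)\<^sup>2"
proof -
  have "\<bar>y t\<bar> powr (q + 2) = \<bar>y t\<bar> powr q * (y t)\<^sup>2" by (cases "y t = 0") (auto simp: powr_add)
  then show ?thesis using q0 by (simp add: En_def algebra_simps)
qed

lemma mid_bound:
  assumes "t \<le> - TT" "\<bar>y t\<bar> \<le> b2"
  shows "(yd t)\<^sup>2 \<ge> 2 * En t + k2\<^sup>2 * (y t)\<^sup>2"
proof -
  have "\<bar>y t\<bar> powr q \<le> m\<^sup>2 * (1 + q / 4)"
    unfolding b2_powr[symmetric] using assms q0 by (intro powr_mono2) auto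
  then have "2 * \<bar>y t\<bar> powr q / (q + 2) \<le> 2 * (m\<^sup>2 * (1 + q / 4)) / (q + 2)"
    using q0 by (intro divide_right_mono) auto
  also have "\<dots> = m\<^sup>2 - 2 * k2\<^sup>2" using q0 by (simp add: k2_sq field_simps)
  finally have "m\<^sup>2 - phi t - 2 * \<bar>y t\<bar> powr q / (q + 2) \<ge> k2\<^sup>2"
    using phi_le[OF assms(1)] by (simp add: nu_def)
  then have "k2\<^sup>2 * (y t)\<^sup>2 \<le> (m\<^sup>2 - phi t - 2 * \<bar>y t\<bar> powr q / (q + 2)) * (y t)\<^sup>2"
    by (intro mult_right_mono) auto
  then show ?thesis by (simp only: yd_sq)
qed

lemma low_bound:
  assumes "t \<le> - TT" "\<bar>y t\<bar> \<le> b1"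
  shows "(yd t)\<^sup>2 \<ge> 2 * En t + m1\<^sup>2 * (y t)\<^sup>2"
proof -
  have a: "\<bar>y t\<bar> powr q \<le> (m\<^sup>2 - m1\<^sup>2) / 2"
    unfolding b1_powr[symmetric] using assms q0 by (intro powr_mono2) auto
  have "2 * \<bar>y t\<bar> powr q / (q + 2) \<le> \<bar>y t\<bar> powr q"
    using q0 by (simp add: field_simps)
  then have "m\<^sup>2 - phi t - 2 * \<bar>y t\<bar> powr q / (q + 2) \<ge> m1\<^sup>2"
    using phi_le[OF assms(1)] a by (simp add: nu_def)
  then have "m1\<^sup>2 * (y t)\<^sup>2 \<le> (m\<^sup>2 - phi t - 2 * \<bar>y t\<bar> powr q / (q + 2)) * (y t)\<^sup>2"
    by (intro mult_right_mono) auto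
  then show ?thesis by (simp only: yd_sq)
qed

end

locale emden_fowler_pos = emden_fowler +
  assumes Epos: "t < 0 \<Longrightarrow> En t > 0"
begin

text \<open>The equation is odd and the energy even, so every statement on descents also serves for
  ascents through this interpretation.\<close>

lemma neg: "emden_fowler_pos m lt q (\<lambda>t. - y t) (\<lambda>t. - yd t)"
proof -
  interpret n: emden_fowler m lt q "\<lambda>t. - y t" "\<lambda>t. - yd t"
    by unfold_locales (auto intro!: derivative_eq_intros dy dyd)
  show ?thesis
    by unfold_locales (use Epos in \<open>simp add: n.En_def En_def\<close>)
qed

lemma yd_nonzero: "t \<le> - TT \<Longrightarrow> \<bar>y t\<bar> \<le> b2 \<Longrightarrow> yd t \<noteq> 0"
  using mid_bound[of t] Epos[of t] TT_pos
  by (smt (verit) mult_nonneg_nonneg power_zero_numeral zero_le_power2)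

text \<open>A turning point inside the band |y| \<le> b2 would have zero speed, which positive
  energy forbids.\<close>

lemma descending_run:
  assumes "t1 \<le> t2" "t2 \<le> - TT" "yd t1 < 0" "y t1 \<le> b2"
    and above: "\<And>t. t \<in> {t1..t2} \<Longrightarrow> y t \<ge> - b2"
  shows "\<forall>t\<in>{t1..t2}. yd t < 0"
proof (rule ccontr)
  assume "\<not> (\<forall>t\<in>{t1..t2}. yd t < 0)"
  then obtain u where u: "u \<in> {t1..t2}" "yd u \<ge> 0" by force
  obtain t where t: "t1 < t" "t \<le> u" "yd t = 0" "\<And>s. t1 \<le> s \<Longrightarrow> s < t \<Longrightarrow> yd s < 0"
    using first_time[of t1 u yd] u assms TT_pos cont_yd[of u t1] by auto
  have "y t \<le> y t1"
  proof (rule DERIV_nonpos_imp_nonincreasing[where f = y])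
    fix x assume x: "t1 \<le> x" "x \<le> t"
    then have "x < 0" using t u assms TT_pos by auto
    moreover have "yd x \<le> 0" using t(3) t(4)[of x] x by (cases "x = t") auto
    ultimately show "\<exists>z. (y has_real_derivative z) (at x) \<and> z \<le> 0" using dy by blast
  qed (use t in simp)
  moreover have "- b2 \<le> y t" using above[of t] t u by auto
  ultimately have "\<bar>y t\<bar> \<le> b2" using assms(4) by linarith
  then show False using yd_nonzero[of t] t u assms by auto
qed

text \<open>Sturm comparison with sin (kap (t - t0)). The Wronskian F decreases as long as y stays
  above \<open>b2\<close>, where the frequency is at least \<open>kap\<close>, but its values at the
  two ends of a half period have the opposite order.\<close>

lemma sturm:
  assumes "t0 + pi / kap < 0" "y t0 \<ge> b2"
  shows "\<exists>t\<in>{t0..t0 + pi / kap}. y t < b2"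
proof (rule ccontr)
  assume "\<not> ?thesis"
  then have big: "y t \<ge> b2" if "t \<in> {t0..t0 + pi / kap}" for t using that by force
  define F where "F t = yd t * sin (kap * (t - t0)) - kap * y t * cos (kap * (t - t0))" for t
  have "F (t0 + pi / kap) \<le> F t0"
  proof (rule DERIV_nonpos_imp_nonincreasing[where f = F])
    fix x assume x: "t0 \<le> x" "x \<le> t0 + pi / kap"
    then have x0: "x < 0" using assms by simp
    have yx: "y x \<ge> b2" using big x by auto
    have "\<bar>y x\<bar> powr q \<ge> b2 powr q" using yx b2_pos q0 by (intro powr_mono2) auto
    then have "m\<^sup>2 - phi x - \<bar>y x\<bar> powr q \<le> - kap\<^sup>2"
      using phi_nonneg[of x] m2 q0 unfolding b2_powr by (simp add: kap_def field_simps)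
    then have c: "(m\<^sup>2 - phi x - \<bar>y x\<bar> powr q + kap\<^sup>2) * y x \<le> 0"
      using yx b2_pos by (intro mult_nonpos_nonneg) auto
    have "sin (kap * (x - t0)) \<ge> 0"
      using x kap_pos by (intro sin_ge_zero) (auto simp: field_simps)
    then have n: "(m\<^sup>2 - phi x - \<bar>y x\<bar> powr q + kap\<^sup>2) * y x * sin (kap * (x - t0)) \<le> 0"
      using c by (rule mult_nonpos_nonneg[rotated])
    have "(F has_real_derivative (m\<^sup>2 - phi x - \<bar>y x\<bar> powr q + kap\<^sup>2) * y x * sin (kap * (x - t0))) (at x)"
      unfolding F_def[abs_def]
      by (rule derivative_eq_intros dy dyd x0 refl)+ (simp add: algebra_simps power2_eq_square)
    then show "\<exists>z. (F has_real_derivative z) (at x) \<and> z \<le> 0" using n by blast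
  qed (use kap_pos in auto)
  moreover have "F t0 = - kap * y t0" by (simp add: F_def)
  moreover have "F (t0 + pi / kap) = kap * y (t0 + pi / kap)" using kap_pos by (simp add: F_def)
  moreover have "kap * y t0 > 0" "kap * y (t0 + pi / kap) > 0"
    using kap_pos b2_pos big[of t0] big[of "t0 + pi/kap"] by (auto intro!: mult_pos_pos)
  ultimately show False by simp
qed

text \<open>Antiderivative in u of 1 / sqrt (s^2 + m1^2 u^2) + 1 / (k2 b1). The summands are
  reciprocals of the lower speed bounds for |u| \<le> b1 and for b1 \<le> |u| \<le> b2. One of them
  always applies and the other has the right sign, so \<open>gg s (y t) + t\<close> cannot increase
  during a descent.\<close>

definition "gg s u = arsinh (m1 * u / s) / m1 + u / (k2 * b1)"

text \<open>As \<open>gg s\<close> is odd and increasing, the monotone quantity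
  \<open>gg s (y t) + t\<close> limits the time from \<open>b2\<close> to \<open>- b2\<close> to
  \<open>2 * gg s b2\<close>.\<close>

lemma descend:
  assumes s: "s > 0" "s\<^sup>2 \<le> 2 * En t1" and t1: "y t1 \<le> b2" "yd t1 < 0" and fin: "t1 + 2 * gg s b2 \<le> - TT"
  shows "\<exists>t\<in>{t1..t1 + 2 * gg s b2}. y t \<le> - b2"
proof (rule ccontr)
  define l where "l = 2 * gg s b2"
  have m1p: "m1 > 0" using m1_gt by simp
  have l0: "l \<ge> 0" unfolding l_def gg_def using m1p b2_pos s k2_pos b1_pos
    by (intro mult_nonneg_nonneg add_nonneg_nonneg divide_nonneg_nonneg arsinh_real_nonneg) auto
  assume "\<not> ?thesis"
  then have above: "y t > - b2" if "t \<in> {t1..t1 + l}" for t using that l_def by force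
  have neg: "yd t < 0" if "t \<in> {t1..t1+l}" for t
    using descending_run[of t1 "t1 + l"] above l0 that t1 fin unfolding l_def[symmetric] by force
  have below: "y t \<le> b2" if t: "t \<in> {t1..t1+l}" for t
  proof -
    have "y t \<le> y t1"
    proof (rule DERIV_nonpos_imp_nonincreasing[where f = y])
      fix x assume x: "t1 \<le> x" "x \<le> t"
      then have "x < 0" using t fin TT_pos l_def by auto
      moreover have "yd x \<le> 0" using neg[of x] x t by auto
      ultimately show "\<exists>z. (y has_real_derivative z) (at x) \<and> z \<le> 0" using dy by blast
    qed (use t in simp)
    then show ?thesis using t1 by simp
  qed
  have mono: "strict_mono (gg s)"
  proof (rule strict_monoI)
    fix u v :: real assume uv: "u < v"
    then have "m1 * u / s < m1 * v / s" using m1p s by (simp add: divide_strict_right_mono)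
    then have "arsinh (m1 * u / s) / m1 < arsinh (m1 * v / s) / m1"
      using m1p by (simp add: divide_strict_right_mono)
    moreover have "u / (k2 * b1) < v / (k2 * b1)" using uv k2_pos b1_pos by (simp add: divide_strict_right_mono)
    ultimately show "gg s u < gg s v" by (simp add: gg_def)
  qed
  have "gg s (y (t1 + l)) + (t1 + l) \<le> gg s (y t1) + t1"
  proof (rule DERIV_nonpos_imp_nonincreasing[where f = "\<lambda>t. gg s (y t) + t"])
    fix x assume x: "t1 \<le> x" "x \<le> t1 + l"
    then have xx: "x < 0" "x \<le> - TT" and ydx: "yd x < 0" and yx: "\<bar>y x\<bar> \<le> b2"
      using fin TT_pos l_def neg[of x] above[of x] below[of x] by auto
    define R where "R = sqrt (s\<^sup>2 + m1\<^sup>2 * (y x)\<^sup>2)"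
    have R: "R > 0" unfolding R_def using s by (auto intro!: add_pos_nonneg)
    have "sqrt ((m1 * y x / s)\<^sup>2 + 1) = sqrt ((s\<^sup>2 + m1\<^sup>2 * (y x)\<^sup>2) / s\<^sup>2)"
      using s by (simp add: field_simps power_mult_distrib power_divide)
    also have "\<dots> = R / s" using s by (simp add: R_def real_sqrt_divide)
    finally have sq: "sqrt ((m1 * y x / s)\<^sup>2 + 1) = R / s" .
    have ga: "((\<lambda>u. arsinh (m1 * u / s)) has_real_derivative (m1 / s) / sqrt ((m1 * y x / s)\<^sup>2 + 1)) (at (y x))"
    proof -
      have "((\<lambda>u. m1 * u / s) has_real_derivative m1 / s) (at (y x))"
        using s by (auto intro!: derivative_eq_intros)
      from DERIV_chain2[OF arsinh_real_has_field_derivative this] show ?thesis by (simp add: mult.commute)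
    qed
    have g: "(gg s has_real_derivative (1 / R + 1 / (k2 * b1))) (at (y x))"
      unfolding gg_def[abs_def] using m1p s R k2_pos b1_pos
      by (auto intro!: derivative_eq_intros ga simp: sq)
    have D: "((\<lambda>t. gg s (y t) + t) has_real_derivative (1 / R + 1 / (k2 * b1)) * yd x + 1) (at x)"
      by (rule derivative_eq_intros DERIV_chain2[OF g dy] xx refl)+
    have Ex: "2 * En x \<ge> s\<^sup>2" using s En_mono[of t1 x] x xx by linarith
    have "(1 / R + 1 / (k2 * b1)) * (- yd x) \<ge> 1"
    proof (cases "\<bar>y x\<bar> \<le> b1")
      case True
      have "s\<^sup>2 + m1\<^sup>2 * (y x)\<^sup>2 \<le> (- yd x)\<^sup>2" using low_bound[OF xx(2) True] Ex by simp
      then have "R \<le> - yd x" unfolding R_def using ydx by (intro real_le_lsqrt) auto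
      then have "1 \<le> 1 / R * (- yd x)" using R by (simp add: field_simps)
      moreover have "0 \<le> 1 / (k2 * b1) * (- yd x)" using k2_pos b1_pos ydx by (intro mult_nonneg_nonneg) auto
      ultimately show ?thesis by (simp only: distrib_right)
    next
      case False
      have "(k2 * \<bar>y x\<bar>)\<^sup>2 \<le> (- yd x)\<^sup>2" using mid_bound[OF xx(2) yx] Epos[OF xx(1)] by (simp add: power_mult_distrib)
      then have "k2 * \<bar>y x\<bar> \<le> - yd x" by (rule power2_le_imp_le) (use ydx in auto)
      moreover have "k2 * b1 \<le> k2 * \<bar>y x\<bar>" using False k2_pos by (intro mult_left_mono) auto
      ultimately have "k2 * b1 \<le> - yd x" by linarith
      then have "1 \<le> 1 / (k2 * b1) * (- yd x)" using k2_pos b1_pos by (simp add: field_simps)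
      moreover have "0 \<le> 1 / R * (- yd x)" using R ydx by (intro mult_nonneg_nonneg) auto
      ultimately show ?thesis by (simp only: distrib_right)
    qed
    then have "(1 / R + 1 / (k2 * b1)) * yd x + 1 \<le> 0" by simp
    then show "\<exists>z. ((\<lambda>t. gg s (y t) + t) has_real_derivative z) (at x) \<and> z \<le> 0" using D by blast
  qed (use l0 in simp)
  then have "gg s (y (t1 + l)) \<le> gg s (y t1) - 2 * gg s b2" by (simp add: l_def)
  also have "gg s (y t1) \<le> gg s b2" using t1 mono by (simp add: strict_mono_less_eq)
  finally have "gg s (y (t1 + l)) \<le> - gg s b2" by simp
  also have "- gg s b2 = gg s (- b2)" by (simp add: gg_def arsinh_minus_real)
  finally have "y (t1 + l) \<le> - b2" using mono by (simp add: strict_mono_less_eq)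
  then show False using above[of "t1 + l"] l0 by auto
qed

text \<open>If the energy stays below 1, the speed during the climb lies between k2 b2 / 2 and
  \<open>BB\<close>, so the climb lasts between b2 / (2 BB) and 1 / k2. Throughout it the energy
  grows at rate at least lt b2^2 exp (2 t1 - 2 / k2).\<close>

lemma gain:
  assumes "t0 < t1" "t1 \<le> - TT" "y t0 = b2 / 2" "y t1 = b2" "\<And>t. t \<in> {t0..t1} \<Longrightarrow> b2 / 2 \<le> y t \<and> y t \<le> b2"
  shows "En t1 \<ge> cc * exp (2 * t1)"
proof (cases "En t1 \<ge> 1")
  case True
  have "exp (2 * t1) \<le> 1" using assms TT_pos by simp
  then have "cc * exp (2 * t1) \<le> 1 * 1" using cc_pos cc_le by (intro mult_mono) auto
  then show ?thesis using True by simp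
next
  case False
  have neg0: "t < 0" if "t \<le> t1" for t using that assms TT_pos by auto
  obtain u where u: "t0 < u" "u < t1" "y t1 - y t0 = (t1 - t0) * yd u"
    using MVT2[OF assms(1), of y yd] dy neg0 by auto
  have yu: "b2 / 2 \<le> y u" "y u \<le> b2" using assms(5)[of u] u by auto
  have b: "b2 / 2 = (t1 - t0) * yd u" using u assms by simp
  have "yd u > 0" using b b2_pos assms(1) by (metis diff_gt_0_iff_gt half_gt_zero zero_less_mult_pos)
  have uT: "u \<le> - TT" using u assms by auto
  have "(yd u)\<^sup>2 \<le> 2 * En u + m\<^sup>2 * (y u)\<^sup>2"
  proof -
    have "(m\<^sup>2 - phi u - 2 * \<bar>y u\<bar> powr q / (q + 2)) * (y u)\<^sup>2 \<le> m\<^sup>2 * (y u)\<^sup>2"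
    proof (intro mult_right_mono)
      have "2 * \<bar>y u\<bar> powr q / (q + 2) \<ge> 0" using q0 by simp
      then show "m\<^sup>2 - phi u - 2 * \<bar>y u\<bar> powr q / (q + 2) \<le> m\<^sup>2" using phi_nonneg[of u] by linarith
    qed simp
    then show ?thesis by (simp only: yd_sq)
  qed
  also have "\<dots> \<le> 2 * 1 + m\<^sup>2 * b2\<^sup>2"
    using En_mono[of u t1] False u neg0[of t1] yu b2_pos by (intro add_mono mult_left_mono power_mono) auto
  finally have "(yd u)\<^sup>2 \<le> BB\<^sup>2" by (simp add: BB_def add_nonneg_nonneg)
  then have "yd u \<le> BB" using BB_pos by (auto intro: power2_le_imp_le)
  then have lo: "b2 / 2 \<le> (t1 - t0) * BB" unfolding b using assms(1) by (intro mult_left_mono) auto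
  have "(k2 * y u)\<^sup>2 \<le> (yd u)\<^sup>2"
    using mid_bound[OF uT] yu b2_pos Epos[OF neg0[of u]] u by (simp add: power_mult_distrib)
  then have "k2 * y u \<le> yd u" by (rule power2_le_imp_le) (use \<open>yd u > 0\<close> in simp)
  moreover have "k2 * (b2 / 2) \<le> k2 * y u" using yu k2_pos by (intro mult_left_mono) auto
  ultimately have "k2 * (b2 / 2) \<le> yd u" by linarith
  then have "(t1 - t0) * (k2 * (b2 / 2)) \<le> (t1 - t0) * yd u" using assms(1) by (intro mult_left_mono) auto
  then have "(t1 - t0) * (k2 * (b2 / 2)) \<le> b2 / 2" by (simp only: b)
  then have hi: "(t1 - t0) * k2 \<le> 1" using b2_pos by simp
  then have hi': "t1 - t0 \<le> 1 / k2" using k2_pos by (simp add: field_simps)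
  obtain x where x: "t0 < x" "x < t1" "En t1 - En t0 = (t1 - t0) * (dphi x * (y x)\<^sup>2 / 2)"
    using MVT2[OF assms(1), of En "\<lambda>t. dphi t * (y t)\<^sup>2 / 2"] En_deriv neg0 by auto
  have x0: "x < 0" using neg0 x by simp
  have yx: "(b2 / 2)\<^sup>2 \<le> (y x)\<^sup>2" using assms(5)[of x] x b2_pos by (intro power_mono) auto
  have "2 * t1 - 2 / k2 \<le> 2 * x" using x hi' by simp
  then have ex: "exp (2 * t1 - 2 / k2) \<le> exp (2 * x)" by simp
  have "8 * lt * exp (2 * t1 - 2 / k2) \<le> 8 * lt * exp (2 * x)" using ex lt0 by simp
  also have "\<dots> \<le> dphi x" using dphi_ge x0 by simp
  finally have d: "8 * lt * exp (2 * t1 - 2 / k2) \<le> dphi x" .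
  have "0 \<le> 8 * lt * exp (2 * t1 - 2 / k2)" using lt0 by simp
  then have "0 \<le> dphi x" using d by (rule order_trans)
  then have "8 * lt * exp (2 * t1 - 2 / k2) * (b2 / 2)\<^sup>2 / 2 \<le> dphi x * (y x)\<^sup>2 / 2"
    using yx lt0 d by (intro divide_right_mono mult_mono) auto
  moreover have "b2 / (2 * BB) \<le> t1 - t0" using lo BB_pos by (simp add: field_simps)
  ultimately have "b2 / (2 * BB) * (8 * lt * exp (2 * t1 - 2 / k2) * (b2 / 2)\<^sup>2 / 2) \<le> (t1 - t0) * (dphi x * (y x)\<^sup>2 / 2)"
    using b2_pos BB_pos lt0 assms(1) by (intro mult_mono) auto
  also have "\<dots> = En t1 - En t0" using x by simp
  also have "\<dots> \<le> En t1" using Epos[OF neg0[of t0]] assms(1) by simp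
  finally have "lt * b2 ^ 3 / (2 * BB) * exp (2 * t1 - 2 / k2) \<le> En t1"
    by (simp add: field_simps power2_eq_square eval_nat_numeral)
  moreover have "exp (2 * t1 - 2 / k2) = exp (- 2 / k2) * exp (2 * t1)" by (simp add: exp_add[symmetric])
  ultimately have "lt * b2 ^ 3 / (2 * BB) * exp (- 2 / k2) * exp (2 * t1) \<le> En t1" by (simp only: mult.assoc)
  moreover have "cc * exp (2 * t1) \<le> lt * b2 ^ 3 / (2 * BB) * exp (- 2 / k2) * exp (2 * t1)"
    unfolding cc_def by (intro mult_right_mono) auto
  ultimately show ?thesis by linarith
qed

text \<open>The first time at \<open>b2\<close> and the last time at b2 / 2 before it delimit a
  climb to which \<open>gain\<close> applies.\<close>

lemma first_passage:
  assumes "a < e" "e \<le> - TT" "y a \<le> b2 / 2" "y e \<ge> b2"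
  shows "\<exists>t. a < t \<and> t \<le> e \<and> y t = b2 \<and> En t \<ge> cc * exp (2 * t)"
proof -
  have c: "continuous_on {a..x} y" if "x \<le> e" for x using cont_y[of x a] that assms TT_pos by auto
  obtain t1 where t1: "a < t1" "t1 \<le> e" "y t1 = b2" "\<And>s. a \<le> s \<Longrightarrow> s < t1 \<Longrightarrow> y s < b2"
  proof (rule first_time[of a e "\<lambda>t. y t - b2"])
    show "continuous_on {a..e} (\<lambda>t. y t - b2)" by (intro continuous_intros c) simp
  qed (use assms b2_pos in auto)
  obtain t0 where t0: "a \<le> t0" "t0 < t1" "y t0 = b2 / 2" "\<And>s. t0 < s \<Longrightarrow> s \<le> t1 \<Longrightarrow> y s > b2 / 2"
  proof (rule last_time[of a t1 "\<lambda>t. b2 / 2 - y t"])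
    show "continuous_on {a..t1} (\<lambda>t. b2 / 2 - y t)" by (intro continuous_intros c t1)
  qed (use assms b2_pos t1 in auto)
  have "En t1 \<ge> cc * exp (2 * t1)"
  proof (rule gain[of t0])
    fix t assume t: "t \<in> {t0..t1}"
    show "b2 / 2 \<le> y t \<and> y t \<le> b2"
      using t0(3) t0(4)[of t] t1(3) t1(4)[of t] t t0(1) 
      by (cases "t = t0"; cases "t = t1") (auto simp: less_imp_le)
  qed (use t0 t1 assms in auto)
  then show ?thesis using t1 by blast
qed

text \<open>\<open>sturm\<close> brings the orbit back to \<open>b2\<close>, its crossing there is
  strictly downward, \<open>descend\<close> carries it to \<open>- b2\<close>, and
  \<open>first_passage\<close> for - y finds the energy on arrival. The guaranteed energy allows s =
  sqrt cc exp t0, and arsinh (m1 b2 / s) is at most a constant minus t0; divided by m1 and doubled,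
  this produces the factor 1 - 2 / m1.\<close>

lemma step_pos:
  assumes st: "y t0 \<ge> b2" "En t0 \<ge> cc * exp (2 * t0)" and t0: "(1 - 2 / m1) * t0 + CC \<le> - TT" "t0 < 0"
  shows "\<exists>t. t0 < t \<and> t \<le> (1 - 2 / m1) * t0 + CC \<and> y t = - b2 \<and> En t \<ge> cc * exp (2 * t)"
proof -
  define s where "s = sqrt cc * exp t0"
  have m1p: "m1 > 0" using m1_gt by simp
  have s: "s > 0" using cc_pos by (simp add: s_def)
  have s2: "s\<^sup>2 = cc * exp (2 * t0)" using cc_pos by (simp add: s_def power_mult_distrib exp_double)
  have "arsinh (m1 * b2 / s) \<le> ln (2 * m1 * b2 / sqrt cc + 1) - t0"
  proof -
    define x where "x = m1 * b2 / s"
    have x: "x \<ge> 0" using m1p b2_pos s by (simp add: x_def)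
    have "sqrt (x\<^sup>2 + 1) \<le> x + 1" using x by (intro real_le_lsqrt) (auto simp: power2_eq_square algebra_simps)
    then have "arsinh x \<le> ln (2 * x + 1)"
      using x arsinh_real_aux[of x] unfolding arsinh_real_def by (intro ln_mono) auto
    moreover have "2 * x + 1 \<le> (2 * m1 * b2 / sqrt cc + 1) * exp (- t0)"
    proof -
      have "2 * x = 2 * m1 * b2 / sqrt cc * exp (- t0)" by (simp add: x_def s_def exp_minus field_simps)
      moreover have "1 \<le> exp (- t0)" using t0 by simp
      ultimately show ?thesis by (simp add: distrib_right)
    qed
    from this have "ln (2 * x + 1) \<le> ln ((2 * m1 * b2 / sqrt cc + 1) * exp (- t0))"
      using x by (intro ln_mono) auto
    moreover have "ln ((2 * m1 * b2 / sqrt cc + 1) * exp (- t0)) = ln (2 * m1 * b2 / sqrt cc + 1) - t0"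
    proof -
      have "0 < 2 * m1 * b2 / sqrt cc + 1" using m1p b2_pos cc_pos by (intro add_nonneg_pos) auto
      then show ?thesis by (simp add: ln_mult_pos)
    qed
    ultimately show ?thesis by (simp add: x_def)
  qed
  then have "arsinh (m1 * b2 / s) / m1 \<le> (ln (2 * m1 * b2 / sqrt cc + 1) - t0) / m1"
    using m1p by (intro divide_right_mono) auto
  then have time: "t0 + pi / kap + 2 * gg s b2 \<le> (1 - 2 / m1) * t0 + CC"
    unfolding gg_def CC_def diff_divide_distrib left_diff_distrib distrib_left by simp
  have gpos: "gg s b2 > 0" unfolding gg_def
    using m1p b2_pos s k2_pos b1_pos by (intro add_nonneg_pos divide_nonneg_pos arsinh_real_nonneg) auto
  have "t0 + pi / kap < 0" using time t0 gpos TT_pos by linarith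
  from sturm[OF this st(1)] obtain u where u: "t0 \<le> u" "u \<le> t0 + pi / kap" "y u < b2" by auto
  obtain t1 where t1: "t0 \<le> t1" "t1 < u" "y t1 = b2" "\<And>s. t1 < s \<Longrightarrow> s \<le> u \<Longrightarrow> y s < b2"
  proof (rule last_time[of t0 u "\<lambda>t. y t - b2"])
    show "continuous_on {t0..u} (\<lambda>t. y t - b2)"
      using u \<open>t0 + pi / kap < 0\<close> by (intro continuous_intros cont_y) simp
  qed (use u st in auto)
  have t1T: "t1 \<le> - TT" using t1 u time t0 gpos by linarith
  then have t10: "t1 < 0" using TT_pos by simp
  have "yd t1 \<le> 0"
  proof (rule ccontr)
    assume "\<not> yd t1 \<le> 0"
    then obtain d where d: "d > 0" "\<And>h. 0 < h \<Longrightarrow> h < d \<Longrightarrow> y t1 < y (t1 + h)"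
      using DERIV_pos_inc_right[OF dy[OF t10]] by auto
    define h where "h = min (d / 2) (u - t1)"
    have "0 < h" "h < d" "t1 + h \<le> u" using d t1 by (auto simp: h_def)
    then show False using d(2)[of h] t1(3) t1(4)[of "t1 + h"] by auto
  qed
  moreover have "yd t1 \<noteq> 0" using yd_nonzero[OF t1T] t1 b2_pos by auto
  ultimately have yd1: "yd t1 < 0" by simp
  have "s\<^sup>2 \<le> 2 * En t1"
  proof -
    have "s\<^sup>2 \<le> En t0" using st s2 by simp
    moreover have "En t0 \<le> En t1" using En_mono t1 t10 by auto
    ultimately show ?thesis using Epos[OF t10] by linarith
  qed
  moreover have e: "t1 + 2 * gg s b2 \<le> - TT" using t1 u time t0 by linarith
  ultimately obtain e where e: "t1 \<le> e" "e \<le> t1 + 2 * gg s b2" "y e \<le> - b2"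
    using descend[OF s _ _ yd1] t1 by force
  interpret n: emden_fowler_pos m lt q "\<lambda>t. - y t" "\<lambda>t. - yd t" by (rule neg)
  have "t1 \<noteq> e" using t1 e b2_pos by auto
  then obtain t where "t1 < t" "t \<le> e" "- y t = b2" "n.En t \<ge> cc * exp (2 * t)"
    using n.first_passage[of t1 e] e t1 b2_pos \<open>t1 + 2 * gg s b2 \<le> - TT\<close> by auto
  moreover have "n.En t = En t" for t by (simp add: n.En_def En_def)
  ultimately show ?thesis using t1 u e time by (intro exI[of _ t]) auto
qed

lemma step:
  assumes st: "\<bar>y t0\<bar> \<ge> b2" "En t0 \<ge> cc * exp (2 * t0)" and t0: "(1 - 2 / m1) * t0 + CC \<le> - TT" "t0 < 0"
  shows "\<exists>t. t0 < t \<and> t \<le> (1 - 2 / m1) * t0 + CC \<and> y t * y t0 < 0 \<and> \<bar>y t\<bar> \<ge> b2 \<and> En t \<ge> cc * exp (2 * t)"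
proof (cases "y t0 \<ge> 0")
  case True
  then obtain t where "t0 < t" "t \<le> (1 - 2 / m1) * t0 + CC" "y t = - b2" "En t \<ge> cc * exp (2 * t)"
    using step_pos[of t0] assms by auto
  then show ?thesis using True st b2_pos by (intro exI[of _ t]) auto
next
  case False
  interpret n: emden_fowler_pos m lt q "\<lambda>t. - y t" "\<lambda>t. - yd t" by (rule neg)
  have E: "n.En t = En t" for t by (simp add: n.En_def En_def)
  obtain t where "t0 < t" "t \<le> (1 - 2 / m1) * t0 + CC" "y t = b2" "En t \<ge> cc * exp (2 * t)"
    using n.step_pos[of t0] assms False E by auto
  then show ?thesis using False st b2_pos by (intro exI[of _ t]) (auto simp: mult_pos_neg)
qed

text \<open>From height c0 on the speed is at least k2 c0, so \<open>b2\<close> is reached within b2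
  / (k2 c0). The limit 0 at - infinity provides a starting point below b2 / 2 for
  \<open>first_passage\<close>; the bubble found may lie before ts.\<close>

lemma start:
  assumes c0: "c0 > 0" "y ts \<ge> c0" and te: "ts + b2 / (k2 * c0) \<le> - TT"
    and pos: "\<And>t. t \<le> ts \<Longrightarrow> y t > 0" and lim: "(y \<longlongrightarrow> 0) at_bot"
  shows "\<exists>t \<le> ts + b2 / (k2 * c0). y t = b2 \<and> En t \<ge> cc * exp (2 * t)"
proof -
  define l where "l = b2 / (k2 * c0)"
  have l: "l > 0" using b2_pos k2_pos c0 by (simp add: l_def)
  have small: "\<exists>a<ts. y a \<le> e" if "e > 0" for e
  proof -
    have "\<forall>\<^sub>F a in at_bot. y a < e" using lim that by (rule order_tendstoD)
    moreover have "\<forall>\<^sub>F a in at_bot. a < ts" by (rule eventually_gt_at_bot)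
    ultimately have "\<forall>\<^sub>F a in at_bot. y a < e \<and> a < ts" by eventually_elim simp
    then show ?thesis using eventually_happens[of _ "at_bot :: real filter"] by (force simp: less_imp_le)
  qed
  have "\<exists>e\<le>ts + l. ts \<le> e \<and> y e \<ge> b2 \<or> e < ts \<and> y e \<ge> b2"
  proof (rule ccontr)
    assume n: "\<not> ?thesis"
    then have lt: "y t < b2" if "t \<le> ts + l" for t using that by (metis leI not_less)
    have tsT: "ts \<le> - TT" using te l l_def by linarith
    \<comment> \<open>Some earlier slope is positive because y comes from near 0, and inside the
      band the slope cannot vanish, so its sign persists up to ts.\<close>
    have "yd ts > 0"
    proof -
      obtain a where a: "a < ts" "y a \<le> y ts / 2" using small[of "y ts / 2"] c0 by auto
      obtain x where x: "a < x" "x < ts" "y ts - y a = (ts - a) * yd x"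
        using MVT2[OF a(1), of y yd] dy tsT TT_pos by auto
      have "y ts - y a > 0" using a c0 by simp
      then have "yd x > 0" using x a by (simp add: zero_less_mult_iff)
      have nz: "yd t \<noteq> 0" if "x \<le> t" "t \<le> ts" for t
        using yd_nonzero[of t] pos[of t] lt[of t] that tsT l by auto
      show ?thesis
      proof (rule ccontr)
        assume "\<not> yd ts > 0"
        then have "\<exists>t\<ge>x. t \<le> ts \<and> yd t = 0"
          using x \<open>yd x > 0\<close> cont_yd[of ts x] tsT TT_pos by (intro IVT2') auto
        then show False using nz by blast
      qed
    qed
    interpret n: emden_fowler_pos m lt q "\<lambda>t. - y t" "\<lambda>t. - yd t" by (rule neg)
    have up: "yd t > 0" if "t \<in> {ts..ts+l}" for t
      using n.descending_run[of ts "ts + l"] that l te \<open>yd ts > 0\<close> lt c0 b2_pos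
      by (force simp: l_def[symmetric] less_imp_le)
    have ge: "y t \<ge> c0" if t: "t \<in> {ts..ts+l}" for t
    proof -
      have "y ts \<le> y t"
      proof (rule DERIV_nonneg_imp_nondecreasing[where f = y])
        fix x assume x: "ts \<le> x" "x \<le> t"
        then have "x < 0" using t te TT_pos l_def by auto
        moreover have "yd x \<ge> 0" using up[of x] x t by auto
        ultimately show "\<exists>z. (y has_real_derivative z) (at x) \<and> 0 \<le> z" using dy by blast
      qed (use t in simp)
      then show ?thesis using c0 by simp
    qed
    obtain x where x: "ts < x" "x < ts + l" "y (ts + l) - y ts = l * yd x"
      using MVT2[of ts "ts + l" y yd] dy te TT_pos l l_def by auto
    have xT: "x \<le> - TT" using x te l_def by simp
    have "(k2 * y x)\<^sup>2 \<le> (yd x)\<^sup>2"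
      using mid_bound[OF xT] Epos[of x] ge[of x] lt[of x] x c0 xT TT_pos by (simp add: power_mult_distrib)
    then have "k2 * y x \<le> yd x" by (rule power2_le_imp_le) (use up[of x] x in auto)
    moreover have "k2 * c0 \<le> k2 * y x" using ge[of x] x k2_pos by (intro mult_left_mono) auto
    ultimately have "k2 * c0 \<le> yd x" by linarith
    then have "l * (k2 * c0) \<le> l * yd x" using l by simp
    moreover have "l * (k2 * c0) = b2" using k2_pos c0 by (simp add: l_def)
    ultimately have "y (ts + l) \<ge> b2" using x c0 by simp
    then show False using lt[of "ts + l"] by simp
  qed
  then obtain e where e: "e \<le> ts + l" "y e \<ge> b2" by blast
  obtain a where a: "a < min e ts" "y a \<le> b2 / 2"
  proof -
    have "\<forall>\<^sub>F a in at_bot. y a < b2 / 2" using lim b2_pos by (intro order_tendstoD) auto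
    moreover have "\<forall>\<^sub>F a in at_bot. a < min e ts" by (rule eventually_gt_at_bot)
    ultimately have "\<forall>\<^sub>F a in at_bot. y a < b2 / 2 \<and> a < min e ts" by eventually_elim simp
    then show ?thesis using eventually_happens[of _ "at_bot :: real filter"] that by (force simp: less_imp_le)
  qed
  then obtain t where "a < t" "t \<le> e" "y t = b2" "En t \<ge> cc * exp (2 * t)"
    using first_passage[of a e] e te l_def by auto
  then show ?thesis using e by (intro exI[of _ t]) (auto simp: l_def)
qed

end

section \<open>The radial equation with critical nonlinearity\<close>

lemma DERIV_abs_powr_mult:
  fixes a :: real assumes "a > 0"
  shows "((\<lambda>u. \<bar>u\<bar> powr a * u) has_real_derivative (a + 1) * \<bar>u\<bar> powr a) (at u)"
proof -
  consider "u > 0" | "u < 0" | "u = 0" by linarith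
  then show ?thesis
  proof cases
    case 1
    have "((\<lambda>u. u powr (a + 1)) has_real_derivative (a + 1) * u powr a) (at u)"
      using has_real_derivative_powr[OF 1, of "a + 1"] by simp
    moreover have "\<forall>\<^sub>F x in nhds u. x > 0" using 1 by (rule eventually_nhds_in_open[of "{0<..}", simplified, rotated]) auto
    then have "\<forall>\<^sub>F x in nhds u. \<bar>x\<bar> powr a * x = x powr (a + 1)"
      by eventually_elim (simp add: powr_add)
    ultimately show ?thesis using 1 by (subst DERIV_cong_ev[OF refl _ refl]) auto
  next
    case 2
    have u: "-u > 0" using 2 by simp
    have "((\<lambda>u. (-u) powr (a + 1)) has_real_derivative ((a + 1) * (-u) powr (a + 1 - 1)) * (-1)) (at u)"
      by (rule DERIV_chain2[where f = "\<lambda>x. x powr (a + 1)" and g = uminus, OF has_real_derivative_powr[OF u]]) (auto intro!: derivative_eq_intros)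
    from DERIV_minus[OF this] have "((\<lambda>u. - ((-u) powr (a + 1))) has_real_derivative (a + 1) * (-u) powr a) (at u)" by simp
    moreover have "\<forall>\<^sub>F x in nhds u. x < 0" using 2 by (rule eventually_nhds_in_open[of "{..<0}", simplified, rotated]) auto
    then have "\<forall>\<^sub>F x in nhds u. \<bar>x\<bar> powr a * x = - ((-x) powr (a + 1))"
      by eventually_elim (simp add: powr_add)
    ultimately show ?thesis using 2 by (subst DERIV_cong_ev[OF refl _ refl]) auto
  next
    case 3
    have "((\<lambda>h. \<bar>h\<bar> powr a) \<longlongrightarrow> 0 powr a) (at (0::real))"
      using assms by (intro tendsto_intros) (auto intro!: tendsto_eq_intros)
    moreover have "\<forall>\<^sub>F h in at (0::real). \<bar>h\<bar> powr a = (\<bar>h\<bar> powr a * h) / h"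
      by (auto simp: eventually_at_filter)
    ultimately have "((\<lambda>h. (\<bar>h\<bar> powr a * h) / h) \<longlongrightarrow> 0 powr a) (at (0::real))"
      by (rule Lim_transform_eventually)
    then show ?thesis using 3 by (simp add: DERIV_def)
  qed
qed

locale hyp_bn =
  fixes N :: nat and lam :: real
  assumes N7: "N \<ge> 7" and lam_lo: "real N * (real N - 2) / 4 < lam" and lam_hi: "lam < ((real N - 1) / 2)\<^sup>2"
begin

definition "dd = N - 1"
definition "mm = (real N - 2) / 2"
definition "qq = 4 / (real N - 2)"
definition "ll = lam - real N * (real N - 2) / 4"
definition "hh u = lam * u + \<bar>u\<bar> powr qq * u"
definition "GG u = lam * u\<^sup>2 / 2 + \<bar>u\<bar> powr (qq + 2) / (qq + 2)"

lemma mm2: "mm > 2" and qq0: "qq > 0" and ll0: "ll > 0" and lam0: "lam > 0" and mq: "mm * qq = 2"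
  and dd_eq: "real dd = 2 * mm + 1" and dd1: "dd \<ge> 1"
proof -
  show "mm > 2" "qq > 0" "mm * qq = 2" using N7 by (auto simp: mm_def qq_def field_simps)
  show "ll > 0" using lam_lo by (simp add: ll_def)
  have "real N * (real N - 2) / 4 > 0" using N7 by simp
  then show "lam > 0" using lam_lo by linarith
  show "real dd = 2 * mm + 1" "dd \<ge> 1" using N7 by (auto simp: dd_def mm_def field_simps of_nat_diff)
qed

sublocale ef_params mm ll qq
  by unfold_locales (use mm2 ll0 qq0 in auto)

lemma hh_deriv: "(hh has_real_derivative lam + (qq + 1) * \<bar>u\<bar> powr qq) (at u)"
  unfolding hh_def[abs_def]
  by (rule DERIV_cong, (rule DERIV_add DERIV_cmult DERIV_ident DERIV_abs_powr_mult qq0)+) simp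

lemma GG_deriv: "(GG has_real_derivative hh u) (at u)"
proof -
  have "((\<lambda>u. lam * u\<^sup>2 / 2) has_real_derivative lam * u) (at u)" by (auto intro!: derivative_eq_intros)
  from DERIV_add[OF this DERIV_abs_powr[OF qq0]] show ?thesis by (simp add: GG_def[abs_def] hh_def)
qed

lemma cont_hh: "continuous_on S hh"
  by (auto intro!: continuous_at_imp_continuous_on DERIV_isCont[OF hh_deriv])

lemma cont_GG: "continuous_on S GG"
  by (auto intro!: continuous_at_imp_continuous_on DERIV_isCont[OF GG_deriv])

lemma hh_lip:
  assumes "\<bar>a\<bar> \<le> A" "\<bar>b\<bar> \<le> A"
  shows "\<bar>hh a - hh b\<bar> \<le> (lam + (qq + 1) * A powr qq) * \<bar>a - b\<bar>"
proof -
  have "norm (hh a - hh b) \<le> (lam + (qq + 1) * A powr qq) * norm (a - b)"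
  proof (rule field_differentiable_bound[of "{-A..A}"])
    fix z assume z: "z \<in> {-A..A}"
    show "(hh has_field_derivative lam + (qq + 1) * \<bar>z\<bar> powr qq) (at z within {-A..A})"
      using hh_deriv by (rule has_field_derivative_at_within)
    have "\<bar>z\<bar> powr qq \<le> A powr qq" using z qq0 by (intro powr_mono2) auto
    then show "norm (lam + (qq + 1) * \<bar>z\<bar> powr qq) \<le> lam + (qq + 1) * A powr qq"
      using lam0 qq0 by (simp add: abs_mult)
  qed (use assms in auto)
  then show ?thesis by simp
qed

lemma hh_mono_abs: assumes "\<bar>a\<bar> \<le> A" shows "\<bar>hh a\<bar> \<le> hh A"
proof -
  have "\<bar>a\<bar> powr qq \<le> A powr qq" using assms qq0 by (intro powr_mono2) auto
  then have "\<bar>a\<bar> powr qq * \<bar>a\<bar> \<le> A powr qq * A" using assms by (intro mult_mono) auto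
  moreover have "lam * \<bar>a\<bar> \<le> lam * A" using assms lam0 by simp
  moreover have "\<bar>hh a\<bar> \<le> lam * \<bar>a\<bar> + \<bar>a\<bar> powr qq * \<bar>a\<bar>"
    unfolding hh_def using lam0 by (intro order_trans[OF abs_triangle_ineq]) (simp add: abs_mult)
  ultimately show ?thesis using assms by (simp add: hh_def)
qed

lemma hh_sign: "u * hh u \<ge> 0"
proof -
  have "u * hh u = (lam + \<bar>u\<bar> powr qq) * u\<^sup>2" by (simp add: hh_def algebra_simps power2_eq_square)
  then show ?thesis using lam0 by (simp add: add_nonneg_nonneg)
qed

lemma GG_strict: assumes "\<bar>a\<bar> < b" shows "GG a < GG b"
proof -
  have "\<bar>a\<bar>\<^sup>2 < b\<^sup>2" using assms by (intro power_strict_mono) auto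
  then have "lam * a\<^sup>2 / 2 < lam * b\<^sup>2 / 2" using lam0 by simp
  moreover have "\<bar>a\<bar> powr (qq + 2) \<le> \<bar>b\<bar> powr (qq + 2)" using assms qq0 by (intro powr_mono2) auto
  then have "\<bar>a\<bar> powr (qq + 2) / (qq + 2) \<le> \<bar>b\<bar> powr (qq + 2) / (qq + 2)" using qq0 by (intro divide_right_mono) auto
  ultimately show ?thesis by (simp add: GG_def)
qed

lemma GG_ge: "GG a \<ge> lam * a\<^sup>2 / 2" using qq0 by (simp add: GG_def)

text \<open>This is - w' for r > 0; at r = 0 the quotient 0 / 0 = 0 agrees with w'(0) = 0.\<close>

definition "vv z r = z r / sinh r ^ dd"
definition "ee w z r = (vv z r)\<^sup>2 / 2 + GG (w r)"

lemma vv_deriv: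
  assumes sol: "radial_sol dd H w z" and r: "r > 0"
  shows "(vv z has_real_derivative H (w r) - real dd * (cosh r / sinh r) * vv z r) (at r)"
proof -
  have s: "sinh r \<noteq> 0" "sinh r > 0" using r by auto
  have sd: "sinh r ^ dd = sinh r * sinh r ^ (dd - 1)" using dd1 by (cases dd) auto
  have "(z has_real_derivative sinh r ^ dd * H (w r)) (at r)" using sol r by (simp add: radial_sol_def)
  moreover have "((\<lambda>r. sinh r ^ dd) has_real_derivative real dd * sinh r ^ (dd - 1) * cosh r) (at r)"
    by (auto intro!: derivative_eq_intros)
  ultimately have "((\<lambda>r. z r / sinh r ^ dd) has_real_derivative
      (sinh r ^ dd * H (w r) * sinh r ^ dd - z r * (real dd * sinh r ^ (dd - 1) * cosh r)) / (sinh r ^ dd * sinh r ^ dd)) (at r)"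
    using s by (intro DERIV_divide) auto
  then show ?thesis unfolding vv_def[abs_def]
    by (rule DERIV_cong) (use s in \<open>simp add: field_simps sd\<close>)
qed

text \<open>The first order term dd coth r w' acts as friction on the mechanical energy.\<close>

lemma ee_deriv:
  assumes sol: "radial_sol dd H w z" and r: "r > 0" and H: "H (w r) = hh (w r)"
  shows "(ee w z has_real_derivative - real dd * (cosh r / sinh r) * (vv z r)\<^sup>2) (at r)"
proof -
  have w: "(w has_real_derivative - vv z r) (at r)" using sol r by (simp add: radial_sol_def vv_def)
  show ?thesis unfolding ee_def[abs_def]
    by (rule DERIV_cong, (rule DERIV_add DERIV_cdivide DERIV_power vv_deriv[OF sol r] DERIV_chain2[OF GG_deriv w])+)
       (simp add: H right_diff_distrib left_diff_distrib power2_eq_square diff_divide_distrib)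
qed

lemma cont_vv:
  assumes "radial_sol dd H w z" "continuous_on UNIV H" shows "continuous_on {0..} (vv z)"
  unfolding vv_def[abs_def] by (rule radial_sol_velocity_continuous[OF assms dd1])

lemma cont_ee:
  assumes "radial_sol dd H w z" "continuous_on UNIV H" shows "continuous_on {0..} (ee w z)"
proof -
  have "continuous_on {0..} w" using assms by (simp add: radial_sol_def)
  then show ?thesis unfolding ee_def[abs_def]
    by (intro continuous_intros cont_vv[OF assms] continuous_on_compose2[OF cont_GG[of UNIV]]) auto
qed

text \<open>H has to agree with \<open>hh\<close> only along the solution and only between r and s;
  this makes the lemma usable for the truncated equation.\<close>

lemma ee_antimono:
  assumes sol: "radial_sol dd H w z" and c: "continuous_on UNIV H" and r: "0 \<le> r" "r \<le> s"
    and H: "\<And>x. x \<in> {r<..<s} \<Longrightarrow> H (w x) = hh (w x)"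
  shows "ee w z s \<le> ee w z r"
proof (rule DERIV_nonpos_imp_decreasing_open[where f = "ee w z"])
  fix x assume x: "r < x" "x < s"
  then have "x > 0" using r by simp
  moreover have "cosh x / sinh x \<ge> 0" using x r by simp
  ultimately show "\<exists>y. (ee w z has_real_derivative y) (at x) \<and> y \<le> 0"
    using ee_deriv[OF sol, of x] H[of x] x
    by (intro exI[of _ "- real dd * (cosh x / sinh x) * (vv z x)\<^sup>2"]) (auto intro!: divide_nonneg_nonneg mult_nonneg_nonneg)
qed (rule r continuous_on_subset[OF cont_ee[OF sol c]], use r in auto)+

lemma ee_0: assumes "radial_sol dd H w z" shows "ee w z 0 = GG (w 0)"
  using assms by (simp add: ee_def vv_def radial_sol_def)

lemma sol_bound:
  assumes sol: "radial_sol dd hh w z" and a: "w 0 = \<alpha>" "\<alpha> \<ge> 0" and r: "r \<ge> 0"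
  shows "\<bar>w r\<bar> \<le> \<alpha>"
proof (rule ccontr)
  assume "\<not> \<bar>w r\<bar> \<le> \<alpha>"
  then have "GG \<alpha> < GG \<bar>w r\<bar>" using GG_strict[of \<alpha> "\<bar>w r\<bar>"] a by simp
  moreover have "GG \<bar>w r\<bar> = GG (w r)" by (simp add: GG_def)
  moreover have "ee w z r \<le> ee w z 0" by (rule ee_antimono[OF sol cont_hh]) (use r in auto)
  moreover have "GG (w r) \<le> ee w z r" by (simp add: ee_def)
  ultimately show False using ee_0[OF sol] a by simp
qed

text \<open>\<open>hh\<close> is only locally Lipschitz; clamping its argument makes it globally
  Lipschitz, as Picard iteration requires.\<close>

definition "clmp A u = max (- A) (min A (u::real))"

lemma clmp_lip: "A \<ge> 0 \<Longrightarrow> \<bar>clmp A u - clmp A v\<bar> \<le> \<bar>u - v\<bar>"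
  by (auto simp: clmp_def max_def min_def)
lemma clmp_bd: "A \<ge> 0 \<Longrightarrow> \<bar>clmp A u\<bar> \<le> A" by (auto simp: clmp_def max_def min_def)
lemma clmp_id: "\<bar>u\<bar> \<le> A \<Longrightarrow> clmp A u = u" by (auto simp: clmp_def max_def min_def)

definition "LL A = lam + (qq + 1) * A powr qq"

lemma trunc: "A \<ge> 0 \<Longrightarrow> radial_lipschitz dd (\<lambda>u. hh (clmp A u)) (LL A)"
proof
  assume A: "A \<ge> 0"
  show "dd \<ge> 1" by (rule dd1)
  show L: "LL A > 0" using lam0 qq0 by (simp add: LL_def add_pos_nonneg)
  fix a b
  have "\<bar>hh (clmp A a) - hh (clmp A b)\<bar> \<le> LL A * \<bar>clmp A a - clmp A b\<bar>"
    unfolding LL_def using clmp_bd[OF A] by (intro hh_lip) auto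
  also have "\<dots> \<le> LL A * \<bar>a - b\<bar>" using clmp_lip[OF A] L by (intro mult_left_mono) auto
  finally show "\<bar>hh (clmp A a) - hh (clmp A b)\<bar> \<le> LL A * \<bar>a - b\<bar>" .
qed

text \<open>Until |w| first reaches A the clamp is inactive, so the true energy decreases and
  \<open>GG\<close> at that time is at most \<open>GG \<alpha>\<close>, which is smaller than
  \<open>GG A\<close>.\<close>

lemma trunc_bound:
  assumes sol: "radial_sol dd (\<lambda>u. hh (clmp A u)) w z" and a: "w 0 = \<alpha>" "0 \<le> \<alpha>" "\<alpha> < A" and r: "r \<ge> 0"
  shows "\<bar>w r\<bar> \<le> A"
proof (rule ccontr)
  assume n: "\<not> \<bar>w r\<bar> \<le> A"
  interpret T: radial_lipschitz dd "\<lambda>u. hh (clmp A u)" "LL A" by (rule trunc) (use a in auto)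
  have cw: "continuous_on {0..} w" using sol by (simp add: radial_sol_def)
  obtain t where t: "0 < t" "t \<le> r" "\<bar>w t\<bar> - A = 0" "\<And>s. 0 \<le> s \<Longrightarrow> s < t \<Longrightarrow> \<bar>w s\<bar> - A < 0"
  proof (rule first_time[of 0 r "\<lambda>r. \<bar>w r\<bar> - A"])
    show "continuous_on {0..r} (\<lambda>r. \<bar>w r\<bar> - A)"
      by (intro continuous_intros continuous_on_subset[OF cw]) auto
  qed (use n a r in auto)
  have "ee w z t \<le> ee w z 0"
    by (rule ee_antimono[OF sol T.cont_H]) (use t clmp_id in \<open>auto simp: less_imp_le\<close>)
  moreover have "GG (w t) \<le> ee w z t" by (simp add: ee_def)
  moreover have "GG (w t) = GG \<bar>w t\<bar>" by (simp add: GG_def)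
  ultimately have "GG A \<le> GG \<alpha>" using ee_0[OF sol] a t by simp
  then show False using GG_strict[of \<alpha> A] a by simp
qed

lemma radial_sol_cong:
  assumes "radial_sol d H w z" "\<And>r. r \<ge> 0 \<Longrightarrow> H (w r) = H' (w r)"
  shows "radial_sol d H' w z"
  using assms by (auto simp: radial_sol_def)

text \<open>A single truncation at B serves all initial values below B, which gives common Lipschitz
  constants. The last clause identifies an arbitrary solution of the original equation with a member
  of the family.\<close>

lemma solution_family:
  assumes B: "B > 0"
  obtains W Z K k where
    "\<And>\<alpha>. 0 < \<alpha> \<Longrightarrow> \<alpha> < B \<Longrightarrow> radial_sol dd hh (W \<alpha>) (Z \<alpha>)" "\<And>\<alpha>. W \<alpha> 0 = \<alpha>"
    "\<And>\<alpha> \<beta> r. r \<ge> 0 \<Longrightarrow> \<bar>W \<alpha> r - W \<beta> r\<bar> \<le> K * exp (k * r) * \<bar>\<alpha> - \<beta>\<bar>"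
    "\<And>\<alpha> \<beta> r. r \<ge> 0 \<Longrightarrow> \<bar>Z \<alpha> r - Z \<beta> r\<bar> \<le> sinh r ^ dd * (K * exp (k * r)) * \<bar>\<alpha> - \<beta>\<bar>"
    "K > 0" "k > 0"
    "\<And>w z r. radial_sol dd hh w z \<Longrightarrow> 0 < w 0 \<Longrightarrow> w 0 < B \<Longrightarrow> r \<ge> 0 \<Longrightarrow> w r = W (w 0) r \<and> z r = Z (w 0) r"
proof -
  interpret T: radial_lipschitz dd "\<lambda>u. hh (clmp B u)" "LL B" by (rule trunc) (use B in auto)
  define K where "K = 2 + LL B * 2 / T.wt"
  have K: "K > 0" "2 \<le> K" "LL B * 2 / T.wt \<le> K" using T.L0 T.wt_pos by (auto simp: K_def add_pos_pos)
  show thesis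
  proof (rule that[of T.sol "\<lambda>\<alpha>. T.Flux (T.sol \<alpha>)" K T.wt])
    fix \<alpha> assume a: "0 < \<alpha>" "\<alpha> < B"
    show "radial_sol dd hh (T.sol \<alpha>) (T.Flux (T.sol \<alpha>))"
      by (rule radial_sol_cong[OF T.radial_sol_sol])
         (use trunc_bound[OF T.radial_sol_sol T.sol_0] a in \<open>auto simp: clmp_id\<close>)
  next
    fix \<alpha> \<beta> r :: real assume r: "r \<ge> 0"
    have "\<bar>T.sol \<alpha> r - T.sol \<beta> r\<bar> \<le> 2 * (exp (T.wt * r) * \<bar>\<alpha> - \<beta>\<bar>)" using T.sol_lipschitz[OF r] by (simp add: mult_ac)
    also have "\<dots> \<le> K * (exp (T.wt * r) * \<bar>\<alpha> - \<beta>\<bar>)" using K by (intro mult_right_mono) auto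
    finally show "\<bar>T.sol \<alpha> r - T.sol \<beta> r\<bar> \<le> K * exp (T.wt * r) * \<bar>\<alpha> - \<beta>\<bar>" by (simp add: mult_ac)
    have "\<bar>T.Flux (T.sol \<alpha>) r - T.Flux (T.sol \<beta>) r\<bar> \<le> (LL B * 2 / T.wt) * (sinh r ^ dd * exp (T.wt * r) * \<bar>\<alpha> - \<beta>\<bar>)"
      using T.sol_flux_lipschitz[OF r, of \<alpha> \<beta>] by (simp add: mult_ac)
    also have "\<dots> \<le> K * (sinh r ^ dd * exp (T.wt * r) * \<bar>\<alpha> - \<beta>\<bar>)" using K r by (intro mult_right_mono) auto
    finally show "\<bar>T.Flux (T.sol \<alpha>) r - T.Flux (T.sol \<beta>) r\<bar> \<le> sinh r ^ dd * (K * exp (T.wt * r)) * \<bar>\<alpha> - \<beta>\<bar>"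
      by (simp add: mult_ac)
  next
    fix w z and r :: real assume s: "radial_sol dd hh w z" and w0: "0 < w 0" "w 0 < B" and r: "r \<ge> 0"
    have bd: "\<bar>w r\<bar> \<le> w 0" if "r \<ge> 0" for r using sol_bound[OF s refl _ that] w0 by simp
    have "radial_sol dd (\<lambda>u. hh (clmp B u)) w z"
    proof (rule radial_sol_cong[OF s])
      fix r :: real assume "r \<ge> 0"
      then have "\<bar>w r\<bar> \<le> B" using bd[of r] w0 by simp
      then show "hh (w r) = hh (clmp B (w r))" by (simp add: clmp_id)
    qed
    then show "w r = T.sol (w 0) r \<and> z r = T.Flux (T.sol (w 0)) r"
      using T.bounded_radial_sol_unique[of w z "w 0" r] bd r by blast
  qed (use T.sol_0 K T.wt_pos in auto)
qed

end

section \<open>Many sign changes for large initial values\<close>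

text \<open>Sign changes are certified by points where w is nonzero, so no zero has to be located or
  shown to be simple; r is the last of the k + 1 points.\<close>

primrec alternates :: "(real \<Rightarrow> real) \<Rightarrow> nat \<Rightarrow> real \<Rightarrow> bool" where
  "alternates w 0 r \<longleftrightarrow> r > 0 \<and> w r \<noteq> 0"
| "alternates w (Suc k) r \<longleftrightarrow> (\<exists>s<r. alternates w k s \<and> w r * w s < 0)"

text \<open>The Emden--Fowler time t of the hyperbolic radius r is ln (tanh (r / 2)).\<close>

definition rho :: "real \<Rightarrow> real" where "rho t = arsinh (- 1 / sinh t)"

text \<open>For t = ln (tanh (r / 2)) the product sinh t sinh r equals - 1, which explains the
  closed form of \<open>rho\<close>.\<close>

lemma sinh_rho: "sinh (rho t) = - 1 / sinh t" by (simp add: rho_def)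

lemma rho_pos: "t < 0 \<Longrightarrow> rho t > 0" by (simp add: rho_def divide_neg_neg)

lemma cosh_rho: "t < 0 \<Longrightarrow> cosh (rho t) = - cosh t / sinh t"
proof -
  assume t: "t < 0"
  have "cosh (rho t) = sqrt ((- 1 / sinh t)\<^sup>2 + 1)" by (simp only: rho_def cosh_arsinh_real)
  also have "(- 1 / sinh t)\<^sup>2 + 1 = (cosh t / sinh t)\<^sup>2"
    using t by (simp add: power_divide field_simps cosh_square_eq)
  also have "sqrt \<dots> = \<bar>cosh t / sinh t\<bar>" by simp
  also have "\<dots> = - cosh t / sinh t" 
  proof -
    have "cosh t / sinh t \<le> 0" using t by (intro divide_nonneg_neg) auto
    then have "\<bar>cosh t / sinh t\<bar> = - (cosh t / sinh t)" by (rule abs_of_nonpos)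
    then show ?thesis by (simp only: minus_divide_left)
  qed
  finally show ?thesis .
qed

lemma rho_deriv: assumes "t < 0" shows "(rho has_real_derivative sinh (rho t)) (at t)"
proof -
  have i: "((\<lambda>t. - 1 / sinh t) has_real_derivative cosh t / (sinh t)\<^sup>2) (at t)"
    using assms by (auto intro!: derivative_eq_intros simp: power2_eq_square)
  have "(rho has_real_derivative 1 / sqrt ((- 1 / sinh t)\<^sup>2 + 1) * (cosh t / (sinh t)\<^sup>2)) (at t)"
    unfolding rho_def[abs_def] using DERIV_chain2[OF arsinh_real_has_field_derivative i] .
  moreover have "sqrt ((- 1 / sinh t)\<^sup>2 + 1) = - cosh t / sinh t"
    using cosh_rho[OF assms] unfolding rho_def cosh_arsinh_real .
  moreover have "1 / (- cosh t / sinh t) * (cosh t / (sinh t)\<^sup>2) = - 1 / sinh t"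
    using assms by (simp add: field_simps power2_eq_square)
  ultimately show ?thesis by (simp only: sinh_rho)
qed

lemma rho_mono: assumes "s < t" "t < 0" shows "rho s < rho t"
proof -
  have "sinh s < sinh t" "sinh t < 0" using assms by auto
  then have "- 1 / sinh s < - 1 / sinh t" by (simp add: field_simps)
  then show ?thesis by (simp add: rho_def)
qed

lemma rho_inverse: assumes "r > 0" shows "rho (- arsinh (1 / sinh r)) = r"
  using assms by (simp add: rho_def arsinh_sinh_real)

lemma rho_lim: "filterlim rho (at 0 within {0..}) at_bot"
proof -
  have "((\<lambda>t::real. - 1 / sinh t) \<longlongrightarrow> 0) at_bot"
    by (intro tendsto_divide_0[OF tendsto_const] filterlim_at_bot_imp_at_infinity sinh_real_at_bot)
  then have "(rho \<longlongrightarrow> arsinh 0) at_bot" unfolding rho_def by (intro tendsto_intros)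
  then have l: "(rho \<longlongrightarrow> 0) at_bot" by simp
  have "\<forall>\<^sub>F t in at_bot. t < (0::real)" by (rule eventually_gt_at_bot)
  then have "\<forall>\<^sub>F t in at_bot. rho t \<in> {0..} \<and> rho t \<noteq> 0"
    by eventually_elim (use rho_pos in \<open>auto simp: less_imp_le\<close>, force)
  then show ?thesis using l by (simp add: filterlim_at)
qed

context hyp_bn begin

definition "yy w t = sinh (rho t) powr mm * w (rho t)"
text \<open>The t-derivative of \<open>yy\<close>, that is sinh r times the r-derivative, since dr /
  dt = sinh r.\<close>

definition "yyd w z t = mm * cosh (rho t) * (sinh (rho t) powr mm * w (rho t)) - sinh (rho t) powr (mm + 1) * vv z (rho t)"

lemma ef_Y_deriv:
  assumes sol: "radial_sol dd hh w z" and r: "r > 0"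
  shows "((\<lambda>r. sinh r powr mm * w r) has_real_derivative
     (mm * cosh r * (sinh r powr mm * w r) - sinh r powr (mm + 1) * vv z r) / sinh r) (at r)"
proof -
  have s: "sinh r > 0" using r by simp
  have w: "(w has_real_derivative - vv z r) (at r)" using sol r by (simp add: radial_sol_def vv_def)
  have p: "((\<lambda>r. sinh r powr mm) has_real_derivative mm * sinh r powr (mm - 1) * cosh r) (at r)"
    by (rule DERIV_chain2[where g = sinh and f = "\<lambda>x. x powr a" for a, OF has_real_derivative_powr[OF s]]) (auto intro!: derivative_eq_intros)
  show ?thesis
    by (rule DERIV_cong[OF DERIV_mult[OF p w]]) (use s in \<open>simp add: powr_diff powr_add field_simps\<close>)
qed

text \<open>The exponent \<open>mm\<close> is tuned to this equation: dd = 2 mm + 1 cancels the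
  first order terms, mm qq = 2 makes the nonlinearity autonomous, and lam = ll + mm^2 + mm leaves
  mm^2 - ll sinh^2 r as the linear coefficient.\<close>

lemma ef_Yd_deriv:
  assumes sol: "radial_sol dd hh w z" and r: "r > 0"
  shows "((\<lambda>r. mm * cosh r * (sinh r powr mm * w r) - sinh r powr (mm + 1) * vv z r) has_real_derivative
     (mm\<^sup>2 - ll * (sinh r)\<^sup>2 - \<bar>sinh r powr mm * w r\<bar> powr qq) * (sinh r powr mm * w r) / sinh r) (at r)"
proof -
  have s: "sinh r > 0" using r by simp
  define S P where "S = sinh r" and "P = sinh r powr mm"
  have S: "S > 0" "P > 0" using s by (auto simp: S_def P_def)
  have p: "((\<lambda>r. sinh r powr (mm + 1)) has_real_derivative ((mm + 1) * sinh r powr (mm + 1 - 1)) * cosh r) (at r)"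
    by (rule DERIV_chain2[where g = sinh and f = "\<lambda>x. x powr a" for a, OF has_real_derivative_powr[OF s]]) (auto intro!: derivative_eq_intros)
  have c: "((\<lambda>r. mm * cosh r) has_real_derivative mm * sinh r) (at r)" by (auto intro!: derivative_eq_intros)
  have D: "((\<lambda>r. mm * cosh r * (sinh r powr mm * w r) - sinh r powr (mm + 1) * vv z r) has_real_derivative
      mm * sinh r * (sinh r powr mm * w r)
      + ((mm * cosh r * (sinh r powr mm * w r) - sinh r powr (mm + 1) * vv z r) / sinh r) * (mm * cosh r)
      - (((mm + 1) * sinh r powr (mm + 1 - 1)) * cosh r * vv z r
         + (hh (w r) - real dd * (cosh r / sinh r) * vv z r) * sinh r powr (mm + 1))) (at r)"
    by (rule DERIV_diff[OF DERIV_mult[OF c ef_Y_deriv[OF sol r]] DERIV_mult[OF p vv_deriv[OF sol r]]])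
  have P1: "sinh r powr (mm + 1) = P * S" using s by (simp add: P_def S_def powr_add)
  have "\<bar>P * w r\<bar> powr qq = P powr qq * \<bar>w r\<bar> powr qq" using S by (simp add: abs_mult powr_mult)
  also have "P powr qq = S\<^sup>2" using s mq by (simp add: P_def S_def powr_powr powr_numeral)
  finally have a: "\<bar>P * w r\<bar> powr qq = S\<^sup>2 * \<bar>w r\<bar> powr qq" .
  have lam: "lam = ll + mm\<^sup>2 + mm" by (simp add: ll_def mm_def power2_eq_square field_simps)
  have ch: "(cosh r)\<^sup>2 = S\<^sup>2 + 1" by (simp add: S_def cosh_square_eq)
  have "mm * S * (P * w r) + ((mm * cosh r * (P * w r) - P * S * vv z r) / S) * (mm * cosh r)
      - (((mm + 1) * P) * cosh r * vv z r + (hh (w r) - (2 * mm + 1) * (cosh r / S) * vv z r) * (P * S))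
      = (mm * S\<^sup>2 * (P * w r) + mm\<^sup>2 * (cosh r)\<^sup>2 * (P * w r) - S\<^sup>2 * P * hh (w r)) / S"
  proof -
    define C V H where "C = cosh r" and "V = vv z r" and "H = hh (w r)"
    have "mm * S * (P * w r) + ((mm * C * (P * w r) - P * S * V) / S) * (mm * C)
      - (((mm + 1) * P) * C * V + (H - (2 * mm + 1) * (C / S) * V) * (P * S))
      = (mm * S\<^sup>2 * (P * w r) + mm\<^sup>2 * C\<^sup>2 * (P * w r) - S\<^sup>2 * P * H) / S"
      using S by (simp add: divide_simps) algebra
    then show ?thesis by (simp only: C_def V_def H_def)
  qed
  also have "mm * S\<^sup>2 * (P * w r) + mm\<^sup>2 * (cosh r)\<^sup>2 * (P * w r) - S\<^sup>2 * P * hh (w r)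
      = (mm\<^sup>2 - ll * S\<^sup>2 - S\<^sup>2 * \<bar>w r\<bar> powr qq) * (P * w r)"
  proof -
    define Q L where "Q = \<bar>w r\<bar> powr qq" and "L = ll"
    have "hh (w r) = (ll + mm\<^sup>2 + mm) * w r + Q * w r" by (simp only: hh_def Q_def lam[symmetric])
    then have h: "hh (w r) = (L + mm\<^sup>2 + mm) * w r + Q * w r" by (simp only: L_def)
    show ?thesis unfolding ch h Q_def[symmetric] L_def[symmetric] by algebra
  qed
  finally have e: "mm * S * (P * w r) + ((mm * cosh r * (P * w r) - P * S * vv z r) / S) * (mm * cosh r)
      - (((mm + 1) * P) * cosh r * vv z r + (hh (w r) - (2 * mm + 1) * (cosh r / S) * vv z r) * (P * S))
      = (mm\<^sup>2 - ll * S\<^sup>2 - S\<^sup>2 * \<bar>w r\<bar> powr qq) * (P * w r) / S" .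
  show ?thesis
    by (rule DERIV_cong[OF D]) (use e in \<open>simp add: P1[folded S_def] dd_eq a P_def[folded S_def, symmetric] flip: S_def\<close>)
qed

lemma ef: assumes sol: "radial_sol dd hh w z" shows "emden_fowler mm ll qq (yy w) (yyd w z)"
proof
  fix t :: real assume t: "t < 0"
  have s: "sinh (rho t) > 0" using rho_pos[OF t] by simp
  show "(yy w has_real_derivative yyd w z t) (at t)"
    unfolding yy_def[abs_def] yyd_def
    by (rule DERIV_cong[OF DERIV_chain2[OF ef_Y_deriv[OF sol rho_pos[OF t]] rho_deriv[OF t]]]) (use s in simp)
  have "phi t = ll * (sinh (rho t))\<^sup>2" by (simp add: phi_def sinh_rho power_divide)
  then show "(yyd w z has_real_derivative (mm\<^sup>2 - phi t - \<bar>yy w t\<bar> powr qq) * yy w t) (at t)"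
    unfolding yy_def yyd_def[abs_def]
    by (intro DERIV_cong[OF DERIV_chain2[OF ef_Yd_deriv[OF sol rho_pos[OF t]] rho_deriv[OF t]]]) (use s in simp)
qed

lemma tendsto_rho: "continuous_on {0..} f \<Longrightarrow> ((\<lambda>t. f (rho t)) \<longlongrightarrow> f 0) at_bot"
  by (rule filterlim_compose[OF _ rho_lim]) (simp add: continuous_on_def)

lemma yy_lim: assumes sol: "radial_sol dd hh w z" shows "(yy w \<longlongrightarrow> 0) at_bot"
proof -
  have "continuous_on {0..} w" using sol by (simp add: radial_sol_def)
  moreover have "continuous_on {0..} (\<lambda>r::real. sinh r powr mm)"
    using mm2 by (intro continuous_on_powr' continuous_intros) auto
  ultimately have "continuous_on {0..} (\<lambda>r. sinh r powr mm * w r)" by (intro continuous_on_mult)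
  from tendsto_rho[OF this] show ?thesis by (simp add: yy_def[abs_def])
qed

lemma yyd_lim: assumes sol: "radial_sol dd hh w z" shows "(yyd w z \<longlongrightarrow> 0) at_bot"
proof -
  have "continuous_on {0..} w" using sol by (simp add: radial_sol_def)
  moreover have "continuous_on {0..} (\<lambda>r::real. sinh r powr mm)" "continuous_on {0..} (\<lambda>r::real. sinh r powr (mm + 1))"
    using mm2 by (intro continuous_on_powr' continuous_intros; auto)+
  ultimately have "continuous_on {0..} (\<lambda>r. mm * cosh r * (sinh r powr mm * w r) - sinh r powr (mm + 1) * vv z r)"
    using cont_vv[OF sol cont_hh]
    by (intro continuous_on_mult continuous_on_diff continuous_on_const continuous_on_cosh continuous_on_id)
  from tendsto_rho[OF this] show ?thesis by (simp add: yyd_def[abs_def])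
qed

text \<open>Being nondecreasing with limit 0 at - infinity, the energy is nonnegative. If it
  vanished at some t it would vanish at all earlier times, although its derivative dphi y^2 / 2 is
  positive near - infinity, where w is close to w 0 > 0.\<close>

lemma ef_pos:
  assumes sol: "radial_sol dd hh w z" and w0: "w 0 > 0"
  shows "emden_fowler_pos mm ll qq (yy w) (yyd w z)"
proof -
  interpret emden_fowler mm ll qq "yy w" "yyd w z" by (rule ef[OF sol])
  have "continuous_on {0..} (\<lambda>r::real. ll * (sinh r)\<^sup>2)" by (intro continuous_intros)
  from tendsto_rho[OF this] have phi0: "(phi \<longlongrightarrow> 0) at_bot"
    by (simp add: phi_def[abs_def] sinh_rho power_divide)
  have "(En \<longlongrightarrow> 0\<^sup>2 / 2 - mm\<^sup>2 * 0\<^sup>2 / 2 + 0 * 0\<^sup>2 / 2 + \<bar>0\<bar> powr (qq + 2) / (qq + 2)) at_bot"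
    unfolding En_def[abs_def] using qq0
    by (intro tendsto_intros yy_lim[OF sol] yyd_lim[OF sol] phi0) (auto intro!: tendsto_eq_intros yy_lim[OF sol])
  then have E0: "(En \<longlongrightarrow> 0) at_bot" by simp
  have nn: "En t \<ge> 0" if "t < 0" for t
  proof (rule tendsto_upperbound[OF E0])
    have "\<forall>\<^sub>F s in at_bot. s < t" by (rule eventually_gt_at_bot)
    then show "\<forall>\<^sub>F s in at_bot. En s \<le> En t" by eventually_elim (use En_mono that in auto)
  qed simp
  have cw: "continuous_on {0..} w" using sol by (simp add: radial_sol_def)
  have "\<forall>\<^sub>F t in at_bot. w (rho t) > 0" by (rule order_tendstoD(1)[OF tendsto_rho[OF cw] w0])
  then obtain T where T: "w (rho t) > 0" if "t \<le> T" for t by (auto simp: eventually_at_bot_linorder)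
  show ?thesis
  proof
    fix t :: real assume t: "t < 0"
    show "En t > 0"
    proof (rule ccontr)
      assume "\<not> En t > 0"
      then have z: "En s = 0" if "s \<le> t" for s using nn[of s] En_mono[of s t] that t by auto
      define s where "s = min t T - 1"
      have s: "s < t" "s < T" "s < 0" using t by (auto simp: s_def)
      have "(En has_real_derivative dphi s * (yy w s)\<^sup>2 / 2) (at s)" by (rule En_deriv[OF s(3)])
      moreover have "(En has_real_derivative 0) (at s)"
      proof -
        have "\<forall>\<^sub>F x in nhds s. x < t" using s(1) by (rule eventually_nhds_in_open[of "{..<t}", simplified, rotated])
        then have "\<forall>\<^sub>F x in nhds s. En x = 0" by eventually_elim (use z in auto)
        then show ?thesis by (subst DERIV_cong_ev[OF refl _ refl]) auto
      qed
      ultimately have "dphi s * (yy w s)\<^sup>2 / 2 = 0" by (rule DERIV_unique)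
      moreover have "dphi s > 0" using dphi_ge[OF s(3)] ll0 by (smt (verit) exp_gt_zero mult_pos_pos)
      moreover have "yy w s > 0" using T[of s] s rho_pos[OF s(3)] by (simp add: yy_def)
      ultimately show False by simp
    qed
  qed
qed

text \<open>A common zero of w and z at r > 0 would be a common zero of y and y', where the energy
  is 0.\<close>

lemma sol_nonzero:
  assumes sol: "radial_sol dd hh w z" and w0: "w 0 > 0" and r: "r \<ge> 0"
  shows "(w r)\<^sup>2 + (z r)\<^sup>2 > 0"
proof (cases "r = 0")
  case False
  interpret emden_fowler_pos mm ll qq "yy w" "yyd w z" by (rule ef_pos[OF sol w0])
  define t where "t = - arsinh (1 / sinh r)"
  have r0: "r > 0" using r False by simp
  then have t: "t < 0" "rho t = r" using rho_inverse by (auto simp: t_def)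
  have "w r \<noteq> 0 \<or> z r \<noteq> 0"
  proof (rule ccontr)
    assume "\<not> ?thesis"
    then have "yy w t = 0" "yyd w z t = 0" using t by (auto simp: yy_def yyd_def vv_def)
    then have "En t = 0" by (simp add: En_def)
    then show False using Epos[OF t(1)] by simp
  qed
  then show ?thesis by (auto simp: sum_power2_gt_zero_iff)
qed (use w0 in \<open>simp add: add_pos_nonneg\<close>)

text \<open>Radius up to which the bound w \<ge> \<alpha> - hh \<alpha> r^2 still guarantees
  \<alpha> / 2.\<close>

definition "r0 \<alpha> = 1 / sqrt (2 * (lam + \<alpha> powr qq))"

lemma initial_plateau:
  assumes sol: "radial_sol dd hh w z" and w0: "w 0 = \<alpha>" "\<alpha> > 0" and r: "0 \<le> r" "r \<le> r0 \<alpha>"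
  shows "w r \<ge> \<alpha> / 2"
proof (cases "r = 0")
  case False
  then have rp: "r > 0" using r by simp
  have cw: "continuous_on {0..} w" using sol by (simp add: radial_sol_def)
  have dw: "(w has_real_derivative - vv z x) (at x)" if "x > 0" for x using sol that by (simp add: radial_sol_def vv_def)
  have "\<exists>l x. 0 < x \<and> x < r \<and> (w has_real_derivative l) (at x) \<and> w r - w 0 = (r - 0) * l"
    by (rule MVT[OF rp continuous_on_subset[OF cw]]) (use dw in \<open>auto simp: real_differentiable_def\<close>)
  then obtain l x where x: "0 < x" "x < r" "(w has_real_derivative l) (at x)" "w r - w 0 = (r - 0) * l" by blast
  have l: "l = - vv z x" using DERIV_unique[OF x(3) dw[OF x(1)]] .
  have "\<bar>z x / sinh x ^ dd\<bar> \<le> hh \<alpha> * x"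
    by (rule radial_sol_velocity_bound[OF sol _ cont_hh]) (use x sol_bound[OF sol w0(1)] w0 hh_mono_abs in auto)
  also have "\<dots> \<le> hh \<alpha> * r" using x w0 lam0 by (intro mult_left_mono) (auto simp: hh_def)
  finally have "\<bar>l\<bar> \<le> hh \<alpha> * r" using l by (simp add: vv_def)
  then have "l \<ge> - (hh \<alpha> * r)" by simp
  then have "r * l \<ge> r * (- (hh \<alpha> * r))" using rp by (intro mult_left_mono) auto
  then have "w r \<ge> \<alpha> - hh \<alpha> * r\<^sup>2" using x w0 by (simp add: power2_eq_square mult_ac)
  moreover have "hh \<alpha> * r\<^sup>2 \<le> \<alpha> / 2"
  proof -
    have p: "lam + \<alpha> powr qq > 0" using lam0 by (simp add: add_pos_nonneg)
    have "r\<^sup>2 \<le> (r0 \<alpha>)\<^sup>2" using r by (intro power_mono) auto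
    also have "\<dots> = 1 / (2 * (lam + \<alpha> powr qq))" using p by (simp add: r0_def power_divide)
    finally have "hh \<alpha> * r\<^sup>2 \<le> hh \<alpha> * (1 / (2 * (lam + \<alpha> powr qq)))"
      using w0 lam0 by (intro mult_left_mono) (auto simp: hh_def)
    also have h: "hh \<alpha> = (lam + \<alpha> powr qq) * \<alpha>" using w0 by (simp add: hh_def algebra_simps)
    also have "(lam + \<alpha> powr qq) * \<alpha> * (1 / (2 * (lam + \<alpha> powr qq))) = \<alpha> / 2"
      using p nonzero_mult_div_cancel_left[of "lam + \<alpha> powr qq" "\<alpha> / 2"] by (simp add: field_simps)
    finally show ?thesis unfolding h .
  qed
  ultimately show ?thesis by simp
qed (use w0 in simp)

definition "bubble w z t \<longleftrightarrow> t < 0 \<and> \<bar>yy w t\<bar> \<ge> b2 \<and> emden_fowler.En mm ll qq (yy w) (yyd w z) t \<ge> cc * exp (2 * t)"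

text \<open>By scaling, \<open>yy\<close> at the end of the plateau is at least c0, which does not
  involve \<alpha>. The threshold A forces \<open>r0 \<alpha> \<le> rs\<close>, so the plateau ends
  before - X, early enough for the growth time in \<open>start\<close> to finish before - max T
  TT.\<close>

lemma first_bubble:
  "\<exists>A>0. \<forall>\<alpha>\<ge>A. \<forall>w z. radial_sol dd hh w z \<and> w 0 = \<alpha> \<longrightarrow> (\<exists>t\<le>-T. bubble w z t)"
proof -
  define c0 where "c0 = (1 / (2 * (lam + 1))) powr (mm / 2) / 2"
  have c0: "c0 > 0" using lam0 by (simp add: c0_def)
  define X where "X = max T TT + b2 / (k2 * c0)"
  have q0: "b2 / (k2 * c0) > 0" using b2_pos k2_pos c0 by simp
  then have X: "X > 0" using TT_pos by (auto simp: X_def)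
  define rs where "rs = rho (- X)"
  have rs: "rs > 0" unfolding rs_def using X by (intro rho_pos) auto
  define A where "A = max 1 (rs powr (- mm))"
  have "\<exists>t\<le>-T. bubble w z t" if a: "\<alpha> \<ge> A" and sol: "radial_sol dd hh w z" and w0: "w 0 = \<alpha>" for \<alpha> w z
  proof -
    have a1: "\<alpha> \<ge> 1" "\<alpha> \<ge> rs powr (- mm)" using a by (auto simp: A_def)
    interpret emden_fowler_pos mm ll qq "yy w" "yyd w z" by (rule ef_pos[OF sol]) (use w0 a1 in simp)
    define p where "p = lam + \<alpha> powr qq"
    have aq: "\<alpha> powr qq \<ge> 1" using a1 qq0 by (simp add: ge_one_powr_ge_zero)
    have p: "p > 0" "p \<ge> \<alpha> powr qq" using lam0 aq by (auto simp: p_def)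
    have r0: "r0 \<alpha> > 0" using p by (simp add: r0_def p_def)
    have "(rs powr (- mm)) powr qq \<le> \<alpha> powr qq" using a1 qq0 by (intro powr_mono2) auto
    moreover have "(rs powr (- mm)) powr qq = 1 / rs\<^sup>2" 
      unfolding powr_powr using mq rs by (simp add: powr_minus powr_numeral inverse_eq_divide)
    ultimately have "1 / rs\<^sup>2 \<le> 2 * p" using p by simp
    then have "sqrt (1 / rs\<^sup>2) \<le> sqrt (2 * p)" by (rule real_sqrt_le_mono)
    then have "1 / rs \<le> sqrt (2 * p)" using rs by (simp add: real_sqrt_divide)
    then have r0rs: "r0 \<alpha> \<le> rs" using rs p by (simp add: r0_def p_def[symmetric] field_simps)
    define ts where "ts = - arsinh (1 / sinh (r0 \<alpha>))"
    have ts: "ts < 0" "rho ts = r0 \<alpha>" using r0 rho_inverse[OF r0] by (auto simp: ts_def)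
    have "ts \<le> - X"
    proof (rule ccontr)
      assume "\<not> ts \<le> - X"
      then have "rho (- X) < rho ts" using ts by (intro rho_mono) auto
      then show False using r0rs ts by (simp add: rs_def)
    qed
    then have tX: "ts + b2 / (k2 * c0) \<le> - max T TT" by (simp add: X_def)
    have wpos: "w (rho t) \<ge> \<alpha> / 2" if "t \<le> ts" for t
    proof -
      have "t < 0" using that ts by simp
      moreover have "rho t \<le> rho ts" using that rho_mono[of t ts] ts by (cases "t = ts") auto
      ultimately show ?thesis using initial_plateau[OF sol w0, of "rho t"] rho_pos[of t] ts a1 by auto
    qed
    have "yy w ts \<ge> c0"
    proof -
      \<comment> \<open>Written as a power of \<open>\<alpha> powr qq\<close>, \<alpha> merges with
        \<open>r0 \<alpha> powr mm\<close>; what remains is the ratio of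
        \<open>\<alpha> powr qq\<close> to 2 p, which is at least 1 / (2 (lam + 1)) once \<alpha>
        \<ge> 1.\<close>
      have aa: "\<alpha> = (\<alpha> powr qq) powr (mm / 2)" using a1 mq by (simp add: powr_powr mult.commute)
      have "r0 \<alpha> = (2 * p) powr (- (1/2))" using p by (simp add: r0_def p_def[symmetric] powr_minus powr_half_sqrt inverse_eq_divide)
      then have "r0 \<alpha> powr mm = (2 * p) powr (- (mm / 2))" using p by (simp add: powr_powr)
      also have "\<dots> = (1 / (2 * p)) powr (mm / 2)" using p by (simp add: powr_minus powr_divide inverse_eq_divide)
      finally have e: "r0 \<alpha> powr mm * \<alpha> = (1 / (2 * p)) powr (mm / 2) * (\<alpha> powr qq) powr (mm / 2)"
        using aa by simp
      also have "\<dots> = (1 / (2 * p) * \<alpha> powr qq) powr (mm / 2)" by (rule powr_mult[symmetric])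
      also have "\<dots> \<ge> (1 / (2 * (lam + 1))) powr (mm / 2)"
      proof (intro powr_mono2)
        have "p \<le> (lam + 1) * \<alpha> powr qq" using aq lam0 by (simp add: p_def distrib_right mult_le_cancel_left1)
        then show "1 / (2 * (lam + 1)) \<le> 1 / (2 * p) * \<alpha> powr qq" using p lam0 by (simp add: field_simps)
      qed (use mm2 lam0 in auto)
      finally have i: "r0 \<alpha> powr mm * \<alpha> / 2 \<ge> c0" by (simp add: c0_def)
      have "r0 \<alpha> powr mm * (\<alpha> / 2) \<le> sinh (r0 \<alpha>) powr mm * w (r0 \<alpha>)"
        using r0 sinh_ge_self[of "r0 \<alpha>"] wpos[of ts] ts a1 mm2 by (intro mult_mono powr_mono2) auto
      then show ?thesis using i ts by (simp add: yy_def)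
    qed
    then obtain t where t: "t \<le> ts + b2 / (k2 * c0)" "yy w t = b2" "En t \<ge> cc * exp (2 * t)"
    proof -
      have "yy w t > 0" if "t \<le> ts" for t
        using wpos[OF that] rho_pos[of t] that ts a1 by (simp add: yy_def)
      moreover have "ts + b2 / (k2 * c0) \<le> - TT" using tX max.cobounded2[of TT T] by linarith
      ultimately show ?thesis using start[OF c0 \<open>yy w ts \<ge> c0\<close> _ _ yy_lim[OF sol]] that by blast
    qed
    then have "t \<le> - T" "t < 0" using tX TT_pos by auto
    then show ?thesis using t b2_pos by (intro exI[of _ t]) (auto simp: bubble_def)
  qed
  then show ?thesis by (intro exI[of _ A]) (auto simp: A_def)
qed

lemma next_bubble:
  assumes sol: "radial_sol dd hh w z" and w0: "w 0 > 0" and b: "bubble w z t0"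
    and t0: "(1 - 2 / m1) * t0 + CC \<le> - max T TT"
  shows "\<exists>t. t0 < t \<and> t \<le> - T \<and> bubble w z t \<and> w (rho t) * w (rho t0) < 0"
proof -
  interpret emden_fowler_pos mm ll qq "yy w" "yyd w z" by (rule ef_pos[OF sol w0])
  obtain t where t: "t0 < t" "t \<le> (1 - 2 / m1) * t0 + CC" "yy w t * yy w t0 < 0" "\<bar>yy w t\<bar> \<ge> b2" "En t \<ge> cc * exp (2 * t)"
  proof -
    have "(1 - 2 / m1) * t0 + CC \<le> - TT" using t0 max.cobounded2[of TT T] by linarith
    then show ?thesis using step[of t0] b that by (auto simp: bubble_def)
  qed
  have neg: "t \<le> - T" "t < 0" using t t0 TT_pos by auto
  have "(sinh (rho t) powr mm * sinh (rho t0) powr mm) * (w (rho t) * w (rho t0)) < 0"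
    using t by (simp add: yy_def mult_ac)
  then have "w (rho t) * w (rho t0) < 0" by (auto simp: mult_less_0_iff)
  then show ?thesis using t neg by (auto simp: bubble_def)
qed

text \<open>Each bubble at time t0 is followed by another one, of opposite sign, before time
  (1 - 2 / m1) t0 + CC; the factor is positive because m > 2, that is, N > 6.\<close>

lemma many_bubbles:
  "\<exists>A>0. \<forall>\<alpha>\<ge>A. \<forall>w z. radial_sol dd hh w z \<and> w 0 = \<alpha> \<longrightarrow> (\<exists>t\<le>-T. bubble w z t \<and> alternates w k (rho t))"
proof (induction k arbitrary: T)
  case 0
  obtain A where A: "A > 0" "\<And>w z. radial_sol dd hh w z \<Longrightarrow> w 0 \<ge> A \<Longrightarrow> \<exists>t\<le>-T. bubble w z t"
    using first_bubble[of T] by auto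
  have "alternates w 0 (rho t)" if "bubble w z t" for w z t
    using that rho_pos b2_pos by (auto simp: bubble_def yy_def)
  then show ?case using A by blast
next
  case (Suc k)
  define f where "f = 1 - 2 / m1"
  have f: "f > 0" using m1_gt by (simp add: f_def)
  \<comment> \<open>Chosen so that the successor of a bubble before - T0 still comes before - max T
    TT.\<close>
  define T0 where "T0 = (max T TT + CC) / f"
  obtain A where A: "A > 0" "\<And>w z. radial_sol dd hh w z \<Longrightarrow> w 0 \<ge> A \<Longrightarrow> \<exists>t\<le>-T0. bubble w z t \<and> alternates w k (rho t)"
    using Suc.IH[of T0] by auto
  have "\<exists>t\<le>-T. bubble w z t \<and> alternates w (Suc k) (rho t)" if sol: "radial_sol dd hh w z" "w 0 \<ge> A" for w z
  proof -
    obtain t0 where t0: "t0 \<le> - T0" "bubble w z t0" "alternates w k (rho t0)" using A(2)[OF sol] by blast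
    have "f * t0 \<le> f * (- T0)" using t0 f by (intro mult_left_mono) auto
    also have "\<dots> = - (max T TT + CC)" using f by (simp add: T0_def)
    finally have "f * t0 + CC \<le> - max T TT" by simp
    then obtain t where t: "t0 < t" "t \<le> - T" "bubble w z t" "w (rho t) * w (rho t0) < 0"
      using next_bubble[OF sol(1) _ t0(2), of T] A(1) sol by (auto simp: f_def)
    moreover have "rho t0 < rho t" using t by (intro rho_mono) (auto simp: bubble_def)
    ultimately show ?thesis using t0 by (intro exI[of _ t]) auto
  qed
  then show ?case using A(1) by blast
qed

lemma many_sign_changes:
  "\<exists>A>0. \<forall>w z. radial_sol dd hh w z \<and> w 0 \<ge> A \<longrightarrow> (\<exists>r. alternates w k r)"
  using many_bubbles[of 0 k] by blast

end

section \<open>Pruefer angle and behaviour at infinity\<close>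

lemma continuous_on_prod_lipschitz:
  fixes f :: "real \<Rightarrow> real \<Rightarrow> real"
  assumes c: "\<And>\<alpha>. \<alpha> \<in> U \<Longrightarrow> continuous_on T (f \<alpha>)"
    and l: "\<And>\<alpha> \<beta> x. \<alpha> \<in> U \<Longrightarrow> \<beta> \<in> U \<Longrightarrow> x \<in> T \<Longrightarrow> \<bar>f \<alpha> x - f \<beta> x\<bar> \<le> C * \<bar>\<alpha> - \<beta>\<bar>"
  shows "continuous_on (U \<times> T) (\<lambda>p. f (fst p) (snd p))"
proof -
  have "((\<lambda>p. f (fst p) (snd p)) \<longlongrightarrow> f \<alpha> x) (at (\<alpha>, x) within U \<times> T)" if "\<alpha> \<in> U" "x \<in> T" for \<alpha> x
  proof -
    have "((\<lambda>p. f (fst p) (snd p) - f \<alpha> (snd p)) \<longlongrightarrow> 0) (at (\<alpha>, x) within U \<times> T)"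
    proof (rule Lim_null_comparison)
      show "\<forall>\<^sub>F p in at (\<alpha>, x) within U \<times> T. norm (f (fst p) (snd p) - f \<alpha> (snd p)) \<le> C * \<bar>fst p - \<alpha>\<bar>"
        unfolding eventually_at_filter by (rule always_eventually) (use l that in auto)
      have "((\<lambda>p. C * \<bar>fst p - \<alpha>\<bar>) \<longlongrightarrow> C * \<bar>fst (\<alpha>, x) - \<alpha>\<bar>) (at (\<alpha>, x) within U \<times> T)"
        by (intro tendsto_intros)
      then show "((\<lambda>p. C * \<bar>fst p - \<alpha>\<bar>) \<longlongrightarrow> 0) (at (\<alpha>, x) within U \<times> T)" by simp
    qed
    moreover have "((\<lambda>p. f \<alpha> (snd p)) \<longlongrightarrow> f \<alpha> x) (at (\<alpha>, x) within U \<times> T)"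
    proof -
      have "continuous_on (U \<times> T) (\<lambda>p. f \<alpha> (snd p))"
        by (rule continuous_on_compose2[OF c[OF that(1)]]) (auto intro!: continuous_intros)
      then show ?thesis using that by (auto simp: continuous_on_def)
    qed
    ultimately have "((\<lambda>p. (f (fst p) (snd p) - f \<alpha> (snd p)) + f \<alpha> (snd p)) \<longlongrightarrow> 0 + f \<alpha> x) (at (\<alpha>, x) within U \<times> T)"
      by (rule tendsto_add)
    then show ?thesis by simp
  qed
  then show ?thesis by (auto simp: continuous_on_def)
qed

context hyp_bn begin

text \<open>\<open>theta\<close> is the polar angle of (w, z), \<open>prf\<close> its derivative; it is monotone, and \<open>cnt\<close> counts
  the zeros of w passed so far.\<close>

definition "prf w z x = (w x * (sinh x ^ dd * hh (w x)) + vv z x * z x) / ((w x)\<^sup>2 + (z x)\<^sup>2)"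
definition "theta w z r = integral {0..r} (prf w z)"
definition "cnt w z r = \<lfloor>theta w z r / pi + 1 / 2\<rfloor>"

context
  fixes w z :: "real \<Rightarrow> real"
  assumes sol: "radial_sol dd hh w z" and w0: "w 0 > 0"
begin

lemma cw: "continuous_on {0..} w" and cz: "continuous_on {0..} z" and z0: "z 0 = 0"
  and dw: "r > 0 \<Longrightarrow> (w has_real_derivative - vv z r) (at r)"
  and dz: "r > 0 \<Longrightarrow> (z has_real_derivative sinh r ^ dd * hh (w r)) (at r)"
  using sol by (auto simp: radial_sol_def vv_def)

lemmas nz = sol_nonzero[OF sol w0]

lemma cont_hw: "continuous_on {0..} (\<lambda>x. hh (w x))"
  by (rule continuous_on_compose2[OF cont_hh[of UNIV] cw]) auto

lemma cont_prf: "continuous_on {0..} (prf w z)"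
  unfolding prf_def[abs_def]
  by (intro continuous_intros cw cz cont_hw cont_vv[OF sol cont_hh]) (use nz in force)

lemma vv_z_nonneg: "r \<ge> 0 \<Longrightarrow> vv z r * z r \<ge> 0"
  by (simp add: vv_def divide_nonneg_nonneg)

lemma prf_nonneg: assumes "x \<ge> 0" shows "prf w z x \<ge> 0"
proof -
  have "sinh x ^ dd * (w x * hh (w x)) \<ge> 0" using hh_sign[of "w x"] assms by (intro mult_nonneg_nonneg[OF _ hh_sign]) auto
  then show ?thesis unfolding prf_def
    using vv_z_nonneg[OF assms] nz[OF assms] by (intro divide_nonneg_pos add_nonneg_nonneg) (auto simp: mult_ac)
qed

lemma cont_theta: "continuous_on {0..} (theta w z)"
  unfolding theta_def[abs_def] by (rule continuous_on_Ici_integral[OF cont_prf])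

lemma theta_0: "theta w z 0 = 0" by (simp add: theta_def)

lemma theta_deriv: "r > 0 \<Longrightarrow> (theta w z has_real_derivative prf w z r) (at r)"
  unfolding theta_def[abs_def] by (rule integral_Ici_has_real_derivative[OF cont_prf])

lemma theta_mono: assumes "0 \<le> r" "r \<le> s" shows "theta w z r \<le> theta w z s"
proof (rule DERIV_nonneg_imp_increasing_open[where f = "theta w z"])
  fix x assume "r < x" "x < s"
  then show "\<exists>y. (theta w z has_real_derivative y) (at x) \<and> 0 \<le> y"
    using theta_deriv[of x] prf_nonneg[of x] assms by auto
qed (use assms in \<open>auto intro: continuous_on_subset[OF cont_theta]\<close>)

text \<open>\<open>theta\<close> is defined by integration, hence continuous, and has yet to be
  identified with the polar angle. The deviation B satisfies B' D = B D' / 2, so B^2 / D is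
  constant, and it is 0 at r = 0.\<close>

lemma theta_direction:
  assumes r: "r \<ge> 0" shows "z r * cos (theta w z r) - w r * sin (theta w z r) = 0"
proof -
  define B where "B r = z r * cos (theta w z r) - w r * sin (theta w z r)" for r
  define D where "D r = (w r)\<^sup>2 + (z r)\<^sup>2" for r
  define F where "F r = (B r)\<^sup>2 / D r" for r
  have D: "D r > 0" if "r \<ge> 0" for r using nz that by (simp add: D_def)
  have cF: "continuous_on {0..} F" unfolding F_def[abs_def] B_def D_def
    by (intro continuous_intros cw cz cont_theta) (use nz in force)
  have dF: "(F has_real_derivative 0) (at x)" if x: "x > 0" for x
  proof -
    define w' z' t' where "w' = - vv z x" and "z' = sinh x ^ dd * hh (w x)" and "t' = prf w z x"
    have d: "(w has_real_derivative w') (at x)" "(z has_real_derivative z') (at x)"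
      "(theta w z has_real_derivative t') (at x)"
      using dw dz theta_deriv x by (auto simp: w'_def z'_def t'_def)
    have t': "t' * D x = w x * z' - w' * z x"
      using D[of x] x by (simp add: t'_def prf_def w'_def z'_def D_def)
    have dB: "(B has_real_derivative z' * cos (theta w z x) - z x * sin (theta w z x) * t'
        - (w' * sin (theta w z x) + w x * cos (theta w z x) * t')) (at x)" (is "(B has_real_derivative ?B') _")
      unfolding B_def[abs_def] by (auto intro!: derivative_eq_intros d)
    have dD: "(D has_real_derivative 2 * (w x * w' + z x * z')) (at x)"
      unfolding D_def[abs_def] by (auto intro!: derivative_eq_intros d)
    have "?B' * D x = B x * (w x * w' + z x * z')"
    proof -
      have "?B' * D x = (z' * cos (theta w z x) - w' * sin (theta w z x)) * D x
          - (z x * sin (theta w z x) + w x * cos (theta w z x)) * (t' * D x)" by (simp add: algebra_simps)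
      also have "\<dots> = B x * (w x * w' + z x * z')" unfolding t' by (simp add: B_def D_def algebra_simps power2_eq_square)
      finally show ?thesis .
    qed
    then have e: "2 * B x * (?B' * D x) - (B x)\<^sup>2 * (2 * (w x * w' + z x * z')) = 0"
      by (simp add: power2_eq_square)
    have "(F has_real_derivative (2 * B x * ?B' * D x - (B x)\<^sup>2 * (2 * (w x * w' + z x * z'))) / (D x * D x)) (at x)"
      unfolding F_def[abs_def] using D[of x] x
      by (intro DERIV_divide[OF _ dD] DERIV_cong[OF DERIV_power[OF dB, of 2]]) auto
    then show ?thesis using e by (simp add: mult.assoc)
  qed
  have "F r = F 0"
  proof (cases "r = 0")
    case False
    show ?thesis
      by (rule DERIV_isconst2[of 0 r]) (use False r dF cF in \<open>auto intro: continuous_on_subset\<close>)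
  qed simp
  also have "\<dots> = 0" by (simp add: F_def B_def z0 theta_0)
  finally show ?thesis using D[OF r] by (auto simp: F_def B_def)
qed

text \<open>\<open>theta_direction\<close> only fixes the line through (w, z); the signed radius
  starts positive and cannot change sign, as (w, z) never vanishes.\<close>

lemma polar:
  assumes r: "r \<ge> 0"
  shows "\<exists>R>0. w r = R * cos (theta w z r) \<and> z r = R * sin (theta w z r)"
proof -
  define A where "A r = w r * cos (theta w z r) + z r * sin (theta w z r)" for r
  have cA: "continuous_on {0..} A" unfolding A_def[abs_def]
    by (intro continuous_intros cw cz cont_theta)
  have e: "w x = A x * cos (theta w z x) \<and> z x = A x * sin (theta w z x)" if "x \<ge> 0" for x
  proof -
    define c s where "c = cos (theta w z x)" and "s = sin (theta w z x)"
    have B: "z x * c - w x * s = 0" using theta_direction[OF that] by (simp add: c_def s_def)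
    have cs: "c\<^sup>2 + s\<^sup>2 = 1" by (simp add: c_def s_def)
    have "(w x * c + z x * s) * c = w x * (c\<^sup>2 + s\<^sup>2) + (z x * c - w x * s) * s" by algebra
    moreover have "(w x * c + z x * s) * s = z x * (c\<^sup>2 + s\<^sup>2) - (z x * c - w x * s) * c" by algebra
    ultimately show ?thesis using B cs by (simp add: A_def c_def[symmetric] s_def[symmetric])
  qed
  have nzA: "A x \<noteq> 0" if "x \<ge> 0" for x using e[OF that] nz[OF that] by auto
  have A0: "A 0 > 0" using w0 by (simp add: A_def theta_0)
  have "A r > 0"
  proof (rule ccontr)
    assume "\<not> A r > 0"
    then have "\<exists>x\<ge>0. x \<le> r \<and> A x = 0"
      using A0 r by (intro IVT2') (auto intro: continuous_on_subset[OF cA])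
    then show False using nzA by blast
  qed
  then show ?thesis using e[OF r] by blast
qed

lemma theta_nonneg: "r \<ge> 0 \<Longrightarrow> theta w z r \<ge> 0"
  using theta_mono[of 0 r] theta_0 by simp

text \<open>Between points of opposite sign the cosine of \<open>theta\<close> must change sign, so
  \<open>theta\<close> passes the next odd multiple of pi / 2. At k = 0 the bound is - pi / 2, which
  lies below \<open>theta\<close> \<ge> 0.\<close>

lemma alternates_theta: "alternates w k r \<Longrightarrow> r > 0 \<and> theta w z r > (real k - 1 / 2) * pi"
proof (induction k arbitrary: r)
  case 0
  then show ?case using theta_nonneg[of r] pi_gt_zero by (auto intro: less_le_trans[of _ 0])
next
  case (Suc k)
  then obtain s where s: "s < r" "alternates w k s" "w r * w s < 0" by auto
  have IH: "s > 0" "theta w z s > (real k - 1 / 2) * pi" using Suc.IH[OF s(2)] by auto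
  define a b where "a = theta w z s - real k * pi" and "b = theta w z r - real k * pi"
  have ab: "a \<le> b" "a > - (pi / 2)" using theta_mono[of s r] IH s by (auto simp: a_def b_def algebra_simps)
  have "b > pi / 2"
  proof (rule ccontr)
    assume "\<not> b > pi / 2"
    then have "cos a \<ge> 0" "cos b \<ge> 0" using ab by (auto intro!: cos_ge_zero)
    have "theta w z s = a + pi * real k" "theta w z r = b + pi * real k" by (auto simp: a_def b_def)
    then have c: "cos (theta w z s) = cos a * (-1) ^ k" "cos (theta w z r) = cos b * (-1) ^ k"
      by (simp_all add: cos_add mult.commute[of pi])
    obtain R1 R2 where "R1 > 0" "R2 > 0" "w s = R1 * cos (theta w z s)" "w r = R2 * cos (theta w z r)"
      using polar[of s] polar[of r] IH s by auto
    then have "w r * w s = (R1 * R2) * (cos a * cos b) * ((-1) ^ k * (-1) ^ k)" by (simp add: c)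
    also have "(-1) ^ k * (-1) ^ k = (1::real)" by (simp add: power_mult_distrib[symmetric])
    finally have "w r * w s \<ge> 0" using \<open>R1 > 0\<close> \<open>R2 > 0\<close> \<open>cos a \<ge> 0\<close> \<open>cos b \<ge> 0\<close> by simp
    then show False using s by simp
  qed
  then show ?case using IH s by (simp add: b_def algebra_simps)
qed

lemma cos_pi_shift_zero: "cos ((of_int n - 1 / 2) * pi) = 0"
proof -
  have "cos ((of_int n - 1 / 2) * pi) = cos (of_int n * pi - pi / 2)" by (simp add: algebra_simps)
  also have "\<dots> = sin (of_int n * pi)" by (simp add: cos_diff)
  also have "\<dots> = 0" by (simp add: sin_zero_iff_int2)
  finally show ?thesis .
qed

text \<open>By the intermediate value theorem a jump of \<open>cnt\<close> makes
  \<open>theta\<close> pass some (n - 1 / 2) pi, where w vanishes.\<close>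

lemma cnt_const:
  assumes r1: "0 \<le> r1" "r1 \<le> r" and nzw: "\<And>x. x \<ge> r1 \<Longrightarrow> w x \<noteq> 0"
  shows "cnt w z r = cnt w z r1"
proof (rule ccontr)
  assume ne: "cnt w z r \<noteq> cnt w z r1"
  have "theta w z r1 / pi \<le> theta w z r / pi" using theta_mono[OF r1] by (simp add: divide_right_mono)
  then have "cnt w z r1 \<le> cnt w z r" unfolding cnt_def by (intro floor_mono) simp
  then have lt: "cnt w z r1 + 1 \<le> cnt w z r" using ne by simp
  define n where "n = cnt w z r1 + 1"
  have "theta w z r1 / pi + 1 / 2 < of_int n" unfolding n_def cnt_def by linarith
  then have a: "theta w z r1 \<le> (of_int n - 1 / 2) * pi" by (simp add: field_simps)
  have "of_int n \<le> theta w z r / pi + 1 / 2" using lt unfolding n_def cnt_def by linarith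
  then have b: "(of_int n - 1 / 2) * pi \<le> theta w z r" by (simp add: field_simps)
  have "\<exists>x\<ge>r1. x \<le> r \<and> theta w z x = (of_int n - 1 / 2) * pi"
    using a b r1 by (intro IVT') (auto intro: continuous_on_subset[OF cont_theta])
  then obtain x where x: "r1 \<le> x" "theta w z x = (of_int n - 1 / 2) * pi" by blast
  obtain R where "w x = R * cos (theta w z x)" using polar[of x] x r1 by auto
  then have "w x = 0" using x cos_pi_shift_zero by simp
  then show False using nzw x by blast
qed

text \<open>Away from the integers the floor in \<open>cnt\<close> is stable, which later makes the
  count locally constant in the initial value.\<close>

lemma frac_theta_nonint: assumes "r \<ge> 0" "w r \<noteq> 0" shows "theta w z r / pi + 1 / 2 \<notin> \<int>"
proof
  assume "theta w z r / pi + 1 / 2 \<in> \<int>"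
  then obtain n where "theta w z r / pi + 1 / 2 = of_int n" by (auto elim: Ints_cases)
  then have "theta w z r = (of_int n - 1 / 2) * pi" by (simp add: field_simps)
  then show False using polar[OF assms(1)] assms(2) cos_pi_shift_zero by auto
qed

end

section \<open>Exponential weights separating slow from fast decay\<close>

definition "gap = (real dd / 2)\<^sup>2 - lam"
definition "del = min (real dd / 4) (sqrt (gap / 2))"
text \<open>The linearisation at infinity w'' + dd w' + lam w = 0 has decay rates dd / 2 - sqrt gap
  and dd / 2 + sqrt gap. The rate \<open>ex\<close> lies strictly between dd / 2 and the faster one,
  so ex (dd - ex) - lam keeps a positive margin.\<close>

definition "ex = real dd / 2 + del"
definition "aa w r = w r * exp (ex * r)"
text \<open>The multiple exp (- 2 ex r) sinh^dd r of the derivative of \<open>aa\<close>, chosen so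
  that its own derivative contains no first order term.\<close>

definition "jj w z r = exp (- ex * r) * (ex * w r * sinh r ^ dd - z r)"
text \<open>Energy at most \<open>e0\<close> keeps |w| powr qq within half of the margin
  \<open>gap\<close>.\<close>

definition "e0 = lam * ((gap / 2) powr (1 / qq))\<^sup>2 / 2"

lemma gap_pos: "gap > 0" using lam_hi N7 by (simp add: gap_def dd_def of_nat_diff)
lemma del_pos: "del > 0" using gap_pos dd1 by (simp add: del_def)
lemma ex_gt: "ex > real dd / 2" using del_pos by (simp add: ex_def)
lemma e0_pos: "e0 > 0" using gap_pos lam0 by (simp add: e0_def)

lemma ex_bound: "ex * (real dd - ex) \<ge> lam + gap / 2"
proof -
  have "del\<^sup>2 \<le> (sqrt (gap / 2))\<^sup>2" using del_pos by (intro power_mono) (auto simp: del_def)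
  then have "del\<^sup>2 \<le> gap / 2" using gap_pos by simp
  moreover have "ex * (real dd - ex) = (real dd / 2)\<^sup>2 - del\<^sup>2" by (simp add: ex_def field_simps power2_eq_square)
  ultimately show ?thesis by (simp add: gap_def field_simps)
qed

lemma small_energy: assumes "ee w z r \<le> e0" shows "\<bar>w r\<bar> powr qq \<le> gap / 2"
proof -
  have "lam * (w r)\<^sup>2 / 2 \<le> lam * ((gap / 2) powr (1 / qq))\<^sup>2 / 2"
    using GG_ge[of "w r"] assms zero_le_power2[of "vv z r"] unfolding ee_def e0_def by linarith
  then have "\<bar>w r\<bar>\<^sup>2 \<le> ((gap / 2) powr (1 / qq))\<^sup>2" using lam0 by simp
  then have "\<bar>w r\<bar> \<le> (gap / 2) powr (1 / qq)" by (rule power2_le_imp_le) simp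
  then have "\<bar>w r\<bar> powr qq \<le> ((gap / 2) powr (1 / qq)) powr qq" using qq0 by (intro powr_mono2) auto
  then show ?thesis using qq0 gap_pos by (simp add: powr_powr)
qed

context
  fixes w z :: "real \<Rightarrow> real"
  assumes sol: "radial_sol dd hh w z" and w0: "w 0 > 0"
begin

lemma aa_deriv: assumes r: "r > 0" shows "(aa w has_real_derivative exp (2 * ex * r) / sinh r ^ dd * jj w z r) (at r)"
proof -
  have "(aa w has_real_derivative (- vv z r) * exp (ex * r) + exp (ex * r) * ex * w r) (at r)"
    unfolding aa_def[abs_def] by (auto intro!: derivative_eq_intros dw[OF sol w0 r])
  moreover have "exp (2 * ex * r) / sinh r ^ dd * jj w z r = (- vv z r) * exp (ex * r) + exp (ex * r) * ex * w r"
  proof -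
    have "exp (2 * ex * r) * exp (- ex * r) = exp (ex * r)" by (simp add: exp_add[symmetric])
    then have "exp (2 * ex * r) / sinh r ^ dd * jj w z r = exp (ex * r) * ((ex * w r * sinh r ^ dd - z r) / sinh r ^ dd)"
      by (simp add: jj_def)
    also have "(ex * w r * sinh r ^ dd - z r) / sinh r ^ dd = ex * w r - vv z r"
      using r by (simp add: vv_def diff_divide_distrib)
    finally show ?thesis by (simp add: algebra_simps)
  qed
  ultimately show ?thesis by simp
qed

lemma jj_deriv:
  assumes r: "r > 0"
  shows "(jj w z has_real_derivative exp (- 2 * ex * r) * sinh r ^ dd *
      (ex * real dd * (cosh r / sinh r) - ex\<^sup>2 - lam - \<bar>w r\<bar> powr qq) * aa w r) (at r)"
proof -
  have s: "sinh r > 0" using r by simp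
  have sd: "sinh r ^ dd = sinh r * sinh r ^ (dd - 1)" using dd1 by (cases dd) auto
  have zz: "z r = vv z r * sinh r ^ dd" using s by (simp add: vv_def)
  define S where "S = sinh r ^ dd"
  have dS: "((\<lambda>r. sinh r ^ dd) has_real_derivative real dd * (cosh r / sinh r) * S) (at r)"
    using s by (auto intro!: derivative_eq_intros simp: S_def sd)
  have D: "(jj w z has_real_derivative (- ex) * exp (- ex * r) * (ex * w r * S - z r)
      + exp (- ex * r) * (ex * (- vv z r) * S + ex * w r * (real dd * (cosh r / sinh r) * S) - S * hh (w r))) (at r)"
    unfolding jj_def[abs_def]
    by (rule derivative_eq_intros dS dw[OF sol w0 r] dz[OF sol w0 r] refl)+ (simp add: S_def algebra_simps)
  have "exp (- 2 * ex * r) * exp (ex * r) = exp (- ex * r)" by (simp add: exp_add[symmetric])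
  moreover have "exp (- 2 * ex * r) * S * X * (w r * exp (ex * r)) = (exp (- 2 * ex * r) * exp (ex * r)) * (S * X * w r)" for X
    by (simp only: mult_ac)
  ultimately have E: "exp (- 2 * ex * r) * S * (ex * real dd * (cosh r / sinh r) - ex\<^sup>2 - lam - \<bar>w r\<bar> powr qq) * aa w r
      = exp (- ex * r) * (S * (ex * real dd * (cosh r / sinh r) - ex\<^sup>2 - lam - \<bar>w r\<bar> powr qq) * w r)"
    by (simp only: aa_def)
  have zz': "z r = vv z r * S" using zz by (simp add: S_def)
  show ?thesis
    by (rule DERIV_cong[OF D], unfold S_def[symmetric] E zz')
       (simp add: hh_def algebra_simps power2_eq_square)
qed

lemma coth_ge_1: "r > 0 \<Longrightarrow> cosh r / sinh (r::real) \<ge> 1"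
  using sinh_le_cosh_real[of r] by simp

lemma potential_pos:
  assumes "r > 0" "ee w z r \<le> e0"
  shows "ex * real dd * (cosh r / sinh r) - ex\<^sup>2 - lam - \<bar>w r\<bar> powr qq \<ge> 0"
proof -
  have "ex > 0" using ex_gt by (smt (verit) divide_nonneg_nonneg of_nat_0_le_iff)
  then have "ex * real dd * (cosh r / sinh r) \<ge> ex * real dd * 1"
    using coth_ge_1[OF assms(1)] by (intro mult_left_mono) auto
  moreover have "ex * real dd - ex\<^sup>2 \<ge> lam + gap / 2" using ex_bound by (simp add: algebra_simps power2_eq_square)
  ultimately show ?thesis using small_energy[OF assms(2)] by simp
qed

lemma ee_mono: "0 \<le> r \<Longrightarrow> r \<le> s \<Longrightarrow> ee w z s \<le> ee w z r"
  by (rule ee_antimono[OF sol cont_hh]) auto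

text \<open>The derivative of \<open>aa * jj\<close> is P jj^2 + Q aa^2 with P, Q \<ge> 0 at small
  energy, and small energy persists. A product that is positive once stays positive, so w cannot
  vanish afterwards.\<close>

lemma slow_trap:
  assumes r1: "r1 > 0" "ee w z r1 \<le> e0" "aa w r1 * jj w z r1 > 0" and r: "r \<ge> r1"
  shows "w r \<noteq> 0"
proof -
  have "aa w r1 * jj w z r1 \<le> aa w r * jj w z r"
  proof (rule DERIV_nonneg_imp_nondecreasing[where f = "\<lambda>r. aa w r * jj w z r", OF r])
    fix x assume x: "r1 \<le> x" "x \<le> r"
    then have x0: "x > 0" "ee w z x \<le> e0" using r1 ee_mono[of r1 x] by auto
    define P Q where "P = exp (2 * ex * x) / sinh x ^ dd"
      and "Q = exp (- 2 * ex * x) * sinh x ^ dd * (ex * real dd * (cosh x / sinh x) - ex\<^sup>2 - lam - \<bar>w x\<bar> powr qq)"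
    have "P \<ge> 0" "Q \<ge> 0" using x0 potential_pos[OF x0] by (auto simp: P_def Q_def)
    moreover have "((\<lambda>r. aa w r * jj w z r) has_real_derivative P * jj w z x * jj w z x + Q * aa w x * aa w x) (at x)"
      unfolding P_def Q_def by (rule DERIV_mult[OF aa_deriv[OF x0(1)] jj_deriv[OF x0(1)]])
    ultimately show "\<exists>y. ((\<lambda>r. aa w r * jj w z r) has_real_derivative y) (at x) \<and> 0 \<le> y"
      by (intro exI[of _ "P * jj w z x * jj w z x + Q * aa w x * aa w x"]) (auto simp: mult.assoc)
  qed
  then show ?thesis using r1 by (auto simp: aa_def)
qed

end

end

section \<open>Decay of the energy and the alternative between fast and slow solutions\<close>

context hyp_bn begin

context
  fixes w z :: "real \<Rightarrow> real"
  assumes sol: "radial_sol dd hh w z" and w0: "w 0 > 0"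
begin

lemma coth_le_2: assumes "r \<ge> 1" shows "cosh r / sinh (r::real) \<le> 2"
proof -
  have "3 \<le> exp (2 * r)" using exp_ge_add_one_self[of "2 * r"] assms by linarith
  then have "3 * exp (- r) \<le> exp (2 * r) * exp (- r)" by (intro mult_right_mono) auto
  also have "\<dots> = exp r" by (simp add: exp_add[symmetric])
  finally have "cosh r \<le> 2 * sinh r" by (simp add: cosh_field_def sinh_field_def)
  then show ?thesis using assms by (simp add: field_simps)
qed

text \<open>Lyapunov function: a small multiple of w w' added to the energy makes it decay exponentially.\<close>

definition "ep = min (min (1 / 2) (lam / 2)) (real dd / 2 / (1 + 2 * (real dd)\<^sup>2 / lam))"
definition "Ly r = ee w z r - ep * (w r * vv z r)"

lemma ep_pos: "ep > 0" and ep_le: "ep \<le> 1 / 2" "ep \<le> lam / 2" "ep * (1 + 2 * (real dd)\<^sup>2 / lam) \<le> real dd / 2"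
proof -
  have p: "1 + 2 * (real dd)\<^sup>2 / lam > 0" using lam0 by (simp add: add_pos_nonneg)
  show "ep > 0" using lam0 dd1 p by (simp add: ep_def)
  show "ep \<le> 1 / 2" "ep \<le> lam / 2" unfolding ep_def by linarith+
  have "ep \<le> real dd / 2 / (1 + 2 * (real dd)\<^sup>2 / lam)" by (simp add: ep_def)
  then show "ep * (1 + 2 * (real dd)\<^sup>2 / lam) \<le> real dd / 2" unfolding pos_le_divide_eq[OF p] .
qed

lemma cross_bound: "\<bar>ep * (w r * vv z r)\<bar> \<le> (vv z r)\<^sup>2 / 4 + lam * (w r)\<^sup>2 / 4"
proof -
  have "2 * \<bar>w r * vv z r\<bar> \<le> (w r)\<^sup>2 + (vv z r)\<^sup>2"
    using sum_squares_bound[of "\<bar>w r\<bar>" "\<bar>vv z r\<bar>"] by (simp add: abs_mult)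
  then have "\<bar>w r * vv z r\<bar> \<le> ((w r)\<^sup>2 + (vv z r)\<^sup>2) / 2" by simp
  then have "ep * \<bar>w r * vv z r\<bar> \<le> ep * (((w r)\<^sup>2 + (vv z r)\<^sup>2) / 2)" using ep_pos by (intro mult_left_mono) auto
  also have "\<dots> = ep * (w r)\<^sup>2 / 2 + ep * (vv z r)\<^sup>2 / 2" by (simp add: algebra_simps add_divide_distrib)
  also have "\<dots> \<le> (lam / 2) * (w r)\<^sup>2 / 2 + (1 / 2) * (vv z r)\<^sup>2 / 2"
    using ep_le by (intro add_mono divide_right_mono mult_right_mono) auto
  finally show ?thesis using ep_pos by (simp add: abs_mult)
qed

lemma Ly_ge: "Ly r \<ge> ee w z r / 2"
proof -
  have "(vv z r)\<^sup>2 / 4 + lam * (w r)\<^sup>2 / 4 \<le> ee w z r / 2" using GG_ge[of "w r"] by (simp add: ee_def)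
  then show ?thesis using cross_bound[of r] by (simp add: Ly_def abs_le_iff)
qed

lemma Ly_deriv_le:
  assumes r: "r \<ge> 1"
  shows "\<exists>D. (Ly has_real_derivative D) (at r) \<and> D \<le> - (ep / 2) * Ly r"
proof -
  have r0: "r > 0" using r by simp
  define c v u p where "c = cosh r / sinh r" and "v = vv z r" and "u = w r" and "p = \<bar>w r\<bar> powr (qq + 2)"
  have c: "1 \<le> c" "c \<le> 2" using coth_ge_1[OF sol w0 r0] coth_le_2[OF r] by (auto simp: c_def)
  have p: "p \<ge> 0" by (simp add: p_def)
  have uh: "u * hh u = lam * u\<^sup>2 + p"
    by (cases "u = 0") (auto simp: hh_def p_def u_def[symmetric] powr_add algebra_simps power2_eq_square)
  define D where "D = - real dd * c * v\<^sup>2 - ep * (- v * v + (hh u - real dd * c * v) * u)"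
  have "(Ly has_real_derivative D) (at r)"
    unfolding Ly_def[abs_def] D_def c_def v_def u_def
    by (intro DERIV_diff ee_deriv[OF sol r0] DERIV_cmult DERIV_mult dw[OF sol w0 r0] vv_deriv[OF sol r0]) auto
  moreover have "D \<le> - (ep / 2) * Ly r"
  proof -
    have "D = - real dd * c * v\<^sup>2 + ep * v\<^sup>2 - ep * (u * hh u) + ep * (real dd * c) * (u * v)"
      by (simp add: D_def algebra_simps power2_eq_square)
    moreover have "ep * (real dd * c) * (u * v) \<le> ep * (lam * u\<^sup>2 / 2 + (2 * (real dd)\<^sup>2 / lam) * v\<^sup>2)"
    proof -
      have "(real dd * c) * (u * v) \<le> (real dd * c) * \<bar>u * v\<bar>"
        using c by (intro mult_left_mono) auto
      also have "\<dots> \<le> (real dd * 2) * \<bar>u * v\<bar>" using c by (intro mult_mono) auto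
      \<comment> \<open>Young's inequality with weights such that the u part uses only half of the
        available ep lam u^2; the v part goes into the friction by the last bound on
        \<open>ep\<close>.\<close>
      also have "\<dots> = 2 * (sqrt (lam / 2) * \<bar>u\<bar>) * (sqrt 2 * real dd / sqrt lam * \<bar>v\<bar>)"
        using lam0 by (simp add: real_sqrt_divide abs_mult)
      also have "\<dots> \<le> (sqrt (lam / 2) * \<bar>u\<bar>)\<^sup>2 + (sqrt 2 * real dd / sqrt lam * \<bar>v\<bar>)\<^sup>2"
        using sum_squares_bound by blast
      also have "\<dots> = lam * u\<^sup>2 / 2 + (2 * (real dd)\<^sup>2 / lam) * v\<^sup>2"
        using lam0 by (simp add: power_mult_distrib power_divide)
      finally show ?thesis using ep_pos unfolding mult.assoc[of ep] by (intro mult_left_mono) (auto simp: mult.assoc)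
    qed
    moreover have "real dd * v\<^sup>2 \<le> real dd * c * v\<^sup>2" using c dd1 by (intro mult_right_mono) auto
    moreover have "ep * v\<^sup>2 + ep * ((2 * (real dd)\<^sup>2 / lam) * v\<^sup>2) \<le> real dd / 2 * v\<^sup>2"
      using mult_right_mono[OF ep_le(3), of "v\<^sup>2"] by (simp add: distrib_left distrib_right mult.assoc)
    moreover have "ep * (lam * u\<^sup>2 / 2 + (2 * (real dd)\<^sup>2 / lam) * v\<^sup>2)
        = ep * lam * u\<^sup>2 / 2 + ep * ((2 * (real dd)\<^sup>2 / lam) * v\<^sup>2)" by (simp add: distrib_left)
    moreover have "ep * (u * hh u) = ep * lam * u\<^sup>2 + ep * p" unfolding uh by (simp add: distrib_left)
    ultimately have 1: "D \<le> - (real dd / 2) * v\<^sup>2 - ep * lam * u\<^sup>2 / 2 - ep * p"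
      by linarith
    have "Ly r \<le> v\<^sup>2 / 2 + (lam * u\<^sup>2 / 2 + p / (qq + 2)) + (v\<^sup>2 / 4 + lam * u\<^sup>2 / 4)"
      using cross_bound[of r] by (simp add: Ly_def ee_def GG_def v_def u_def p_def abs_le_iff)
    moreover have "p / (qq + 2) \<le> p" using p qq0 by (simp add: divide_le_eq mult_le_cancel_left1)
    ultimately have "Ly r \<le> 3 / 4 * v\<^sup>2 + 3 / 4 * (lam * u\<^sup>2) + p" by simp
    then have "(ep / 2) * Ly r \<le> (ep / 2) * (3 / 4 * v\<^sup>2 + 3 / 4 * (lam * u\<^sup>2) + p)"
      using ep_pos by (intro mult_left_mono) auto
    also have "\<dots> = 3 / 8 * ep * v\<^sup>2 + 3 / 8 * ep * lam * u\<^sup>2 + ep * p / 2" by (simp add: algebra_simps)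
    also have "\<dots> \<le> real dd / 2 * v\<^sup>2 + 1 / 2 * ep * lam * u\<^sup>2 + ep * p"
    proof (intro add_mono mult_right_mono)
      show "3 / 8 * ep \<le> real dd / 2" using ep_le(1) dd1 by linarith
    qed (use ep_pos lam0 p in auto)
    finally show ?thesis using 1 by simp
  qed
  ultimately show ?thesis by blast
qed

lemma ee_to_0: "(ee w z \<longlongrightarrow> 0) at_top"
proof -
  define C where "C = 2 * (Ly 1 * exp (ep / 2 * 1))"
  have bd: "ee w z r \<le> C * exp (- (ep / 2 * r))" if r: "r \<ge> 1" for r
  proof -
    have "Ly r * exp (ep / 2 * r) \<le> Ly 1 * exp (ep / 2 * 1)"
    proof (rule DERIV_nonpos_imp_nonincreasing[where f = "\<lambda>r. Ly r * exp (ep / 2 * r)", OF r])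
      fix x assume x: "1 \<le> x" "x \<le> r"
      obtain D where D: "(Ly has_real_derivative D) (at x)" "D \<le> - (ep / 2) * Ly x" using Ly_deriv_le[OF x(1)] by blast
      have "((\<lambda>r. Ly r * exp (ep / 2 * r)) has_real_derivative (D + ep / 2 * Ly x) * exp (ep / 2 * x)) (at x)"
        by (rule derivative_eq_intros D refl)+ (simp add: algebra_simps)
      moreover have "(D + ep / 2 * Ly x) * exp (ep / 2 * x) \<le> 0" using D by (intro mult_nonpos_nonneg) auto
      ultimately show "\<exists>y. ((\<lambda>r. Ly r * exp (ep / 2 * r)) has_real_derivative y) (at x) \<and> y \<le> 0" by blast
    qed
    then have "Ly r * exp (ep / 2 * r) * exp (- (ep / 2 * r)) \<le> Ly 1 * exp (ep / 2 * 1) * exp (- (ep / 2 * r))"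
      by (intro mult_right_mono) auto
    then have "Ly r \<le> Ly 1 * exp (ep / 2 * 1) * exp (- (ep / 2 * r))" by (simp add: mult.assoc exp_add[symmetric])
    then show ?thesis using Ly_ge[of r] by (simp add: C_def)
  qed
  show ?thesis
  proof (rule tendsto_sandwich[of "\<lambda>_. 0" _ _ "\<lambda>r. C * exp (- (ep / 2 * r))"])
    show "\<forall>\<^sub>F r in at_top. 0 \<le> ee w z r"
    proof (rule always_eventually, rule allI)
      fix r show "0 \<le> ee w z r" using GG_ge[of "w r"] lam0 unfolding ee_def by (smt (verit) divide_nonneg_nonneg mult_nonneg_nonneg zero_le_power2)
    qed
    show "\<forall>\<^sub>F r in at_top. ee w z r \<le> C * exp (- (ep / 2 * r))"
      using eventually_ge_at_top[of 1] by eventually_elim (rule bd)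
    have "filterlim (\<lambda>r. ep / 2 * r) at_top at_top"
      using ep_pos by (intro filterlim_tendsto_pos_mult_at_top[OF tendsto_const]) (auto simp: filterlim_ident)
    then have "((\<lambda>r. exp (- (ep / 2 * r))) \<longlongrightarrow> 0) at_top"
      by (intro filterlim_compose[OF exp_at_bot] filterlim_compose[OF filterlim_uminus_at_bot_at_top])
    then have "((\<lambda>r. C * exp (- (ep / 2 * r))) \<longlongrightarrow> C * 0) at_top" by (intro tendsto_intros)
    then show "((\<lambda>r. C * exp (- (ep / 2 * r))) \<longlongrightarrow> 0) at_top" by simp
  qed simp
qed

lemma small_tail: "\<exists>r1\<ge>1. ee w z r1 < e0"
proof -
  have "\<forall>\<^sub>F r in at_top. ee w z r < e0" by (rule order_tendstoD(2)[OF ee_to_0 e0_pos])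
  then have "\<forall>\<^sub>F r in at_top. ee w z r < e0 \<and> r \<ge> 1" using eventually_ge_at_top by (rule eventually_conj)
  then show ?thesis by (auto dest: eventually_happens)
qed

text \<open>The hypothesis says that \<open>aa\<close> squared does not increase, which is the decay
  of w. For w', the mean value theorem gives a point of [r, r + 1] where w' is small; as z w \<ge>
  0, |z| is nondecreasing, so the bound moves back to r at the cost of the growth q of sinh^dd over
  a unit step.\<close>

lemma fast_decay:
  assumes r1: "r1 \<ge> 1" and fast: "\<And>r. r \<ge> r1 \<Longrightarrow> aa w r * jj w z r \<le> 0"
  shows "\<exists>C. \<forall>r\<ge>0. \<bar>w r\<bar> \<le> C * exp (- ex * r) \<and> \<bar>vv z r\<bar> \<le> C * exp (- ex * r)"
proof -
  define C1 where "C1 = \<bar>aa w r1\<bar>"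
  have exp0: "ex > 0" using ex_gt by (smt (verit) divide_nonneg_nonneg of_nat_0_le_iff)
  have wb: "\<bar>w r\<bar> \<le> C1 * exp (- ex * r)" if r: "r \<ge> r1" for r
  proof -
    have "(aa w r)\<^sup>2 \<le> (aa w r1)\<^sup>2"
    proof (rule DERIV_nonpos_imp_nonincreasing[where f = "\<lambda>r. (aa w r)\<^sup>2", OF r])
      fix x assume x: "r1 \<le> x" "x \<le> r"
      have x0: "x > 0" using x r1 by simp
      have "((\<lambda>r. (aa w r)\<^sup>2) has_real_derivative 2 * aa w x * (exp (2 * ex * x) / sinh x ^ dd * jj w z x)) (at x)"
        by (rule DERIV_cong[OF DERIV_power[OF aa_deriv[OF sol w0 x0], of 2]]) simp
      moreover have "2 * aa w x * (exp (2 * ex * x) / sinh x ^ dd * jj w z x)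
          = (2 * (exp (2 * ex * x) / sinh x ^ dd)) * (aa w x * jj w z x)" by simp
      moreover have "\<dots> \<le> 0" by (rule mult_nonneg_nonpos) (use fast[OF x(1)] x0 in auto)
      ultimately show "\<exists>y. ((\<lambda>r. (aa w r)\<^sup>2) has_real_derivative y) (at x) \<and> y \<le> 0" by metis
    qed
    then have "\<bar>aa w r\<bar> \<le> C1" by (simp add: C1_def abs_le_square_iff)
    then have "\<bar>w r\<bar> * exp (ex * r) * exp (- ex * r) \<le> C1 * exp (- ex * r)"
      by (intro mult_right_mono) (auto simp: aa_def abs_mult)
    then show ?thesis by (simp add: mult.assoc exp_add[symmetric])
  qed
  have zw: "z x * hh (w x) \<ge> 0" if x: "x \<ge> r1" for x
  proof -
    have "aa w x * jj w z x = w x * (ex * w x * sinh x ^ dd - z x)"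
      by (simp add: aa_def jj_def exp_minus)
    then have "z x * w x \<ge> ex * (w x)\<^sup>2 * sinh x ^ dd" using fast[OF x] by (simp add: algebra_simps power2_eq_square)
    moreover have "ex * (w x)\<^sup>2 * sinh x ^ dd \<ge> 0" using exp0 x r1 by simp
    ultimately have "z x * w x \<ge> 0" by linarith
    then have "(lam + \<bar>w x\<bar> powr qq) * (z x * w x) \<ge> 0"
      by (rule mult_nonneg_nonneg[rotated]) (use lam0 in \<open>auto intro: add_nonneg_nonneg\<close>)
    then show ?thesis by (simp add: hh_def algebra_simps)
  qed
  have zm: "\<bar>z s\<bar> \<le> \<bar>z r\<bar>" if s: "r1 \<le> s" "s \<le> r" for s r
  proof -
    have "(z s)\<^sup>2 \<le> (z r)\<^sup>2"
    proof (rule DERIV_nonneg_imp_nondecreasing[where f = "\<lambda>r. (z r)\<^sup>2", OF s(2)])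
      fix x assume x: "s \<le> x" "x \<le> r"
      have x0: "x > 0" using x r1 s by simp
      have "((\<lambda>r. (z r)\<^sup>2) has_real_derivative 2 * z x * (sinh x ^ dd * hh (w x))) (at x)"
        by (rule DERIV_cong[OF DERIV_power[OF dz[OF sol w0 x0], of 2]]) simp
      moreover have "2 * z x * (sinh x ^ dd * hh (w x)) = (2 * sinh x ^ dd) * (z x * hh (w x))" by simp
      moreover have "\<dots> \<ge> 0" by (rule mult_nonneg_nonneg) (use zw[of x] x x0 s in auto)
      ultimately show "\<exists>y. ((\<lambda>r. (z r)\<^sup>2) has_real_derivative y) (at x) \<and> 0 \<le> y" by metis
    qed
    then show ?thesis by (simp add: abs_le_square_iff)
  qed
  define q where "q = (cosh 1 + 2 * sinh (1::real)) ^ dd"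
  have vb: "\<bar>vv z r\<bar> \<le> q * (2 * C1) * exp (- ex * r)" if r: "r \<ge> r1" for r
  proof -
    have r0: "r > 0" using r r1 by simp
    obtain x where x: "r < x" "x < r + 1" "w (r + 1) - w r = (r + 1 - r) * (- vv z x)"
      using MVT2[of r "r + 1" w "\<lambda>x. - vv z x"] dw[OF sol w0] r0 by auto
    have S: "sinh (r + 1) \<le> sinh r * (cosh 1 + 2 * sinh 1)"
    proof -
      have "cosh r \<le> 2 * sinh r" using coth_le_2[of r] r r1 by (simp add: divide_le_eq)
      then have "cosh r * sinh 1 \<le> 2 * sinh r * sinh 1" by (intro mult_right_mono) auto
      then show ?thesis by (simp add: sinh_add algebra_simps)
    qed
    have "\<bar>vv z r\<bar> * sinh r ^ dd = \<bar>z r\<bar>" using r0 by (simp add: vv_def abs_mult)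
    also have "\<dots> \<le> \<bar>z x\<bar>" using zm[of r x] x r by simp
    also have "\<dots> = \<bar>vv z x\<bar> * sinh x ^ dd" using x r0 by (simp add: vv_def abs_mult)
    also have "\<dots> \<le> (2 * C1 * exp (- ex * r)) * (sinh r ^ dd * q)"
    proof (intro mult_mono)
      have "\<bar>vv z x\<bar> \<le> \<bar>w (r + 1)\<bar> + \<bar>w r\<bar>" using x by simp
      also have "\<dots> \<le> C1 * exp (- ex * (r + 1)) + C1 * exp (- ex * r)" using wb[of r] wb[of "r + 1"] r by (intro add_mono) auto
      also have "\<dots> \<le> C1 * exp (- ex * r) + C1 * exp (- ex * r)"
        using exp0 by (intro add_mono mult_left_mono) (auto simp: C1_def algebra_simps)
      finally show "\<bar>vv z x\<bar> \<le> 2 * C1 * exp (- ex * r)" by simp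
      have "sinh x ^ dd \<le> sinh (r + 1) ^ dd" using x r0 by (intro power_mono) auto
      also have "\<dots> \<le> (sinh r * (cosh 1 + 2 * sinh 1)) ^ dd" using S r0 by (intro power_mono) auto
      finally show "sinh x ^ dd \<le> sinh r ^ dd * q" by (simp add: q_def power_mult_distrib)
    qed (use x r0 in \<open>auto simp: C1_def\<close>)
    finally have "\<bar>vv z r\<bar> * sinh r ^ dd \<le> (q * (2 * C1) * exp (- ex * r)) * sinh r ^ dd" by (simp add: mult_ac)
    then show ?thesis using r0 by (simp add: mult_le_cancel_right)
  qed
  have "compact ((\<lambda>r. \<bar>w r\<bar> + \<bar>vv z r\<bar>) ` {0..r1})"
    by (intro compact_continuous_image continuous_intros continuous_on_subset[OF cw[OF sol w0]]
        continuous_on_subset[OF cont_vv[OF sol cont_hh]]) auto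
  then have "bounded ((\<lambda>r. \<bar>w r\<bar> + \<bar>vv z r\<bar>) ` {0..r1})" by (rule compact_imp_bounded)
  then obtain M where M: "\<And>r. r \<in> {0..r1} \<Longrightarrow> \<bar>w r\<bar> + \<bar>vv z r\<bar> \<le> M"
    unfolding bounded_iff by fastforce
  have M0: "M \<ge> 0" using M[of 0] r1 by (smt (verit) atLeastAtMost_iff abs_ge_zero)
  define C where "C = C1 + q * (2 * C1) + M * exp (ex * r1)"
  have pos: "C1 \<ge> 0" "q * (2 * C1) \<ge> 0" "M * exp (ex * r1) \<ge> 0" using M0 by (auto simp: C1_def q_def add_nonneg_nonneg)
  have "\<bar>w r\<bar> \<le> C * exp (- ex * r) \<and> \<bar>vv z r\<bar> \<le> C * exp (- ex * r)" if r: "r \<ge> 0" for r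
  proof (cases "r \<ge> r1")
    case True
    have "C1 * exp (- ex * r) \<le> C * exp (- ex * r)" "q * (2 * C1) * exp (- ex * r) \<le> C * exp (- ex * r)"
      using pos by (auto intro!: mult_right_mono simp: C_def)
    then show ?thesis using wb[OF True] vb[OF True] by linarith
  next
    case False
    have "M = M * exp (ex * r) * exp (- ex * r)" by (simp add: mult.assoc exp_add[symmetric])
    also have "\<dots> \<le> C * exp (- ex * r)"
    proof (intro mult_right_mono)
      have "M * exp (ex * r) \<le> M * exp (ex * r1)" using M0 False exp0 by (intro mult_left_mono) auto
      then show "M * exp (ex * r) \<le> C" using pos unfolding C_def by linarith
    qed simp
    finally show ?thesis using M[of r] r False by auto
  qed
  then show ?thesis by blast
qed

end

text \<open>The volume of spheres grows like exp ((N - 1) r), and \<open>ex\<close> > (N - 1) / 2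
  makes w and w' square integrable.\<close>

definition "fast_sol w z \<longleftrightarrow> radial_sol dd hh w z \<and> w 0 > 0 \<and>
  (\<exists>C. \<forall>r\<ge>0. \<bar>w r\<bar> \<le> C * exp (- ex * r) \<and> \<bar>vv z r\<bar> \<le> C * exp (- ex * r))"

text \<open>The hypotheses of \<open>slow_trap\<close> at a single radius, with strict inequalities,
  hence stable under small changes of the initial value.\<close>

definition "slow_at w z r1 \<longleftrightarrow> r1 \<ge> 1 \<and> ee w z r1 < e0 \<and> aa w r1 * jj w z r1 > 0"

lemma fast_or_slow:
  assumes sol: "radial_sol dd hh w z" and w0: "w 0 > 0" and nf: "\<not> fast_sol w z"
  shows "\<exists>r1. slow_at w z r1"
proof (rule ccontr)
  assume n: "\<not> ?thesis"
  obtain r1 where r1: "r1 \<ge> 1" "ee w z r1 < e0" using small_tail[OF sol w0] by blast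
  have "aa w r * jj w z r \<le> 0" if "r \<ge> r1" for r
  proof -
    have "ee w z r < e0" "r \<ge> 1" using ee_mono[OF sol w0, of r1 r] r1 that by auto
    then show ?thesis using n by (auto simp: slow_at_def not_less)
  qed
  then show False using fast_decay[OF sol w0 r1(1)] nf sol w0 by (auto simp: fast_sol_def)
qed

text \<open>If no initial value in [M, B] gave a fast solution, the limiting Pruefer count would be
  locally constant there, hence constant.\<close>

lemma fast_unbounded:
  assumes M: "M > 0"
  shows "\<exists>w z. fast_sol w z \<and> w 0 \<ge> M"
proof (rule ccontr)
  assume nofast: "\<not> ?thesis"
  \<comment> \<open>The family used below depends on B, which depends on k, which depends on the
    count at initial value M. So a solution at M is taken from a preliminary family and identified
    with the later one by \<open>uniq\<close>.\<close>
  obtain W1 Z1 where W1: "radial_sol dd hh W1 Z1" "W1 0 = M"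
    using solution_family[of "M + 1"] M by (metis add_pos_pos less_add_one zero_less_one)
  obtain r1 where r1: "slow_at W1 Z1 r1" using fast_or_slow[OF W1(1)] nofast W1 M by auto
  obtain k :: nat where k: "theta W1 Z1 r1 / pi + 1 / 2 < real k" using reals_Archimedean2 by blast
  obtain A where A: "A > 0" "\<And>w z. radial_sol dd hh w z \<Longrightarrow> w 0 \<ge> A \<Longrightarrow> \<exists>r. alternates w k r"
    using many_sign_changes[of k] by blast
  define B where "B = max A M"
  obtain W Z K ka where fam: "\<And>\<alpha>. 0 < \<alpha> \<Longrightarrow> \<alpha> < B + 1 \<Longrightarrow> radial_sol dd hh (W \<alpha>) (Z \<alpha>)" "\<And>\<alpha>. W \<alpha> 0 = \<alpha>"
    and lipW: "\<And>\<alpha> \<beta> r. r \<ge> 0 \<Longrightarrow> \<bar>W \<alpha> r - W \<beta> r\<bar> \<le> K * exp (ka * r) * \<bar>\<alpha> - \<beta>\<bar>"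
    and lipZ: "\<And>\<alpha> \<beta> r. r \<ge> 0 \<Longrightarrow> \<bar>Z \<alpha> r - Z \<beta> r\<bar> \<le> sinh r ^ dd * (K * exp (ka * r)) * \<bar>\<alpha> - \<beta>\<bar>"
    and Kk: "K > 0" "ka > 0"
    and uniq: "\<And>w z r. radial_sol dd hh w z \<Longrightarrow> 0 < w 0 \<Longrightarrow> w 0 < B + 1 \<Longrightarrow> r \<ge> 0 \<Longrightarrow> w r = W (w 0) r \<and> z r = Z (w 0) r"
  proof (rule solution_family[of "B + 1"])
    show "B + 1 > 0" using A(1) by (simp add: B_def)
  qed (rule that, assumption+)
  define I where "I = {M..B}"
  have Isol: "radial_sol dd hh (W \<alpha>) (Z \<alpha>)" "W \<alpha> 0 > 0" if "\<alpha> \<in> I" for \<alpha>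
    using fam that M by (auto simp: I_def)
  have lipV: "\<bar>vv (Z \<alpha>) r - vv (Z \<beta>) r\<bar> \<le> K * exp (ka * r) * \<bar>\<alpha> - \<beta>\<bar>" if r: "r \<ge> 0" for \<alpha> \<beta> r
  proof (cases "r = 0")
    case False
    then have s: "sinh r ^ dd > 0" using r by simp
    have "\<bar>vv (Z \<alpha>) r - vv (Z \<beta>) r\<bar> = \<bar>Z \<alpha> r - Z \<beta> r\<bar> / sinh r ^ dd"
      using s by (simp add: vv_def diff_divide_distrib[symmetric] abs_mult)
    also have "\<dots> \<le> (sinh r ^ dd * (K * exp (ka * r)) * \<bar>\<alpha> - \<beta>\<bar>) / sinh r ^ dd"
      using lipZ[OF r] s by (intro divide_right_mono) auto
    also have "\<dots> = K * exp (ka * r) * \<bar>\<alpha> - \<beta>\<bar>" using s False by simp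
    finally show ?thesis .
  qed (use dd1 Kk in \<open>simp add: vv_def power_0_left\<close>)
  have jW: "continuous_on (I \<times> {0..R}) (\<lambda>p. W (fst p) (snd p))" (is ?A)
    and jZ: "continuous_on (I \<times> {0..R}) (\<lambda>p. Z (fst p) (snd p))" (is ?B)
    and jV: "continuous_on (I \<times> {0..R}) (\<lambda>p. vv (Z (fst p)) (snd p))" (is ?C) for R
  proof -
    have m: "K * exp (ka * x) * \<bar>\<alpha> - \<beta>\<bar> \<le> K * exp (ka * R) * \<bar>\<alpha> - \<beta>\<bar>" if "x \<in> {0..R}" for x \<alpha> \<beta>
      using Kk that by (intro mult_right_mono mult_left_mono) auto
    have mz: "sinh x ^ dd * (K * exp (ka * x)) * \<bar>\<alpha> - \<beta>\<bar> \<le> sinh R ^ dd * (K * exp (ka * R)) * \<bar>\<alpha> - \<beta>\<bar>" if "x \<in> {0..R}" for x \<alpha> \<beta>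
      using Kk that by (intro mult_right_mono mult_mono power_mono) auto
    have cI: "continuous_on {0..R} (W \<alpha>)" "continuous_on {0..R} (Z \<alpha>)" "continuous_on {0..R} (vv (Z \<alpha>))" if "\<alpha> \<in> I" for \<alpha>
      using cw[OF Isol[OF that]] cz[OF Isol[OF that]] cont_vv[OF Isol(1)[OF that] cont_hh]
      by (auto elim: continuous_on_subset)
    show ?A
      by (rule continuous_on_prod_lipschitz[where C = "K * exp (ka * R)", OF cI(1)])
         (auto intro: order_trans[OF lipW m])
    show ?B
      by (rule continuous_on_prod_lipschitz[where C = "sinh R ^ dd * (K * exp (ka * R))", OF cI(2)])
         (auto intro: order_trans[OF lipZ mz])
    show ?C
      by (rule continuous_on_prod_lipschitz[where C = "K * exp (ka * R)" and f = "\<lambda>\<alpha>. vv (Z \<alpha>)", OF cI(3)])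
         (auto intro: order_trans[OF lipV m])
  qed
  have cth: "continuous_on I (\<lambda>\<alpha>. theta (W \<alpha>) (Z \<alpha>) R)" for R
  proof -
    have hW: "continuous_on (I \<times> {0..R}) (\<lambda>p. hh (W (fst p) (snd p)))"
      by (rule continuous_on_compose2[OF cont_hh[of UNIV] jW]) auto
    have "continuous_on (I \<times> {0..R}) (\<lambda>p. prf (W (fst p)) (Z (fst p)) (snd p))"
      unfolding prf_def
      by (intro continuous_intros jW jZ jV hW) (use sol_nonzero[OF Isol] in force)
    then have "continuous_on (I \<times> cbox 0 R) (\<lambda>(\<alpha>, x). prf (W \<alpha>) (Z \<alpha>) x)"
      by (simp add: case_prod_unfold)
    from integral_continuous_on_param[OF this] show ?thesis by (simp add: theta_def[abs_def])
  qed
  have fixW: "continuous_on I (\<lambda>\<alpha>. W \<alpha> r)" and fixZ: "continuous_on I (\<lambda>\<alpha>. Z \<alpha> r)" and fixV: "continuous_on I (\<lambda>\<alpha>. vv (Z \<alpha>) r)"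
    if "r \<ge> 0" for r
  proof -
    have p: "continuous_on I (\<lambda>\<alpha>. (\<alpha>, r))" "(\<lambda>\<alpha>. (\<alpha>, r)) ` I \<subseteq> I \<times> {0..r}"
      using that by (auto intro!: continuous_intros)
    show "continuous_on I (\<lambda>\<alpha>. W \<alpha> r)" "continuous_on I (\<lambda>\<alpha>. Z \<alpha> r)" "continuous_on I (\<lambda>\<alpha>. vv (Z \<alpha>) r)"
      using continuous_on_compose2[OF jW p] continuous_on_compose2[OF jZ p] continuous_on_compose2[OF jV p] by simp_all
  qed
  \<comment> \<open>The eventual count. It does not depend on the radius that certifies slowness, so
    different \<alpha> may use different radii.\<close>
  define F where "F \<alpha> = (THE n::int. \<exists>R\<ge>0. \<forall>r\<ge>R. cnt (W \<alpha>) (Z \<alpha>) r = n)" for \<alpha>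
  have Feq: "F \<alpha> = cnt (W \<alpha>) (Z \<alpha>) r1" if a: "\<alpha> \<in> I" and s: "slow_at (W \<alpha>) (Z \<alpha>) r1" for \<alpha> r1
  proof -
    have r1: "r1 > 0" using s by (simp add: slow_at_def)
    have nz: "W \<alpha> x \<noteq> 0" if "x \<ge> r1" for x
      by (rule slow_trap[OF Isol[OF a] r1 _ _ that]) (use s in \<open>auto simp: slow_at_def\<close>)
    have c: "cnt (W \<alpha>) (Z \<alpha>) r = cnt (W \<alpha>) (Z \<alpha>) r1" if "r \<ge> r1" for r
      by (rule cnt_const[OF Isol[OF a]]) (use r1 that nz in auto)
    show ?thesis unfolding F_def
    proof (rule the_equality)
      show "\<exists>R\<ge>0. \<forall>r\<ge>R. cnt (W \<alpha>) (Z \<alpha>) r = cnt (W \<alpha>) (Z \<alpha>) r1" 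
        by (intro exI[of _ r1] conjI allI impI c) (use r1 in auto)
      fix n assume "\<exists>R\<ge>0. \<forall>r\<ge>R. cnt (W \<alpha>) (Z \<alpha>) r = n"
      then obtain R where "\<forall>r\<ge>R. cnt (W \<alpha>) (Z \<alpha>) r = n" by blast
      then have "cnt (W \<alpha>) (Z \<alpha>) (max R r1) = n" by simp
      moreover have "cnt (W \<alpha>) (Z \<alpha>) (max R r1) = cnt (W \<alpha>) (Z \<alpha>) r1" by (rule c) simp
      ultimately show "n = cnt (W \<alpha>) (Z \<alpha>) r1" by simp
    qed
  qed
  have slowI: "\<exists>r1. slow_at (W \<alpha>) (Z \<alpha>) r1" if "\<alpha> \<in> I" for \<alpha>
  proof -
    have "W \<alpha> 0 \<ge> M" using fam(2)[of \<alpha>] that by (simp add: I_def)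
    then have "\<not> fast_sol (W \<alpha>) (Z \<alpha>)" using nofast by blast
    then show ?thesis by (rule fast_or_slow[OF Isol[OF that]])
  qed
  \<comment> \<open>The radius r1 found for \<alpha> also serves its neighbours: slowness at r1 is
    open, and the shifted angle there is not an integer, so its floor does not move.\<close>
  have loc: "\<forall>\<^sub>F \<beta> in at \<alpha> within I. F \<alpha> = F \<beta>" if a: "\<alpha> \<in> I" for \<alpha>
  proof -
    obtain r1 where s: "slow_at (W \<alpha>) (Z \<alpha>) r1" using slowI[OF a] by blast
    have r1: "r1 \<ge> 1" "r1 > 0" "r1 \<ge> 0" using s by (auto simp: slow_at_def)
    have cee: "continuous_on I (\<lambda>\<alpha>. ee (W \<alpha>) (Z \<alpha>) r1)" unfolding ee_def
      by (intro continuous_intros fixV[OF r1(3)] continuous_on_compose2[OF cont_GG[of UNIV] fixW[OF r1(3)]]) auto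
    have caj: "continuous_on I (\<lambda>\<alpha>. aa (W \<alpha>) r1 * jj (W \<alpha>) (Z \<alpha>) r1)"
      by (rule continuous_on_eq[where f = "\<lambda>\<alpha>. W \<alpha> r1 * exp (ex * r1) * (exp (- ex * r1) * (ex * W \<alpha> r1 * sinh r1 ^ dd - Z \<alpha> r1))"])
         (auto intro!: continuous_intros fixW[OF r1(3)] fixZ[OF r1(3)] simp: aa_def jj_def)
    have 1: "\<forall>\<^sub>F \<beta> in at \<alpha> within I. ee (W \<beta>) (Z \<beta>) r1 < e0"
      using cee a s by (intro order_tendstoD(2)[of _ "ee (W \<alpha>) (Z \<alpha>) r1"]) (auto simp: continuous_on_def slow_at_def)
    have 2: "\<forall>\<^sub>F \<beta> in at \<alpha> within I. aa (W \<beta>) r1 * jj (W \<beta>) (Z \<beta>) r1 > 0"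
      using caj a s by (intro order_tendstoD(1)[of _ "aa (W \<alpha>) r1 * jj (W \<alpha>) (Z \<alpha>) r1"]) (auto simp: continuous_on_def slow_at_def)
    define t where "t \<beta> = theta (W \<beta>) (Z \<beta>) r1 / pi + 1 / 2" for \<beta>
    have ct: "(t \<longlongrightarrow> t \<alpha>) (at \<alpha> within I)" unfolding t_def[abs_def]
      using cth[of r1] a by (intro tendsto_intros) (auto simp: continuous_on_def)
    have "W \<alpha> r1 \<noteq> 0" by (rule slow_trap[OF Isol[OF a] r1(2)]) (use s in \<open>auto simp: slow_at_def\<close>)
    then have "t \<alpha> \<notin> \<int>" unfolding t_def by (rule frac_theta_nonint[OF Isol[OF a] r1(3)])
    then have fl: "of_int \<lfloor>t \<alpha>\<rfloor> < t \<alpha>" "t \<alpha> < of_int \<lfloor>t \<alpha>\<rfloor> + 1"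
      by (metis Ints_of_int less_eq_real_def of_int_floor_le) (rule floor_correct[THEN conjunct2, of "t \<alpha>", unfolded of_int_add of_int_1])
    have 3: "\<forall>\<^sub>F \<beta> in at \<alpha> within I. of_int \<lfloor>t \<alpha>\<rfloor> < t \<beta>" "\<forall>\<^sub>F \<beta> in at \<alpha> within I. t \<beta> < of_int \<lfloor>t \<alpha>\<rfloor> + 1"
      using order_tendstoD[OF ct] fl by auto
    have 4: "\<forall>\<^sub>F \<beta> in at \<alpha> within I. \<beta> \<in> I" by (auto simp: eventually_at_filter)
    show ?thesis
      using 1 2 3 4
    proof eventually_elim
      case (elim \<beta>)
      have "slow_at (W \<beta>) (Z \<beta>) r1" using elim r1 by (simp add: slow_at_def)
      then have "F \<beta> = cnt (W \<beta>) (Z \<beta>) r1" using Feq elim by simp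
      also have "\<dots> = \<lfloor>t \<beta>\<rfloor>" by (simp add: cnt_def t_def)
      also have "\<dots> = \<lfloor>t \<alpha>\<rfloor>" using elim by (intro floor_unique) auto
      also have "\<dots> = F \<alpha>" using Feq[OF a s] by (simp add: cnt_def t_def)
      finally show ?case by simp
    qed
  qed
  have MI: "M \<in> I" "B \<in> I" by (auto simp: I_def B_def)
  have "F M = F B"
    by (rule connected_local_const[of I]) (use loc MI in \<open>auto simp: I_def\<close>)
  moreover have "F M < int k"
  proof -
    have eqW: "W1 r = W M r" "Z1 r = Z M r" if "r \<ge> 0" for r
      using uniq[OF W1(1)] W1(2) M that by (auto simp: B_def)
    have rr: "r1 \<ge> 1" using r1 by (simp add: slow_at_def)
    have "slow_at (W M) (Z M) r1"
      using r1 eqW[of r1] rr by (simp add: slow_at_def ee_def vv_def aa_def jj_def aa_def jj_def W1(2) M)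
    then have "F M = \<lfloor>theta (W M) (Z M) r1 / pi + 1 / 2\<rfloor>" using Feq[OF MI(1)] by (simp add: cnt_def)
    also have "theta (W M) (Z M) r1 = theta W1 Z1 r1"
      unfolding theta_def by (rule integral_cong) (use eqW in \<open>auto simp: prf_def vv_def\<close>)
    finally show ?thesis using k by linarith
  qed
  moreover have "F B \<ge> int k"
  proof -
    obtain r where r: "alternates (W B) k r" using A(2)[OF Isol(1)[OF MI(2)]] fam(2) by (auto simp: B_def)
    have "r > 0" and th: "theta (W B) (Z B) r > (real k - 1 / 2) * pi"
      using alternates_theta[OF Isol[OF MI(2)] r] by auto
    obtain s where s: "slow_at (W B) (Z B) s" using slowI[OF MI(2)] by blast
    then have s1: "s \<ge> 1" by (simp add: slow_at_def)
    define m where "m = max r s"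
    have nz: "W B x \<noteq> 0" if "x \<ge> s" for x
      by (rule slow_trap[OF Isol[OF MI(2)] _ _ _ that]) (use s in \<open>auto simp: slow_at_def\<close>)
    have "F B = cnt (W B) (Z B) s" using Feq[OF MI(2) s] .
    also have "\<dots> = cnt (W B) (Z B) m"
      by (rule cnt_const[OF Isol[OF MI(2)], symmetric]) (use s1 nz in \<open>auto simp: m_def\<close>)
    also have "\<dots> = \<lfloor>theta (W B) (Z B) m / pi + 1 / 2\<rfloor>" by (simp add: cnt_def)
    finally have "F B = \<lfloor>theta (W B) (Z B) m / pi + 1 / 2\<rfloor>" .
    moreover have "theta (W B) (Z B) m > (real k - 1 / 2) * pi"
      using th theta_mono[OF Isol[OF MI(2)], of r m] \<open>r > 0\<close> by (auto simp: m_def)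
    then have "theta (W B) (Z B) m / pi > real k - 1 / 2" by (simp add: field_simps)
    ultimately show ?thesis by (simp add: le_floor_iff)
  qed
  ultimately show False by simp
qed

end

section \<open>Smooth radial functions and integrals over the ball\<close>

definition Psi :: "nat \<Rightarrow> real \<Rightarrow> real" where
  "Psi j t = (if t > 0 then exp (- 1 / t) / t ^ j else 0)"

text \<open>Substituting 1 / t turns this into the decay of x^j / exp x at infinity.\<close>

lemma Psi_tendsto_0: "(Psi j \<longlongrightarrow> 0) (at 0)"
proof -
  have "((\<lambda>t. inverse t ^ j / exp (inverse t)) \<longlongrightarrow> 0) (at_right (0::real))"
    by (rule filterlim_compose[OF tendsto_power_div_exp_0 filterlim_inverse_at_top_right])
  moreover have "\<forall>\<^sub>F t in at_right (0::real). inverse t ^ j / exp (inverse t) = Psi j t"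
  proof -
    have "\<forall>\<^sub>F t in at_right (0::real). t > 0" by (auto simp: eventually_at_filter)
    then show ?thesis by eventually_elim (simp add: Psi_def exp_minus field_simps)
  qed
  ultimately have r: "(Psi j \<longlongrightarrow> 0) (at_right 0)" by (rule Lim_transform_eventually)
  have "(Psi j \<longlongrightarrow> 0) (at_left 0)"
    by (rule tendsto_eventually) (auto simp: eventually_at_filter Psi_def)
  with r show ?thesis by (simp add: filterlim_split_at)
qed

lemma Psi_deriv: "(Psi j has_real_derivative Psi (j + 2) t - real j * Psi (j + 1) t) (at t)"
proof -
  consider "t > 0" | "t < 0" | "t = 0" by linarith
  then show ?thesis
  proof cases
    case 1
    have "((\<lambda>t. exp (- 1 / t) / t ^ j) has_real_derivative
        (exp (- 1 / t) * (1 / t\<^sup>2) * t ^ j - exp (- 1 / t) * (real j * t ^ (j - 1))) / (t ^ j * t ^ j)) (at t)"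
      using 1 by (auto intro!: derivative_eq_intros simp: power2_eq_square)
    moreover have "(exp (- 1 / t) * (1 / t\<^sup>2) * t ^ j - exp (- 1 / t) * (real j * t ^ (j - 1))) / (t ^ j * t ^ j)
        = Psi (j + 2) t - real j * Psi (j + 1) t"
      using 1 by (cases j) (auto simp: Psi_def field_simps power2_eq_square)
    moreover have "\<forall>\<^sub>F x in nhds t. Psi j x = exp (- 1 / x) / x ^ j"
    proof -
      have "\<forall>\<^sub>F x in nhds t. x > 0" using 1 by (rule eventually_nhds_in_open[of "{0<..}", simplified, rotated]) simp
      then show ?thesis by eventually_elim (simp add: Psi_def)
    qed
    ultimately show ?thesis by (subst DERIV_cong_ev[OF refl _ refl]) auto
  next
    case 2
    have "\<forall>\<^sub>F x in nhds t. x < 0" using 2 by (rule eventually_nhds_in_open[of "{..<0}", simplified, rotated]) simp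
    then have "\<forall>\<^sub>F x in nhds t. Psi j x = 0" by eventually_elim (simp add: Psi_def)
    then show ?thesis using 2 by (subst DERIV_cong_ev[OF refl _ refl]) (auto simp: Psi_def)
  next
    case 3
    have "Psi j h / h = Psi (j + 1) h" if "h \<noteq> 0" for h using that by (auto simp: Psi_def)
    then have "\<forall>\<^sub>F h in at 0. Psi (j + 1) h = Psi j h / h" by (auto simp: eventually_at_filter)
    with Psi_tendsto_0 have "((\<lambda>h. Psi j h / h) \<longlongrightarrow> 0) (at 0)" by (rule Lim_transform_eventually)
    then show ?thesis using 3 by (simp add: DERIV_def Psi_def)
  qed
qed

text \<open>The coinduction for \<^const>\<open>smooth_on\<close> runs over this class, which is closed under
  derivatives because the derivative of Psi j is Psi (j + 2) - j Psi (j + 1).\<close>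

inductive sm :: "('a::euclidean_space \<Rightarrow> real) \<Rightarrow> bool" where
  sm_const: "sm (\<lambda>x. c)"
| sm_inner: "sm (\<lambda>x. x \<bullet> v)"
| sm_sq: "sm (\<lambda>x. x \<bullet> x)"
| sm_add: "sm f \<Longrightarrow> sm g \<Longrightarrow> sm (\<lambda>x. f x + g x)"
| sm_mult: "sm f \<Longrightarrow> sm g \<Longrightarrow> sm (\<lambda>x. f x * g x)"
| sm_Psi: "sm (\<lambda>x. Psi j (a - b * (x \<bullet> x)))"

lemma sm_derivative:
  "sm f \<Longrightarrow> \<exists>f'. (\<forall>x. (f has_derivative f' x) (at x)) \<and> (\<forall>v. sm (\<lambda>x. f' x v))"
proof (induction rule: sm.induct)
  case (sm_const c)
  show ?case by (rule exI[of _ "\<lambda>x v. 0"]) (auto intro: sm.sm_const)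
next
  case (sm_inner v)
  have "sm (\<lambda>x::'a. va \<bullet> v)" for va by (rule sm.sm_const)
  then show ?case by (intro exI[of _ "\<lambda>x h. h \<bullet> v"]) (auto intro!: derivative_eq_intros)
next
  case sm_sq
  have "sm (\<lambda>x::'a. 2 * (x \<bullet> h))" for h by (intro sm.intros)
  then show ?case by (intro exI[of _ "\<lambda>x h. 2 * (x \<bullet> h)"]) (auto intro!: derivative_eq_intros simp: inner_commute)
next
  case (sm_add f g)
  then obtain f' g' where "\<forall>x. (f has_derivative f' x) (at x)" "\<forall>v. sm (\<lambda>x. f' x v)"
    "\<forall>x. (g has_derivative g' x) (at x)" "\<forall>v. sm (\<lambda>x. g' x v)" by blast
  then show ?case by (intro exI[of _ "\<lambda>x h. f' x h + g' x h"]) (auto intro!: derivative_intros sm.sm_add)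
next
  case (sm_mult f g)
  then obtain f' g' where "\<forall>x. (f has_derivative f' x) (at x)" "\<forall>v. sm (\<lambda>x. f' x v)"
    "\<forall>x. (g has_derivative g' x) (at x)" "\<forall>v. sm (\<lambda>x. g' x v)" by blast
  then show ?case using sm_mult.hyps
    by (intro exI[of _ "\<lambda>x h. f x * g' x h + f' x h * g x"])
       (auto intro!: derivative_intros sm.sm_add sm.sm_mult)
next
  case (sm_Psi j a b)
  let ?d = "\<lambda>x h::'a. (- 2 * b * (x \<bullet> h)) * (Psi (j + 2) (a - b * (x \<bullet> x)) + (- real j) * Psi (j + 1) (a - b * (x \<bullet> x)))"
  have "((\<lambda>x. Psi j (a - b * (x \<bullet> x))) has_derivative ?d x) (at x)" for x :: 'a
  proof -
    have "((\<lambda>x::'a. a - b * (x \<bullet> x)) has_derivative (\<lambda>h. - 2 * b * (x \<bullet> h))) (at x)"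
      by (auto intro!: derivative_eq_intros simp: inner_commute)
    from has_derivative_compose[OF this Psi_deriv[unfolded has_field_derivative_def]]
    show ?thesis by (simp add: mult.commute o_def)
  qed
  moreover have "sm (\<lambda>x. ?d x v)" for v by (intro sm.intros)
  ultimately show ?case by (intro exI[of _ ?d] conjI allI)
qed

lemma sm_smooth_on: assumes "sm f" "open S" shows "smooth_on S f"
  using assms(1)
proof (coinduction arbitrary: f rule: smooth_on.coinduct)
  case smooth_on
  obtain f' where f': "\<forall>x. (f has_derivative f' x) (at x)" "\<forall>v. sm (\<lambda>x. f' x v)" using sm_derivative[OF smooth_on] by blast
  have fd: "frechet_derivative f (at x) = f' x" for x using f'(1) frechet_derivative_at by metis
  have "f differentiable_on S" using f'(1) by (auto simp: differentiable_on_def differentiable_def intro: has_derivative_at_withinI)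
  then show ?case using assms(2) f'(2) by (auto simp: fd differentiable_imp_continuous_on)
qed

lemma sm_power: "sm f \<Longrightarrow> sm (\<lambda>x. f x ^ n)"
  by (induction n) (auto intro: sm.intros)

lemma sm_sum: "finite I \<Longrightarrow> (\<And>i. i \<in> I \<Longrightarrow> sm (f i)) \<Longrightarrow> sm (\<lambda>x. \<Sum>i\<in>I. f i x)"
  by (induction I rule: finite_induct) (auto intro: sm.intros)

lemma egrad_radial:
  assumes "(F has_real_derivative D) (at (x \<bullet> x))"
  shows "egrad (\<lambda>x. F (x \<bullet> x)) x = (2 * D) *\<^sub>R x"
proof -
  have "((\<lambda>x. x \<bullet> x) has_derivative (\<lambda>h. 2 * (x \<bullet> h))) (at x)"
    by (auto intro!: derivative_eq_intros simp: inner_commute)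
  from has_derivative_compose[OF this assms[unfolded has_field_derivative_def]]
  have "((\<lambda>x. F (x \<bullet> x)) has_derivative (\<lambda>h. D * (2 * (x \<bullet> h)))) (at x)" by simp
  then have "frechet_derivative (\<lambda>x. F (x \<bullet> x)) (at x) = (\<lambda>h. D * (2 * (x \<bullet> h)))"
    by (rule frechet_derivative_at[symmetric])
  then have "egrad (\<lambda>x. F (x \<bullet> x)) x = (\<Sum>b\<in>Basis. (2 * D) *\<^sub>R ((x \<bullet> b) *\<^sub>R b))"
    by (simp add: egrad_def mult_ac)
  also have "\<dots> = (2 * D) *\<^sub>R (\<Sum>b\<in>Basis. (x \<bullet> b) *\<^sub>R b)" by (rule scaleR_sum_right[symmetric])
  also have "\<dots> = (2 * D) *\<^sub>R x" by (simp only: euclidean_representation)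
  finally show ?thesis .
qed

text \<open>Stone-Weierstrass is applied to the derivative and the polynomial is integrated from f
  0, so one error bound holds for function and derivative. At s = 0 only the continuous extension of
  f' is used.\<close>

lemma C1_polynomial_approx:
  fixes f f' :: "real \<Rightarrow> real"
  assumes R: "0 \<le> R" "R < 1" and cf: "continuous_on {0..<1} f" and cf': "continuous_on {0..<1} f'"
    and d: "\<And>s. s \<in> {0<..<1} \<Longrightarrow> (f has_real_derivative f' s) (at s)" and e: "e > 0"
  obtains p p' where "\<And>s. (p has_real_derivative p' s) (at s)" "\<And>s. s \<in> {0..R} \<Longrightarrow> \<bar>p s - f s\<bar> \<le> e"
    "\<And>s. s \<in> {0..R} \<Longrightarrow> \<bar>p' s - f' s\<bar> \<le> e" "sm (\<lambda>x::'a::euclidean_space. p (x \<bullet> x))" "continuous_on UNIV p'"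
proof -
  obtain g where g: "real_polynomial_function g" "\<And>x. x \<in> {0..R} \<Longrightarrow> \<bar>f' x - g x\<bar> < e"
    by (rule Stone_Weierstrass_real_polynomial_function[of "{0..R}" f' e])
       (use e R in \<open>auto intro: continuous_on_subset[OF cf']\<close>)
  then obtain a n where a: "g = (\<lambda>x. \<Sum>i\<le>n. a i * x ^ i)" by (auto simp: real_polynomial_function_iff_sum)
  define p where "p s = f 0 + (\<Sum>i\<le>n. a i / real (Suc i) * s ^ Suc i)" for s
  have dp: "(p has_real_derivative g s) (at s)" for s
  proof -
    have "((\<lambda>s. a i / real (Suc i) * s ^ Suc i) has_real_derivative a i * s ^ i) (at s)" for i
      by (rule DERIV_cong[OF DERIV_cmult[OF DERIV_pow]]) simp
    then have "((\<lambda>s. \<Sum>i\<le>n. a i / real (Suc i) * s ^ Suc i) has_real_derivative (\<Sum>i\<le>n. a i * s ^ i)) (at s)"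
      by (intro DERIV_sum) auto
    from DERIV_add[OF DERIV_const this, of "f 0"] show ?thesis by (simp add: p_def[abs_def] a)
  qed
  have "\<bar>p s - f s\<bar> \<le> e" if s: "s \<in> {0..R}" for s
  proof (cases "s = 0")
    case False
    then have s0: "s > 0" using s by simp
    have c: "continuous_on {0..s} (\<lambda>x. p x - f x)"
    proof (rule continuous_on_diff)
      show "continuous_on {0..s} p" by (auto intro!: continuous_at_imp_continuous_on DERIV_isCont[OF dp])
      show "continuous_on {0..s} f" by (rule continuous_on_subset[OF cf]) (use s R in auto)
    qed
    have dd: "((\<lambda>x. p x - f x) has_real_derivative g x - f' x) (at x)" if "0 < x" "x < s" for x
      using d[of x] that s R by (intro DERIV_diff dp) auto
    have "\<exists>l x. 0 < x \<and> x < s \<and> ((\<lambda>x. p x - f x) has_real_derivative l) (at x) \<and> (p s - f s) - (p 0 - f 0) = (s - 0) * l"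
      by (rule MVT[OF s0 c]) (use dd in \<open>auto simp: real_differentiable_def\<close>)
    then obtain l x where x: "0 < x" "x < s" "((\<lambda>x. p x - f x) has_real_derivative l) (at x)"
      "(p s - f s) - (p 0 - f 0) = (s - 0) * l" by blast
    have l: "l = g x - f' x" by (rule DERIV_unique[OF x(3) dd[OF x(1,2)]])
    have "\<bar>l\<bar> \<le> e" using g(2)[of x] x s by (simp add: l abs_minus_commute)
    have "\<bar>p s - f s\<bar> = s * \<bar>l\<bar>" using x s0 by (simp add: p_def abs_mult)
    also have "\<dots> \<le> 1 * e" using \<open>\<bar>l\<bar> \<le> e\<close> s R by (intro mult_mono) auto
    finally show ?thesis by simp
  qed (use e in \<open>simp add: p_def\<close>)
  moreover have "sm (\<lambda>x::'a. p (x \<bullet> x))" unfolding p_def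
    by (intro sm.intros sm_sum sm_power) auto
  moreover have "\<bar>g s - f' s\<bar> \<le> e" if "s \<in> {0..R}" for s using g(2)[OF that] by (simp add: abs_minus_commute)
  moreover have "continuous_on UNIV g" unfolding a by (intro continuous_intros)
  ultimately show ?thesis using that dp by blast
qed

section \<open>Hyperbolic volume and integrability up to the boundary sphere\<close>

lemma hyp_ball_sets [measurable]: "(hyp_ball :: 'a::euclidean_space set) \<in> sets lebesgue"
  by (simp add: hyp_ball_def)

lemma in_hyp_ball: "x \<in> hyp_ball \<longleftrightarrow> x \<bullet> x < 1"
proof -
  have "x \<bullet> x < 1 \<longleftrightarrow> (norm x)\<^sup>2 < 1\<^sup>2" by (simp add: power2_norm_eq_inner)
  also have "\<dots> \<longleftrightarrow> norm x < 1" using power_less_imp_less_base[of "norm x" 2 1] power_strict_mono[of "norm x" 1 2] by auto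
  finally show ?thesis by (simp add: hyp_ball_def)
qed

lemma space_hyp_vol: "space hyp_vol = hyp_ball" by (simp add: hyp_vol_def)

lemma continuous_hyp_measurable:
  "continuous_on hyp_ball f \<Longrightarrow> f \<in> borel_measurable (hyp_vol :: 'a::euclidean_space measure)"
  unfolding hyp_vol_def
  by (simp add: continuous_imp_measurable_on_sets_lebesgue hyp_ball_sets)

lemma hyp_conf_continuous: "continuous_on hyp_ball (hyp_conf :: 'a::euclidean_space \<Rightarrow> real)"
  unfolding hyp_conf_def[abs_def]
  by (intro continuous_intros) (auto simp: in_hyp_ball power2_norm_eq_inner)

lemma hyp_conf_pos: "x \<in> hyp_ball \<Longrightarrow> hyp_conf x > 0"
  by (auto simp: hyp_conf_def in_hyp_ball power2_norm_eq_inner)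

lemma hyp_conf_power_measurable [measurable]:
  "(\<lambda>x. hyp_conf x ^ n) \<in> borel_measurable (lebesgue_on (hyp_ball :: 'a::euclidean_space set))"
  by (intro continuous_imp_measurable_on_sets_lebesgue continuous_intros hyp_conf_continuous hyp_ball_sets)

lemma nn_integral_hyp_vol:
  assumes "f \<in> borel_measurable (hyp_vol :: 'a::euclidean_space measure)"
  shows "(\<integral>\<^sup>+ x. f x \<partial>hyp_vol) = (\<integral>\<^sup>+ x. ennreal (hyp_conf x ^ DIM('a)) * f x * indicator hyp_ball x \<partial>lebesgue)"
proof -
  have f: "f \<in> borel_measurable (lebesgue_on hyp_ball)" using assms by (simp add: hyp_vol_def)
  have "(\<integral>\<^sup>+ x. f x \<partial>hyp_vol) = (\<integral>\<^sup>+ x. ennreal (hyp_conf x ^ DIM('a)) * f x \<partial>lebesgue_on hyp_ball)"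
    unfolding hyp_vol_def by (rule nn_integral_density) (use f in auto)
  also have "\<dots> = (\<integral>\<^sup>+ x. ennreal (hyp_conf x ^ DIM('a)) * f x * indicator hyp_ball x \<partial>lebesgue)"
    by (rule nn_integral_restrict_space) (simp add: hyp_ball_sets)
  finally show ?thesis .
qed

lemma shell_measure:
  fixes r R :: real assumes "0 \<le> r" "r \<le> R" "R \<le> 1"
  shows "emeasure lebesgue {x::'a::euclidean_space. r \<le> norm x \<and> norm x < R}
     \<le> ennreal (measure lborel (ball (0::'a) 1) * real DIM('a) * (R - r))"
proof -
  have e: "{x::'a. r \<le> norm x \<and> norm x < R} = ball 0 R - ball 0 r" by auto
  have E: "emeasure lebesgue (ball (0::'a) t) = ennreal (measure lborel (ball (0::'a) t))" for t
    using emeasure_lborel_ball_finite[of "0::'a" t] by (subst emeasure_eq_ennreal_measure[symmetric]) auto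
  have "emeasure lebesgue (ball (0::'a) R - ball 0 r) = emeasure lebesgue (ball (0::'a) R) - emeasure lebesgue (ball (0::'a) r)"
    by (rule emeasure_Diff) (use assms E[of r] in auto)
  also have "\<dots> = ennreal (measure lborel (ball (0::'a) R)) - ennreal (measure lborel (ball (0::'a) r))"
    by (simp only: E)
  also have "\<dots> = ennreal (measure lborel (ball (0::'a) R) - measure lborel (ball (0::'a) r))"
    by (rule ennreal_minus) simp
  also have "measure lborel (ball (0::'a) R) - measure lborel (ball (0::'a) r) = measure lborel (ball (0::'a) 1) * (R ^ DIM('a) - r ^ DIM('a))"
    using assms content_ball_conv_unit_ball[of R "0::'a"] content_ball_conv_unit_ball[of r "0::'a"]
    by (simp add: algebra_simps)
  also have "ennreal \<dots> \<le> ennreal (measure lborel (ball (0::'a) 1) * (real DIM('a) * (R - r)))"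
  proof (intro ennreal_leI mult_left_mono)
    have "R ^ n - r ^ n \<le> real n * (R - r)" for n
    proof (induction n)
      case (Suc n)
      have "R ^ Suc n - r ^ Suc n = R * (R ^ n - r ^ n) + (R - r) * r ^ n" by (simp add: algebra_simps)
      also have "\<dots> \<le> 1 * (R ^ n - r ^ n) + (R - r) * 1"
        using assms by (intro add_mono mult_mono power_le_one) (auto intro: power_mono)
      also have "\<dots> \<le> real (Suc n) * (R - r)" using Suc by (simp add: algebra_simps)
      finally show ?case .
    qed simp
    then show "R ^ DIM('a) - r ^ DIM('a) \<le> real DIM('a) * (R - r)" .
  qed simp
  finally show ?thesis by (simp add: e mult.assoc)
qed

text \<open>On the dyadic shell \<open>Sh j\<close> the integrand is comparable to 2^(- j \<beta>)
  and the volume is at most a multiple of 2^(- j); the sum is geometric with ratio 2^(- (\<beta> +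
  1)).\<close>

lemma boundary_power_integrable:
  fixes \<beta> :: real assumes b: "\<beta> > -1"
  shows "(\<integral>\<^sup>+ x. ennreal ((1 - (x::'a::euclidean_space) \<bullet> x) powr \<beta>) * indicator hyp_ball x \<partial>lebesgue) < \<infinity>"
proof -
  define Sh where "Sh j = {x::'a. 1 - (1/2) ^ j \<le> norm x \<and> norm x < 1 - (1/2) ^ Suc j}" for j
  define V where "V = measure lborel (ball (0::'a) 1) * real DIM('a)"
  \<comment> \<open>On \<open>Sh j\<close> the quantity 1 - |x|^2 lies between 2^(- j) / 2 and 2 *
    2^(- j); the prefactor covers both signs of \<beta>.\<close>
  define c where "c j = 2 powr \<bar>\<beta>\<bar> * ((1/2) ^ j) powr \<beta>" for j :: nat
  have V: "V \<ge> 0" by (simp add: V_def)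
  have Shm: "Sh j \<in> sets lebesgue" for j
  proof -
    have "Sh j = ball 0 (1 - (1/2) ^ Suc j) - ball 0 (1 - (1/2) ^ j)" by (auto simp: Sh_def)
    then show ?thesis by (simp del: power_Suc)
  qed
  have "ennreal ((1 - x \<bullet> x) powr \<beta>) * indicator hyp_ball x \<le> (\<Sum>j. ennreal (c j) * indicator (Sh j) x)" for x :: 'a
  proof (cases "x \<in> hyp_ball")
    case True
    then have nx: "norm x < 1" by (simp add: hyp_ball_def)
    have "\<exists>j. (1/2) ^ Suc j < 1 - norm x" 
    proof -
      obtain n where "(1/2::real) ^ n < 1 - norm x" using real_arch_pow_inv[of "1 - norm x" "1/2"] nx by auto
      moreover have "(1/2::real) ^ Suc n \<le> (1/2) ^ n" by simp
      ultimately show ?thesis by (intro exI[of _ n]) linarith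
    qed
    define j where "j = (LEAST j. (1/2) ^ Suc j < 1 - norm x)"
    have j1: "(1/2) ^ Suc j < 1 - norm x" unfolding j_def using \<open>\<exists>j. _\<close> by (rule LeastI_ex)
    have j2: "1 - norm x \<le> (1/2) ^ j"
    proof (cases j)
      case (Suc i)
      have "\<not> (1/2) ^ Suc i < 1 - norm x" using not_less_Least[of i "\<lambda>j. (1/2) ^ Suc j < 1 - norm x"] Suc by (simp add: j_def)
      then show ?thesis using Suc by simp
    qed simp
    have xS: "x \<in> Sh j" using j1 j2 by (simp add: Sh_def)
    have xx: "1 - x \<bullet> x = (1 - norm x) * (1 + norm x)"
      by (simp add: power2_norm_eq_inner[symmetric] power2_eq_square algebra_simps)
    have lo: "1 - x \<bullet> x \<ge> (1/2) ^ Suc j"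
    proof -
      have "(1/2) ^ Suc j \<le> (1 - norm x) * 1" using j1 by simp
      also have "\<dots> \<le> (1 - norm x) * (1 + norm x)" using nx by (intro mult_left_mono) auto
      finally show ?thesis by (simp add: xx)
    qed
    have hi: "1 - x \<bullet> x \<le> 2 * (1/2) ^ j"
    proof -
      have "(1 - norm x) * (1 + norm x) \<le> (1/2) ^ j * 2" using j2 nx by (intro mult_mono) auto
      then show ?thesis by (simp add: xx)
    qed
    have pos: "1 - x \<bullet> x > 0" using True by (simp add: in_hyp_ball)
    have "(1 - x \<bullet> x) powr \<beta> \<le> c j"
    proof (cases "\<beta> \<ge> 0")
      case True
      have "(1 - x \<bullet> x) powr \<beta> \<le> (2 * (1/2) ^ j) powr \<beta>" using hi pos True by (intro powr_mono2) auto
      then show ?thesis using True by (simp add: c_def powr_mult)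
    next
      case False
      have "(1 - x \<bullet> x) powr \<beta> \<le> ((1/2) ^ Suc j) powr \<beta>" using lo False by (intro powr_mono2') auto
      also have "\<dots> = (1/2) powr \<beta> * ((1/2) ^ j) powr \<beta>"
        unfolding power_Suc by (rule powr_mult)
      also have "(1/2) powr \<beta> = 2 powr \<bar>\<beta>\<bar>" using False by (simp add: powr_divide powr_minus_divide)
      finally show ?thesis by (simp add: c_def)
    qed
    then have "ennreal ((1 - x \<bullet> x) powr \<beta>) * indicator hyp_ball x \<le> ennreal (c j) * indicator (Sh j) x"
      using True xS by (simp add: ennreal_leI)
    also have "\<dots> \<le> (\<Sum>j. ennreal (c j) * indicator (Sh j) x)"
    proof -
      have "g j \<le> suminf g" for g :: "nat \<Rightarrow> ennreal" using sum_le_suminf[of g "{j}"] by simp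
      then show ?thesis .
    qed
    finally show ?thesis .
  qed simp
  then have "(\<integral>\<^sup>+ x. ennreal ((1 - (x::'a) \<bullet> x) powr \<beta>) * indicator hyp_ball x \<partial>lebesgue)
      \<le> (\<integral>\<^sup>+ x. (\<Sum>j. ennreal (c j) * indicator (Sh j) x) \<partial>lebesgue)" by (rule nn_integral_mono)
  also have "\<dots> = (\<Sum>j. \<integral>\<^sup>+ x. ennreal (c j) * indicator (Sh j) x \<partial>lebesgue)"
    by (rule nn_integral_suminf) (use Shm in auto)
  also have "\<dots> = (\<Sum>j. ennreal (c j) * emeasure lebesgue (Sh j))"
    using Shm by (simp add: nn_integral_cmult_indicator)
  also have "\<dots> \<le> (\<Sum>j. ennreal (2 powr \<bar>\<beta>\<bar> * V * ((1/2) powr (\<beta> + 1)) ^ j))"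
  proof (rule suminf_le)
    fix j
    have "emeasure lebesgue (Sh j) \<le> ennreal (V * ((1 - (1/2) ^ Suc j) - (1 - (1/2) ^ j)))"
      unfolding Sh_def V_def by (rule shell_measure) (auto simp: power_le_one)
    also have "\<dots> \<le> ennreal (V * (1/2) ^ j)" using V by (intro ennreal_leI mult_left_mono) auto
    finally have "ennreal (c j) * emeasure lebesgue (Sh j) \<le> ennreal (c j) * ennreal (V * (1/2) ^ j)" by (rule mult_left_mono) simp
    also have "\<dots> = ennreal (c j * (V * (1/2) ^ j))" by (simp add: c_def V ennreal_mult')
    also have "c j * (V * (1/2) ^ j) = 2 powr \<bar>\<beta>\<bar> * V * ((1/2) powr (\<beta> + 1)) ^ j"
    proof -
      have "((1/2::real) ^ j) powr \<beta> = ((1/2) powr \<beta>) ^ j" by (simp add: powr_realpow[symmetric] powr_powr mult.commute)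
      then show ?thesis by (simp add: c_def powr_add power_mult_distrib power_divide mult_ac)
    qed
    finally show "ennreal (c j) * emeasure lebesgue (Sh j) \<le> ennreal (2 powr \<bar>\<beta>\<bar> * V * ((1/2) powr (\<beta> + 1)) ^ j)" .
  qed auto
  also have "\<dots> < \<infinity>"
  proof -
    have "(1/2::real) powr (\<beta> + 1) < 1" using b powr_less_mono'[of "1/2" 0 "\<beta> + 1"] by simp
    then have "summable (\<lambda>j. 2 powr \<bar>\<beta>\<bar> * V * ((1/2::real) powr (\<beta> + 1)) ^ j)"
      by (intro summable_mult summable_geometric) auto
    then show ?thesis using V by (subst suminf_ennreal2) (auto simp: less_top[symmetric])
  qed
  finally show ?thesis .
qed

section \<open>Smooth cutoffs and membership of radial functions in H^1\<close>

lemma Psi_0_bounds: "0 \<le> Psi 0 t" "Psi 0 t \<le> 1"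
  by (auto simp: Psi_def)

lemma Psi_0_lower: "t > 0 \<Longrightarrow> 1 - Psi 0 t \<le> 1 / t"
  using exp_ge_add_one_self[of "- 1 / t"] by (simp add: Psi_def)

text \<open>With y = 1 / t the left side is (y + y^2) / exp y. It is the size of the cutoff gradient
  in the hyperbolic metric: the first bound serves domination, the second pointwise
  convergence.\<close>

lemma Psi_2_bounds:
  assumes "t > 0" shows "(t + 1) * Psi 2 t \<le> 2" "(t + 1) * Psi 2 t \<le> 1 / t + 1 / t\<^sup>2"
proof -
  define y where "y = 1 / t"
  have y: "y > 0" using assms by (simp add: y_def)
  have e: "(t + 1) * Psi 2 t = (y + y\<^sup>2) / exp y"
    using assms by (simp add: Psi_def y_def exp_minus field_simps power2_eq_square)
  have "y + y\<^sup>2 \<le> 2 * (1 + y + y\<^sup>2 / 2)" using y by (simp add: algebra_simps)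
  also have "\<dots> \<le> 2 * exp y" using exp_lower_Taylor_quadratic[of y] y by simp
  finally show "(t + 1) * Psi 2 t \<le> 2" unfolding e by (simp add: divide_le_eq)
  have "(y + y\<^sup>2) / exp y \<le> (y + y\<^sup>2) / 1" using y by (intro divide_left_mono) auto
  then show "(t + 1) * Psi 2 t \<le> 1 / t + 1 / t\<^sup>2" unfolding e by (simp add: y_def power_divide)
qed

text \<open>The volume density contributes the exponent - N, and the hypothesis on c makes 2 c - N >
  - 1.\<close>

lemma hyp_power_finite:
  assumes "c > (real DIM('a) - 1) / 2"
  shows "(\<integral>\<^sup>+ x. ennreal (M * (1 - (x::'a::euclidean_space) \<bullet> x) powr (2 * c)) \<partial>hyp_vol) < \<infinity>"
proof -
  let ?N = "DIM('a)"
  have m: "(\<lambda>x::'a. ennreal (M * (1 - x \<bullet> x) powr (2 * c))) \<in> borel_measurable hyp_vol"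
    by (intro measurable_compose[OF _ measurable_ennreal] continuous_hyp_measurable continuous_intros)
       (auto simp: in_hyp_ball)
  have "(\<integral>\<^sup>+ x. ennreal (M * (1 - (x::'a) \<bullet> x) powr (2 * c)) \<partial>hyp_vol)
      \<le> (\<integral>\<^sup>+ x. ennreal (2 ^ ?N * \<bar>M\<bar>) * (ennreal ((1 - (x::'a) \<bullet> x) powr (2 * c - real ?N)) * indicator hyp_ball x) \<partial>lebesgue)"
    unfolding nn_integral_hyp_vol[OF m]
  proof (rule nn_integral_mono)
    fix x :: 'a
    show "ennreal (hyp_conf x ^ ?N) * ennreal (M * (1 - x \<bullet> x) powr (2 * c)) * indicator hyp_ball x
        \<le> ennreal (2 ^ ?N * \<bar>M\<bar>) * (ennreal ((1 - x \<bullet> x) powr (2 * c - real ?N)) * indicator hyp_ball x)"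
    proof (cases "x \<in> hyp_ball")
      case True
      then have p: "1 - x \<bullet> x > 0" by (simp add: in_hyp_ball)
      have "hyp_conf x ^ ?N * (M * (1 - x \<bullet> x) powr (2 * c)) \<le> hyp_conf x ^ ?N * (\<bar>M\<bar> * (1 - x \<bullet> x) powr (2 * c))"
        using hyp_conf_pos[OF True] by (intro mult_left_mono mult_right_mono) auto
      also have "\<dots> = 2 ^ ?N * \<bar>M\<bar> * ((1 - x \<bullet> x) powr (2 * c - real ?N))"
        using p by (simp add: hyp_conf_def power2_norm_eq_inner power_divide powr_diff powr_realpow)
      finally have "ennreal (hyp_conf x ^ ?N * (M * (1 - x \<bullet> x) powr (2 * c)))
          \<le> ennreal (2 ^ ?N * \<bar>M\<bar> * ((1 - x \<bullet> x) powr (2 * c - real ?N)))" by (rule ennreal_leI)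
      then show ?thesis using True hyp_conf_pos[OF True] by (simp add: ennreal_mult' ennreal_mult'')
    qed simp
  qed
  also have "\<dots> = ennreal (2 ^ ?N * \<bar>M\<bar>) * (\<integral>\<^sup>+ x. ennreal ((1 - (x::'a) \<bullet> x) powr (2 * c - real ?N)) * indicator hyp_ball x \<partial>lebesgue)"
  proof (rule nn_integral_cmult)
    have "(\<lambda>x::'a. ennreal ((1 - x \<bullet> x) powr (2 * c - real ?N))) \<in> borel_measurable borel" by measurable
    then have "(\<lambda>x::'a. ennreal ((1 - x \<bullet> x) powr (2 * c - real ?N))) \<in> borel_measurable lebesgue"
      by (intro measurable_completion) simp
    then show "(\<lambda>x::'a. ennreal ((1 - x \<bullet> x) powr (2 * c - real ?N)) * indicator hyp_ball x) \<in> borel_measurable lebesgue"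
      by (intro borel_measurable_times_ennreal borel_measurable_indicator hyp_ball_sets)
  qed
  also have "\<dots> < \<infinity>"
    using boundary_power_integrable[where 'a = 'a, of "2 * c - real ?N"] assms by (simp add: ennreal_mult_less_top)
  finally show ?thesis .
qed

text \<open>The cutoff vanishes unless |x|^2 < 1 - 1 / K, so the support stays in a smaller closed
  ball.\<close>

lemma cutoff_test_fun:
  assumes "sm (\<lambda>x::'a::euclidean_space. p (x \<bullet> x))" "K > 1"
  shows "test_fun (\<lambda>x::'a. Psi 0 ((K - 1) - K * (x \<bullet> x)) * p (x \<bullet> x))" (is "test_fun ?f")
proof -
  have s: "smooth_on hyp_ball ?f"
    by (rule sm_smooth_on[OF sm.sm_mult[OF sm.sm_Psi assms(1)]]) (simp add: hyp_ball_def)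
  define R where "R = sqrt (1 - 1 / K)"
  have R: "R < 1" using assms(2) by (simp add: R_def)
  have "{x. ?f x \<noteq> 0} \<subseteq> cball 0 R"
  proof
    fix x :: 'a assume "x \<in> {x. ?f x \<noteq> 0}"
    then have "(K - 1) - K * (x \<bullet> x) > 0" by (auto simp: Psi_def split: if_splits)
    then have "x \<bullet> x \<le> 1 - 1 / K" using assms(2) by (simp add: field_simps)
    then have "norm x \<le> R" unfolding R_def norm_eq_sqrt_inner by (rule real_sqrt_le_mono)
    then show "x \<in> cball 0 R" by simp
  qed
  then have c: "closure {x. ?f x \<noteq> 0} \<subseteq> cball 0 R" by (rule closure_minimal) simp
  have "compact (closure {x. ?f x \<noteq> 0})"
    using bounded_subset[OF bounded_cball c] by (simp add: compact_eq_bounded_closed)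
  moreover have "closure {x. ?f x \<noteq> 0} \<subseteq> hyp_ball" using c R by (force simp: hyp_ball_def)
  ultimately show ?thesis using s by (simp add: test_fun_def)
qed

text \<open>The approximants are cutoff times polynomial. Their error in value and in hyperbolic
  gradient is at most B k s (1 - s)^c, where B is bounded and tends to 0 for each s. Dominated
  convergence applies because (1 - s)^(2 c) has finite hyperbolic integral.\<close>

lemma H1_radial:
  fixes om om' :: "real \<Rightarrow> real"
  assumes c: "c > (real DIM('a::euclidean_space) - 1) / 2" "c \<ge> 0"
    and cf: "continuous_on {0..<1} om" and cf': "continuous_on {0..<1} om'"
    and d: "\<And>s. s \<in> {0<..<1} \<Longrightarrow> (om has_real_derivative om' s) (at s)"
    and b: "\<And>s. s \<in> {0..<1} \<Longrightarrow> \<bar>om s\<bar> \<le> C * (1 - s) powr c"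
    and b': "\<And>s. s \<in> {0..<1} \<Longrightarrow> \<bar>om' s\<bar> * (1 - s) \<le> C * (1 - s) powr c"
  shows "H1_with_grad (\<lambda>x::'a. om (x \<bullet> x)) (\<lambda>x. (2 * om' (x \<bullet> x)) *\<^sub>R x)"
proof -
  define K where "K k = real (k + 2)" for k
  have K: "K k > 1" "K k > 0" "K k \<noteq> 0" for k by (auto simp: K_def)
  have C: "C \<ge> 0" using b[of 0] by simp
  define Q where "Q k p p' \<longleftrightarrow> (\<forall>s. (p has_real_derivative p' s) (at s)) \<and> (\<forall>s\<in>{0..1 - 1 / K k}. \<bar>p s - om s\<bar> \<le> (1 / K k) powr (c + 1))
     \<and> (\<forall>s\<in>{0..1 - 1 / K k}. \<bar>p' s - om' s\<bar> \<le> (1 / K k) powr (c + 1)) \<and> sm (\<lambda>x::'a. p (x \<bullet> x)) \<and> continuous_on UNIV p'" for k p p'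
  have "\<exists>p p'. Q k p p'" for k
  proof -
    obtain p p' where "\<And>s. (p has_real_derivative p' s) (at s)" "\<And>s. s \<in> {0..1 - 1 / K k} \<Longrightarrow> \<bar>p s - om s\<bar> \<le> (1 / K k) powr (c + 1)"
      "\<And>s. s \<in> {0..1 - 1 / K k} \<Longrightarrow> \<bar>p' s - om' s\<bar> \<le> (1 / K k) powr (c + 1)" "sm (\<lambda>x::'a. p (x \<bullet> x))" "continuous_on UNIV p'"
      by (rule C1_polynomial_approx[OF _ _ cf cf' d, of "1 - 1 / K k" "(1 / K k) powr (c + 1)"]) (use K[of k] in auto)
    then show ?thesis unfolding Q_def by blast
  qed
  then obtain p p' where "\<And>k. Q k (p k) (p' k)" by metis
  then have dp: "\<And>k s. (p k has_real_derivative p' k s) (at s)"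
    and pe: "\<And>k s. s \<in> {0..1 - 1 / K k} \<Longrightarrow> \<bar>p k s - om s\<bar> \<le> (1 / K k) powr (c + 1)"
    and pe': "\<And>k s. s \<in> {0..1 - 1 / K k} \<Longrightarrow> \<bar>p' k s - om' s\<bar> \<le> (1 / K k) powr (c + 1)"
    and smp: "\<And>k. sm (\<lambda>x::'a. p k (x \<bullet> x))" and cp': "\<And>k. continuous_on UNIV (p' k)"
    unfolding Q_def by blast+
  define t where "t k s = (K k - 1) - K k * s" for k s
  define z where "z k s = Psi 0 (t k s)" for k s
  define z' where "z' k s = - K k * Psi 2 (t k s)" for k s
  define F where "F k s = z k s * p k s" for k s
  define F' where "F' k s = z' k s * p k s + z k s * p' k s" for k s
  define phi where "phi k x = F k (x \<bullet> x)" for k and x :: 'a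
  have test: "test_fun (phi k)" for k
    using cutoff_test_fun[OF smp[of k] K(1)[of k]] by (simp add: phi_def[abs_def] F_def z_def t_def)
  have dz: "(z k has_real_derivative z' k s) (at s)" for k s
  proof -
    have "(t k has_real_derivative - K k) (at s)" unfolding t_def[abs_def] by (auto intro!: derivative_eq_intros)
    from DERIV_chain2[OF Psi_deriv this, of 0] show ?thesis by (simp add: z_def[abs_def] z'_def mult.commute numeral_2_eq_2)
  qed
  have dF: "(F k has_real_derivative F' k s) (at s)" for k s
    unfolding F_def[abs_def] F'_def by (rule DERIV_cong[OF DERIV_mult[OF dz dp]]) simp
  have grad: "egrad (phi k) x = (2 * F' k (x \<bullet> x)) *\<^sub>R x" for k x
    unfolding phi_def by (rule egrad_radial[OF dF])
  \<comment> \<open>This is |z'| (1 - s), the cutoff gradient in the hyperbolic scale; since K (1 -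
    s) = t + 1 it is controlled by \<open>Psi_2_bounds\<close>.\<close>
  define eta where "eta k s = K k * (1 - s) * Psi 2 (t k s)" for k s
  define B where "B k s = eta k s * (1 + C) + 1 / K k + C * (1 - z k s)" for k s
  have eta0: "0 \<le> eta k s" "eta k s \<le> 2" if "s < 1" for k s
  proof -
    show "0 \<le> eta k s" using K[of k] that by (auto simp: eta_def Psi_def)
    have "K k * (1 - s) = t k s + 1" by (simp add: t_def algebra_simps)
    then show "eta k s \<le> 2" using Psi_2_bounds(1)[of "t k s"] by (cases "t k s > 0") (auto simp: eta_def Psi_def)
  qed
  have z01: "0 \<le> z k s" "z k s \<le> 1" for k s by (auto simp: z_def Psi_0_bounds)
  have iK: "1 / K k \<le> 1" "0 \<le> 1 / K k" for k using K[of k] by auto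
  have B0: "0 \<le> B k s" "B k s \<le> 4 * (1 + C)" if "s < 1" for k s
  proof -
    show "0 \<le> B k s" unfolding B_def using eta0[OF that] z01[of k s] iK[of k] C by (intro add_nonneg_nonneg mult_nonneg_nonneg) auto
    have "eta k s * (1 + C) \<le> 2 * (1 + C)" using eta0[OF that] C by (intro mult_right_mono) auto
    moreover have "C * (1 - z k s) \<le> C * 1" using z01[of k s] C by (intro mult_left_mono) auto
    ultimately show "B k s \<le> 4 * (1 + C)" unfolding B_def using iK[of k] C by simp
  qed
  have B_lim: "(\<lambda>k. B k s) \<longlonglongrightarrow> 0" if s: "s < 1" for s
  proof -
    have "filterlim K at_top sequentially" unfolding K_def[abs_def]
      by (rule filterlim_compose[OF filterlim_real_sequentially]) (rule filterlim_add_const_nat_at_top)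
    then have "filterlim (\<lambda>k. (1 - s) * K k) at_top sequentially"
      using s by (intro filterlim_tendsto_pos_mult_at_top[OF tendsto_const]) auto
    then have "filterlim (\<lambda>k. - 1 + (1 - s) * K k) at_top sequentially"
      by (rule filterlim_tendsto_add_at_top[OF tendsto_const])
    then have tl: "filterlim (\<lambda>k. t k s) at_top sequentially" by (simp add: t_def algebra_simps)
    have t0: "\<forall>\<^sub>F k in sequentially. t k s > 0" using tl by (auto simp: filterlim_at_top_dense)
    have it: "(\<lambda>k. 1 / t k s) \<longlonglongrightarrow> 0" by (rule tendsto_divide_0[OF tendsto_const filterlim_at_top_imp_at_infinity[OF tl]])
    have iKl: "(\<lambda>k. 1 / K k) \<longlonglongrightarrow> 0" by (rule tendsto_divide_0[OF tendsto_const filterlim_at_top_imp_at_infinity[OF \<open>filterlim K at_top sequentially\<close>]])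
    have "(\<lambda>k. (1 / t k s + (1 / t k s)\<^sup>2) * (1 + C) + 1 / K k + C * (1 / t k s)) \<longlonglongrightarrow> (0 + 0\<^sup>2) * (1 + C) + 0 + C * 0"
      by (intro tendsto_intros it iKl)
    then have u: "(\<lambda>k. (1 / t k s + (1 / t k s)\<^sup>2) * (1 + C) + 1 / K k + C * (1 / t k s)) \<longlonglongrightarrow> 0" by simp
    show ?thesis
    proof (rule tendsto_sandwich[OF _ _ tendsto_const u])
      show "\<forall>\<^sub>F k in sequentially. 0 \<le> B k s" using B0[OF s] by simp
      show "\<forall>\<^sub>F k in sequentially. B k s \<le> (1 / t k s + (1 / t k s)\<^sup>2) * (1 + C) + 1 / K k + C * (1 / t k s)"
        using t0
      proof eventually_elim
        case (elim k)
        have "K k * (1 - s) = t k s + 1" by (simp add: t_def algebra_simps)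
        then have "eta k s \<le> 1 / t k s + (1 / t k s)\<^sup>2" using Psi_2_bounds(2)[OF elim] by (simp add: eta_def power_divide)
        moreover have "1 - z k s \<le> 1 / t k s" unfolding z_def by (rule Psi_0_lower[OF elim])
        ultimately show ?case unfolding B_def using C by (intro add_mono mult_right_mono mult_left_mono) auto
      qed
    qed
  qed
  have E: "\<bar>F k s - om s\<bar> \<le> B k s * (1 - s) powr c \<and> \<bar>F' k s - om' s\<bar> * (1 - s) \<le> B k s * (1 - s) powr c"
    if s: "s \<in> {0..<1}" for k s
  proof -
    define P where "P = (1 - s) powr c"
    have P0: "P \<ge> 0" by (simp add: P_def)
    have q: "z k s * \<bar>p k s - om s\<bar> \<le> 1 / K k * P \<and> eta k s * \<bar>p k s - om s\<bar> \<le> eta k s * P \<and> z k s * \<bar>p' k s - om' s\<bar> \<le> 1 / K k * P"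
    proof (cases "s \<le> 1 - 1 / K k")
      case True
      \<comment> \<open>On the support of the cutoff 1 / K \<le> 1 - s, so one power of 1 / K stays
        as a small factor and the others become (1 - s)^c.\<close>
      have "(1 / K k) powr (c + 1) = 1 / K k * (1 / K k) powr c" using K[of k] by (simp add: powr_add)
      also have "\<dots> \<le> 1 / K k * P" unfolding P_def
        using True c(2) iK[of k] by (intro mult_left_mono powr_mono2) auto
      finally have e: "(1 / K k) powr (c + 1) \<le> 1 / K k * P" .
      have 1: "\<bar>p k s - om s\<bar> \<le> 1 / K k * P" "\<bar>p' k s - om' s\<bar> \<le> 1 / K k * P"
        using pe[of s k] pe'[of s k] e s True by auto
      have "z k s * \<bar>p k s - om s\<bar> \<le> 1 * (1 / K k * P)" "z k s * \<bar>p' k s - om' s\<bar> \<le> 1 * (1 / K k * P)"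
        using 1 z01[of k s] by (intro mult_mono; auto)+
      moreover have "1 / K k * P \<le> 1 * P" using iK[of k] P0 by (intro mult_right_mono) auto
      then have "\<bar>p k s - om s\<bar> \<le> P" using 1 by simp
      then have "eta k s * \<bar>p k s - om s\<bar> \<le> eta k s * P" using eta0[of s k] s by (intro mult_left_mono) auto
      ultimately show ?thesis by simp
    next
      case False
      then have "t k s \<le> 0" using K[of k] by (simp add: t_def field_simps)
      then have "z k s = 0" "eta k s = 0" by (auto simp: z_def eta_def Psi_def)
      then show ?thesis using P0 iK[of k] by simp
    qed
    have omb: "\<bar>om s\<bar> \<le> C * P" "\<bar>om' s\<bar> * (1 - s) \<le> C * P" using b[OF s] b'[OF s] by (auto simp: P_def)
    have "F k s - om s = z k s * (p k s - om s) - (1 - z k s) * om s" by (simp add: F_def algebra_simps)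
    also have "\<bar>\<dots>\<bar> \<le> \<bar>z k s * (p k s - om s)\<bar> + \<bar>(1 - z k s) * om s\<bar>" by (rule abs_triangle_ineq4)
    also have "\<dots> = z k s * \<bar>p k s - om s\<bar> + (1 - z k s) * \<bar>om s\<bar>" using z01[of k s] by (simp add: abs_mult)
    also have "\<dots> \<le> 1 / K k * P + (1 - z k s) * (C * P)" using q omb z01[of k s] by (intro add_mono mult_left_mono) auto
    also have "\<dots> \<le> B k s * P"
    proof -
      have "0 \<le> eta k s * (1 + C) * P" using eta0[of s k] s C P0 by simp
      then show ?thesis by (simp add: B_def algebra_simps)
    qed
    finally have 1: "\<bar>F k s - om s\<bar> \<le> B k s * P" .
    have s1: "0 < 1 - s" "1 - s \<le> 1" using s by auto
    have "F' k s - om' s = z' k s * (p k s - om s) + z' k s * om s + z k s * (p' k s - om' s) - (1 - z k s) * om' s"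
      by (simp add: F'_def algebra_simps)
    then have "\<bar>F' k s - om' s\<bar> \<le> \<bar>z' k s * (p k s - om s)\<bar> + \<bar>z' k s * om s\<bar> + \<bar>z k s * (p' k s - om' s)\<bar> + \<bar>(1 - z k s) * om' s\<bar>"
      by linarith
    then have "\<bar>F' k s - om' s\<bar> * (1 - s) \<le> (\<bar>z' k s * (p k s - om s)\<bar> + \<bar>z' k s * om s\<bar> + \<bar>z k s * (p' k s - om' s)\<bar> + \<bar>(1 - z k s) * om' s\<bar>) * (1 - s)"
      using s1 by (intro mult_right_mono) auto
    also have "\<dots> = eta k s * \<bar>p k s - om s\<bar> + eta k s * \<bar>om s\<bar> + z k s * \<bar>p' k s - om' s\<bar> * (1 - s) + (1 - z k s) * (\<bar>om' s\<bar> * (1 - s))"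
    proof -
      have "\<bar>z' k s\<bar> * (1 - s) = eta k s" using K[of k] by (simp add: z'_def eta_def abs_mult Psi_def)
      then have "\<bar>z' k s * a\<bar> * (1 - s) = eta k s * \<bar>a\<bar>" for a by (metis abs_mult mult.assoc mult.commute)
      moreover have "\<bar>z k s * a\<bar> = z k s * \<bar>a\<bar>" "\<bar>(1 - z k s) * a\<bar> = (1 - z k s) * \<bar>a\<bar>" for a using z01[of k s] by (auto simp: abs_mult)
      ultimately show ?thesis by (simp add: distrib_right mult.assoc)
    qed
    also have "\<dots> \<le> eta k s * P + eta k s * (C * P) + 1 / K k * P + (1 - z k s) * (C * P)"
    proof -
      have "z k s * \<bar>p' k s - om' s\<bar> * (1 - s) \<le> z k s * \<bar>p' k s - om' s\<bar> * 1"
        using s1 z01[of k s] by (intro mult_left_mono) auto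
      moreover have "eta k s * \<bar>om s\<bar> \<le> eta k s * (C * P)" using omb eta0[of s k] s by (intro mult_left_mono) auto
      moreover have "(1 - z k s) * (\<bar>om' s\<bar> * (1 - s)) \<le> (1 - z k s) * (C * P)"
        using omb z01[of k s] by (intro mult_left_mono) auto
      ultimately show ?thesis using q by linarith
    qed
    also have "\<dots> = B k s * P" by (simp add: B_def algebra_simps)
    finally show ?thesis using 1 by (simp add: P_def)
  qed
  define I where "I k x = ((1 - (norm x)\<^sup>2) / 2)\<^sup>2 * (norm (egrad (phi k) x - (2 * om' (x \<bullet> x)) *\<^sub>R x))\<^sup>2 + (phi k x - om (x \<bullet> x))\<^sup>2" for k and x :: 'a
  have Ieq: "I k x = ((1 - x \<bullet> x) * (F' k (x \<bullet> x) - om' (x \<bullet> x)))\<^sup>2 * (x \<bullet> x) + (F k (x \<bullet> x) - om (x \<bullet> x))\<^sup>2" for k x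
  proof -
    define a b where "a = F' k (x \<bullet> x)" and "b = om' (x \<bullet> x)"
    have "egrad (phi k) x - (2 * b) *\<^sub>R x = (2 * (a - b)) *\<^sub>R x"
      unfolding grad a_def[symmetric] scaleR_diff_left[symmetric] right_diff_distrib ..
    then have "norm (egrad (phi k) x - (2 * b) *\<^sub>R x) = \<bar>2 * (a - b)\<bar> * norm x" by (simp only: norm_scaleR)
    then have "(norm (egrad (phi k) x - (2 * b) *\<^sub>R x))\<^sup>2 = (2 * (a - b))\<^sup>2 * (x \<bullet> x)"
      by (simp only: power_mult_distrib power2_abs power2_norm_eq_inner)
    then have "((1 - (norm x)\<^sup>2) / 2)\<^sup>2 * (norm (egrad (phi k) x - (2 * b) *\<^sub>R x))\<^sup>2
        = ((1 - x \<bullet> x) / 2)\<^sup>2 * ((2 * (a - b))\<^sup>2 * (x \<bullet> x))" by (simp only: power2_norm_eq_inner)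
    also have "\<dots> = ((1 - x \<bullet> x) * (a - b))\<^sup>2 * (x \<bullet> x)" by (simp add: power2_eq_square field_simps)
    finally show ?thesis by (simp only: I_def phi_def a_def b_def)
  qed
  have Ile: "I k x \<le> 2 * (B k (x \<bullet> x))\<^sup>2 * (1 - x \<bullet> x) powr (2 * c)" if x: "x \<in> hyp_ball" for k x
  proof -
    define s where "s = x \<bullet> x"
    have s: "s \<in> {0..<1}" using x by (auto simp: s_def in_hyp_ball)
    have "((1 - s) * (F' k s - om' s))\<^sup>2 = (\<bar>F' k s - om' s\<bar> * (1 - s))\<^sup>2" by (simp add: power_mult_distrib mult.commute)
    also have "\<dots> \<le> (B k s * (1 - s) powr c)\<^sup>2" using E[OF s, of k] s by (intro power_mono) auto
    finally have "((1 - s) * (F' k s - om' s))\<^sup>2 * s \<le> (B k s * (1 - s) powr c)\<^sup>2 * 1" using s by (intro mult_mono) auto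
    moreover have "(F k s - om s)\<^sup>2 \<le> (B k s * (1 - s) powr c)\<^sup>2"
      using E[OF s, of k] power_mono[of "\<bar>F k s - om s\<bar>" "B k s * (1 - s) powr c" 2] by simp
    moreover have "((1 - s) powr c)\<^sup>2 = (1 - s) powr (2 * c)" by (simp add: power2_eq_square powr_add[symmetric])
    ultimately show ?thesis unfolding Ieq s_def[symmetric] by (simp add: power_mult_distrib)
  qed
  have cxx: "continuous_on hyp_ball (\<lambda>x::'a. x \<bullet> x)" by (intro continuous_intros)
  have sub: "(\<lambda>x::'a. x \<bullet> x) ` hyp_ball \<subseteq> {0..<1}" by (auto simp: in_hyp_ball)
  have com: "continuous_on hyp_ball (\<lambda>x::'a. om (x \<bullet> x))" "continuous_on hyp_ball (\<lambda>x::'a. om' (x \<bullet> x))"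
    using continuous_on_compose2[OF cf cxx sub] continuous_on_compose2[OF cf' cxx sub] by auto
  have cPsi: "continuous_on UNIV (Psi j)" for j by (auto intro!: continuous_at_imp_continuous_on DERIV_isCont[OF Psi_deriv])
  have cI: "continuous_on hyp_ball (I k)" for k
  proof -
    have "continuous_on UNIV (F k)" by (auto intro!: continuous_at_imp_continuous_on DERIV_isCont[OF dF])
    then have "continuous_on hyp_ball (\<lambda>x::'a. F k (x \<bullet> x))" by (rule continuous_on_compose2[OF _ cxx]) auto
    moreover have "continuous_on UNIV (F' k)"
    proof -
      have "continuous_on UNIV (p k)" by (auto intro!: continuous_at_imp_continuous_on DERIV_isCont[OF dp])
      moreover have "continuous_on UNIV (\<lambda>s. Psi j (t k s))" for j
        by (rule continuous_on_compose2[OF cPsi]) (auto simp: t_def intro!: continuous_intros)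
      ultimately show ?thesis unfolding F'_def[abs_def] z'_def z_def by (intro continuous_intros cp')
    qed
    then have "continuous_on hyp_ball (\<lambda>x::'a. F' k (x \<bullet> x))" by (rule continuous_on_compose2[OF _ cxx]) auto
    ultimately show ?thesis unfolding Ieq[abs_def] using com by (intro continuous_intros)
  qed
  have "(\<lambda>k. \<integral>\<^sup>+ x. ennreal (I k x) \<partial>hyp_vol) \<longlonglongrightarrow> (\<integral>\<^sup>+ x. 0 \<partial>(hyp_vol :: 'a measure))"
  proof (rule nn_integral_dominated_convergence[where w = "\<lambda>x. ennreal (2 * (4 * (1 + C))\<^sup>2 * (1 - x \<bullet> x) powr (2 * c))"])
    show "(\<lambda>x. ennreal (I k x)) \<in> borel_measurable hyp_vol" for k
      by (intro measurable_compose[OF _ measurable_ennreal] continuous_hyp_measurable cI)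
    show "(\<lambda>x::'a. ennreal (2 * (4 * (1 + C))\<^sup>2 * (1 - x \<bullet> x) powr (2 * c))) \<in> borel_measurable hyp_vol"
      by (intro measurable_compose[OF _ measurable_ennreal] continuous_hyp_measurable continuous_intros) (auto simp: in_hyp_ball)
    show "AE x in hyp_vol. ennreal (I k x) \<le> ennreal (2 * (4 * (1 + C))\<^sup>2 * (1 - x \<bullet> x) powr (2 * c))" for k
    proof (rule AE_I2)
      fix x :: 'a assume "x \<in> space hyp_vol"
      then have x: "x \<in> hyp_ball" by (simp add: space_hyp_vol)
      have "(B k (x \<bullet> x))\<^sup>2 \<le> (4 * (1 + C))\<^sup>2" using B0[of "x \<bullet> x" k] x by (intro power_mono) (auto simp: in_hyp_ball)
      then have "2 * (B k (x \<bullet> x))\<^sup>2 * (1 - x \<bullet> x) powr (2 * c) \<le> 2 * (4 * (1 + C))\<^sup>2 * (1 - x \<bullet> x) powr (2 * c)"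
        by (intro mult_right_mono) auto
      then show "ennreal (I k x) \<le> ennreal (2 * (4 * (1 + C))\<^sup>2 * (1 - x \<bullet> x) powr (2 * c))"
        using Ile[OF x, of k] by (intro ennreal_leI) linarith
    qed
    show "(\<integral>\<^sup>+ x. ennreal (2 * (4 * (1 + C))\<^sup>2 * (1 - (x::'a) \<bullet> x) powr (2 * c)) \<partial>hyp_vol) < \<infinity>"
      by (rule hyp_power_finite[OF c(1)])
    show "AE x in hyp_vol. (\<lambda>k. ennreal (I k (x::'a))) \<longlonglongrightarrow> 0"
    proof (rule AE_I2)
      fix x :: 'a assume "x \<in> space hyp_vol"
      then have x: "x \<in> hyp_ball" by (simp add: space_hyp_vol)
      then have s: "x \<bullet> x < 1" by (simp add: in_hyp_ball)
      have "(\<lambda>k. 2 * (B k (x \<bullet> x))\<^sup>2 * (1 - x \<bullet> x) powr (2 * c)) \<longlonglongrightarrow> 2 * 0\<^sup>2 * (1 - x \<bullet> x) powr (2 * c)"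
        by (intro tendsto_intros B_lim[OF s])
      then have u: "(\<lambda>k. 2 * (B k (x \<bullet> x))\<^sup>2 * (1 - x \<bullet> x) powr (2 * c)) \<longlonglongrightarrow> 0" by simp
      have "(\<lambda>k. I k x) \<longlonglongrightarrow> 0"
        by (rule tendsto_sandwich[OF _ _ tendsto_const u]) (use Ile[OF x] in \<open>auto simp: I_def\<close>)
      then show "(\<lambda>k. ennreal (I k x)) \<longlonglongrightarrow> 0" using tendsto_ennrealI by fastforce
    qed
  qed auto
  then have lim: "(\<lambda>k. \<integral>\<^sup>+ x. ennreal (I k x) \<partial>(hyp_vol :: 'a measure)) \<longlonglongrightarrow> 0" by simp
  show ?thesis unfolding H1_with_grad_def
  proof (intro conjI exI[of _ phi])
    show "(\<lambda>x::'a. om (x \<bullet> x)) \<in> borel_measurable hyp_vol" by (rule continuous_hyp_measurable[OF com(1)])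
    show "(\<lambda>x::'a. (2 * om' (x \<bullet> x)) *\<^sub>R x) \<in> borel_measurable hyp_vol"
      by (intro continuous_hyp_measurable continuous_intros com(2))
  qed (use test lim in \<open>auto simp: I_def[abs_def]\<close>)
qed

section \<open>The weak equation for radial fields\<close>

lemma integral_translation:
  fixes F :: "'a::euclidean_space \<Rightarrow> real"
  assumes "integrable lborel F"
  shows "integrable lborel (\<lambda>x. F (c + x))" "(\<integral>x. F (c + x) \<partial>lborel) = (\<integral>x. F x \<partial>lborel)"
proof -
  have m: "F \<in> borel_measurable borel" using assms by (simp add: borel_measurable_integrable)
  have i: "integrable (distr lborel borel ((+) c)) F" unfolding lborel_distr_plus by (rule assms)
  then show "integrable lborel (\<lambda>x. F (c + x))"
    by (subst (asm) integrable_distr_eq) (use m in auto)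
  have "(\<integral>x. F x \<partial>lborel) = (\<integral>x. F x \<partial>distr lborel borel ((+) c))" by (simp only: lborel_distr_plus)
  also have "\<dots> = (\<integral>x. F (c + x) \<partial>lborel)" by (rule integral_distr) (use m in auto)
  finally show "(\<integral>x. F (c + x) \<partial>lborel) = (\<integral>x. F x \<partial>lborel)" by simp
qed

text \<open>Difference quotients integrate to zero by translation invariance; dominated convergence
  passes this to the derivative.\<close>

lemma integral_directional_derivative:
  fixes F F' :: "'a::euclidean_space \<Rightarrow> real"
  assumes d: "\<And>x. ((\<lambda>t. F (x + t *\<^sub>R b)) has_real_derivative F' x) (at 0)"
    and bd: "\<And>x. \<bar>F' x\<bar> \<le> C" and supp: "\<And>x. norm x \<ge> 1 \<Longrightarrow> F x = 0"
    and int: "integrable lborel F" and b: "norm b = 1"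
  shows "integrable lborel F'" "(\<integral>x. F' x \<partial>lborel) = 0"
proof -
  define h where "h n = inverse (real (Suc n))" for n
  have h: "h n > 0" "h n \<le> 1" for n by (auto simp: h_def inverse_le_1_iff)
  define D where "D n x = (F (x + h n *\<^sub>R b) - F x) / h n" for n x
  have m: "F \<in> borel_measurable borel" using int by (simp add: borel_measurable_integrable)
  have mD: "D n \<in> borel_measurable lborel" for n
    unfolding D_def using m by measurable
  have lim: "(\<lambda>n. D n x) \<longlonglongrightarrow> F' x" for x
  proof -
    have "((\<lambda>t. (F (x + t *\<^sub>R b) - F x) / t) \<longlongrightarrow> F' x) (at 0)" using d[of x] by (simp add: DERIV_def)
    moreover have "filterlim h (at 0) sequentially"
      unfolding filterlim_at using LIMSEQ_inverse_real_of_nat h by (auto simp: h_def[abs_def])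
    ultimately show ?thesis unfolding D_def by (rule filterlim_compose)
  qed
  have bdD: "\<bar>D n x\<bar> \<le> C" for n x
  proof -
    have dt: "((\<lambda>t. F (x + t *\<^sub>R b)) has_real_derivative F' (x + t *\<^sub>R b)) (at t)" for t
    proof -
      have "((\<lambda>s. F (x + (s + t) *\<^sub>R b)) has_real_derivative F' (x + t *\<^sub>R b)) (at 0)"
        using d[of "x + t *\<^sub>R b"] by (simp add: scaleR_add_left algebra_simps)
      then show ?thesis using DERIV_shift[of "\<lambda>t. F (x + t *\<^sub>R b)" _ 0 t] by simp
    qed
    obtain s where "F (x + h n *\<^sub>R b) - F (x + 0 *\<^sub>R b) = (h n - 0) * F' (x + s *\<^sub>R b)"
      using MVT2[of 0 "h n" "\<lambda>t. F (x + t *\<^sub>R b)" "\<lambda>t. F' (x + t *\<^sub>R b)"] dt h[of n] by auto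
    then have "D n x = F' (x + s *\<^sub>R b)" using h[of n] by (simp add: D_def)
    then show ?thesis using bd by simp
  qed
  have C: "C \<ge> 0" using bd[of 0] by linarith
  have dom: "norm (D n x) \<le> C * indicator (cball 0 2) x" for n x
  proof (cases "x \<in> cball 0 2")
    case False
    then have "norm x > 2" by simp
    moreover have "norm x \<le> norm (x + h n *\<^sub>R b) + norm (h n *\<^sub>R b)" using norm_triangle_ineq4[of "x + h n *\<^sub>R b" "h n *\<^sub>R b"] by simp
    moreover have "norm (h n *\<^sub>R b) \<le> 1" using h[of n] b by simp
    ultimately have "D n x = 0" unfolding D_def by (simp add: supp)
    then show ?thesis using C by simp
  qed (use bdD in simp)
  have iw: "integrable lborel (\<lambda>x::'a. C * indicator (cball 0 2) x)"
    using emeasure_bounded_finite[of "cball 0 2 :: 'a set"]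
    by (intro integrable_mult_right integrable_real_indicator) auto
  have m': "F' \<in> borel_measurable lborel" by (rule borel_measurable_LIMSEQ_real[OF lim mD])
  show "integrable lborel F'"
    by (rule integrable_dominated_convergence[where s = D, OF m' mD iw]) (use lim dom in auto)
  have "(\<lambda>n. \<integral>x. D n x \<partial>lborel) \<longlonglongrightarrow> (\<integral>x. F' x \<partial>lborel)"
    by (rule integral_dominated_convergence[where s = D, OF m' mD iw]) (use lim dom in auto)
  moreover have "(\<integral>x. D n x \<partial>lborel) = 0" for n
  proof -
    have "integrable lborel (\<lambda>x. F (x + h n *\<^sub>R b))" "(\<integral>x. F (x + h n *\<^sub>R b) \<partial>lborel) = (\<integral>x. F x \<partial>lborel)"
      using integral_translation[OF int, of "h n *\<^sub>R b"] by (simp_all add: add.commute)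
    then show ?thesis using int by (simp add: D_def)
  qed
  ultimately have "(\<lambda>n. 0) \<longlonglongrightarrow> (\<integral>x. F' x \<partial>lborel)" by simp
  then show "(\<integral>x. F' x \<partial>lborel) = 0" by (simp add: LIMSEQ_const_iff)
qed

text \<open>Off its support a test function is locally zero, so it is differentiable on the whole
  space; this permits integration over all of \<open>lborel\<close>.\<close>

lemma test_fun_facts:
  fixes \<phi> :: "'a::euclidean_space \<Rightarrow> real"
  assumes "test_fun \<phi>"
  obtains K where "compact K" "K \<subseteq> hyp_ball" "\<And>x. x \<notin> K \<Longrightarrow> \<phi> x = 0"
    "\<And>x. x \<notin> K \<Longrightarrow> frechet_derivative \<phi> (at x) = (\<lambda>_. 0)"
    "continuous_on hyp_ball \<phi>" "\<And>v. continuous_on hyp_ball (\<lambda>x. frechet_derivative \<phi> (at x) v)"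
    "\<And>x. (\<phi> has_derivative frechet_derivative \<phi> (at x)) (at x)"
proof -
  define K where "K = closure {x. \<phi> x \<noteq> 0}"
  have s: "smooth_on hyp_ball \<phi>" and K: "compact K" "K \<subseteq> hyp_ball" using assms by (auto simp: test_fun_def K_def)
  have z: "\<phi> x = 0" if "x \<notin> K" for x using that closure_subset[of "{x. \<phi> x \<noteq> 0}"] by (auto simp: K_def)
  have zd: "(\<phi> has_derivative (\<lambda>_. 0)) (at x)" if "x \<notin> K" for x
  proof (rule has_derivative_transform_within_open[of "\<lambda>_. 0" _ _ _ "- K"])
    show "((\<lambda>_. 0::real) has_derivative (\<lambda>_. 0)) (at x)" by simp
  qed (use that z K(1) in \<open>auto simp: compact_imp_closed open_Compl\<close>)
  have o: "open (hyp_ball :: 'a set)" by (simp add: hyp_ball_def)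
  from s have c: "continuous_on hyp_ball \<phi>" "\<phi> differentiable_on hyp_ball"
    and c': "\<And>v. smooth_on hyp_ball (\<lambda>x. frechet_derivative \<phi> (at x) v)"
    by (auto elim: smooth_on.cases)
  have c'': "continuous_on hyp_ball (\<lambda>x. frechet_derivative \<phi> (at x) v)" for v
    using c'[of v] by (auto elim: smooth_on.cases)
  have "(\<phi> has_derivative frechet_derivative \<phi> (at x)) (at x)" for x
  proof (cases "x \<in> K")
    case True
    then have "\<phi> differentiable at x" using c(2) K(2) o by (meson differentiable_on_eq_differentiable_at subsetD)
    then show ?thesis by (simp add: frechet_derivative_works)
  next
    case False
    then show ?thesis using zd frechet_derivative_at by metis
  qed
  moreover have "frechet_derivative \<phi> (at x) = (\<lambda>_. 0)" if "x \<notin> K" for x using frechet_derivative_at[OF zd[OF that]] by simp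
  ultimately show ?thesis using that[of K] K z c(1) c'' by blast
qed

text \<open>The assumption \<open>ode\<close> says that the field Zf (|x|^2) x has divergence ka
  (|x|^2). The integrand is the divergence of \<phi> times this field, the sum over b of the
  derivative \<open>F' b\<close> of its b-component in direction b.\<close>

lemma radial_divergence:
  fixes \<phi> :: "'a::euclidean_space \<Rightarrow> real" and Zf Zf' ka :: "real \<Rightarrow> real"
  assumes cZ: "continuous_on {0..<1} Zf" and ck: "continuous_on {0..<1} ka"
    and dZ: "\<And>s. s \<in> {0<..<1} \<Longrightarrow> (Zf has_real_derivative Zf' s) (at s)"
    and ode: "\<And>s. s \<in> {0..<1} \<Longrightarrow> 2 * s * Zf' s + real DIM('a) * Zf s = ka s"
    and test: "test_fun \<phi>"
  shows "(\<integral>x. Zf (x \<bullet> x) * (x \<bullet> egrad \<phi> x) + ka (x \<bullet> x) * \<phi> x \<partial>lborel) = 0"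
proof -
  obtain K where K: "compact K" "K \<subseteq> (hyp_ball :: 'a set)" and z: "\<And>x. x \<notin> K \<Longrightarrow> \<phi> x = 0"
    and zd: "\<And>x. x \<notin> K \<Longrightarrow> frechet_derivative \<phi> (at x) = (\<lambda>_. 0)"
    and c\<phi>: "continuous_on hyp_ball \<phi>" and cD: "\<And>v. continuous_on hyp_ball (\<lambda>x. frechet_derivative \<phi> (at x) v)"
    and d\<phi>: "\<And>x. (\<phi> has_derivative frechet_derivative \<phi> (at x)) (at x)"
    using test_fun_facts[OF test] by metis
  define F where "F b x = \<phi> x * (Zf (x \<bullet> x) * (x \<bullet> b))" for b x :: 'a
  define F' where "F' b x = frechet_derivative \<phi> (at x) b * (Zf (x \<bullet> x) * (x \<bullet> b))
      + \<phi> x * (Zf (x \<bullet> x) + 2 * Zf' (x \<bullet> x) * (x \<bullet> b)\<^sup>2)" for b x :: 'a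
  have KS: "x \<bullet> x \<in> {0..<1}" if "x \<in> K" for x using K(2) that by (auto simp: in_hyp_ball)
  have cxx: "continuous_on K (\<lambda>x::'a. x \<bullet> x)" by (intro continuous_intros)
  have cZK: "continuous_on K (\<lambda>x. Zf (x \<bullet> x))" and ckK: "continuous_on K (\<lambda>x. ka (x \<bullet> x))"
    by (rule continuous_on_compose2[OF cZ cxx] continuous_on_compose2[OF ck cxx]; use KS in auto)+
  have c\<phi>K: "continuous_on K \<phi>" and cDK: "\<And>v. continuous_on K (\<lambda>x. frechet_derivative \<phi> (at x) v)"
    using c\<phi> cD K(2) by (auto intro: continuous_on_subset)
  have bnd: "\<exists>C. \<forall>x\<in>K. \<bar>f x\<bar> \<le> C" if "continuous_on K f" for f :: "'a \<Rightarrow> real"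
    using compact_imp_bounded[OF compact_continuous_image[OF that K(1)]] unfolding bounded_iff by fastforce
  have dF: "((\<lambda>t. F b (x + t *\<^sub>R b)) has_real_derivative F' b x) (at 0)" if b: "b \<in> Basis" for b x
  proof -
    have bb: "b \<bullet> b = 1" using b by (simp add: inner_same_Basis)
    have dl: "((\<lambda>t. \<phi> (x + t *\<^sub>R b)) has_real_derivative frechet_derivative \<phi> (at x) b) (at 0)"
    proof -
      have "((\<lambda>t. x + t *\<^sub>R b) has_derivative (\<lambda>h. h *\<^sub>R b)) (at 0)" by (auto intro!: derivative_eq_intros)
      moreover have "(\<phi> has_derivative frechet_derivative \<phi> (at x)) (at (x + 0 *\<^sub>R b))" using d\<phi>[of x] by simp
      ultimately have "((\<lambda>t. \<phi> (x + t *\<^sub>R b)) has_derivative (\<lambda>h. frechet_derivative \<phi> (at x) (h *\<^sub>R b))) (at 0)"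
        by (rule has_derivative_compose)
      moreover have "frechet_derivative \<phi> (at x) (h *\<^sub>R b) = frechet_derivative \<phi> (at x) b * h" for h
        using linear_cmul[OF has_derivative_linear[OF d\<phi>[of x]], of h b] by (simp add: mult.commute)
      ultimately show ?thesis by (simp add: has_field_derivative_def)
    qed
    show ?thesis
    proof (cases "x \<in> K")
      case False
      have "open (- K)" using K(1) by (simp add: compact_imp_closed open_Compl)
      then have "\<forall>\<^sub>F y in nhds x. y \<in> - K" by (rule eventually_nhds_in_open) (use False in simp)
      moreover have "((\<lambda>t. x + t *\<^sub>R b) \<longlongrightarrow> x + 0 *\<^sub>R b) (nhds (0::real))"
        by (intro tendsto_intros filterlim_ident)
      then have "((\<lambda>t. x + t *\<^sub>R b) \<longlongrightarrow> x) (nhds (0::real))" by simp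
      ultimately have "\<forall>\<^sub>F t in nhds 0. x + t *\<^sub>R b \<in> - K" by (rule eventually_compose_filterlim)
      then have "\<forall>\<^sub>F t in nhds 0. F b (x + t *\<^sub>R b) = 0" by eventually_elim (simp add: F_def z)
      then have "((\<lambda>t. F b (x + t *\<^sub>R b)) has_real_derivative 0) (at 0)"
        by (subst DERIV_cong_ev[OF refl _ refl]) auto
      moreover have "F' b x = 0" using False by (simp add: F'_def z zd)
      ultimately show ?thesis by simp
    next
      case True
      show ?thesis
      proof (cases "x = 0")
        case False
        then have s: "x \<bullet> x \<in> {0<..<1}" using KS[OF True] by auto
        have q: "((\<lambda>t. (x + t *\<^sub>R b) \<bullet> (x + t *\<^sub>R b)) has_real_derivative 2 * (x \<bullet> b)) (at 0)"
        proof -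
          have "(\<lambda>t. (x + t *\<^sub>R b) \<bullet> (x + t *\<^sub>R b)) = (\<lambda>t. x \<bullet> x + 2 * (x \<bullet> b) * t + t\<^sup>2)"
            by (auto simp: inner_add_left inner_add_right bb inner_commute power2_eq_square algebra_simps)
          then show ?thesis by (auto intro!: derivative_eq_intros)
        qed
        have l: "((\<lambda>t. (x + t *\<^sub>R b) \<bullet> b) has_real_derivative 1) (at 0)"
        proof -
          have "(\<lambda>t. (x + t *\<^sub>R b) \<bullet> b) = (\<lambda>t. x \<bullet> b + t)" by (auto simp: inner_add_left bb)
          then show ?thesis by (auto intro!: derivative_eq_intros)
        qed
        have Z: "((\<lambda>t. Zf ((x + t *\<^sub>R b) \<bullet> (x + t *\<^sub>R b))) has_real_derivative Zf' (x \<bullet> x) * (2 * (x \<bullet> b))) (at 0)"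
          using DERIV_chain2[of Zf "Zf' (x \<bullet> x)" "\<lambda>t. (x + t *\<^sub>R b) \<bullet> (x + t *\<^sub>R b)" 0, OF _ q] dZ[OF s] by simp
        show ?thesis unfolding F_def F'_def
          by (rule DERIV_cong[OF DERIV_mult[OF dl DERIV_mult[OF Z l]]]) (simp add: power2_eq_square algebra_simps)
      next
        case x0: True
        \<comment> \<open>At the origin \<open>Zf\<close> is only continuous, but the factor x
          \<bullet> b vanishes there, so the difference quotient is \<phi> times \<open>Zf\<close>
          itself.\<close>
        have "((\<lambda>h. \<phi> (h *\<^sub>R b) * Zf (h\<^sup>2)) \<longlongrightarrow> \<phi> 0 * Zf 0) (at 0)"
        proof (intro tendsto_mult)
          have "isCont \<phi> 0" using d\<phi>[of 0] by (rule has_derivative_continuous)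
          moreover have "((\<lambda>h. h *\<^sub>R b) \<longlongrightarrow> 0) (at (0::real))" by (auto intro!: tendsto_eq_intros)
          ultimately show "((\<lambda>h. \<phi> (h *\<^sub>R b)) \<longlongrightarrow> \<phi> 0) (at 0)" by (rule isCont_tendsto_compose)
          have "(Zf \<longlongrightarrow> Zf 0) (at 0 within {0..<1})" using cZ by (auto simp: continuous_on_def)
          moreover have "filterlim (\<lambda>h::real. h\<^sup>2) (at 0 within {0..<1}) (at 0)"
            unfolding filterlim_at
          proof
            show "((\<lambda>h::real. h\<^sup>2) \<longlongrightarrow> 0) (at 0)" by (auto intro!: tendsto_eq_intros)
            have "\<forall>\<^sub>F h in at (0::real). h \<noteq> 0 \<and> \<bar>h\<bar> < 1"
              unfolding eventually_at by (rule exI[of _ 1]) (auto simp: dist_real_def)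
            then show "\<forall>\<^sub>F h in at (0::real). h\<^sup>2 \<in> {0..<1} \<and> h\<^sup>2 \<noteq> 0"
              by eventually_elim (auto simp: abs_square_less_1)
          qed
          ultimately show "((\<lambda>h. Zf (h\<^sup>2)) \<longlongrightarrow> Zf 0) (at 0)" by (rule filterlim_compose)
        qed
        moreover have "\<forall>\<^sub>F h in at 0. \<phi> (h *\<^sub>R b) * Zf (h\<^sup>2) = (F b (0 + h *\<^sub>R b) - F b 0) / h"
          by (auto simp: eventually_at_filter F_def bb power2_eq_square)
        ultimately have "((\<lambda>h. (F b (0 + h *\<^sub>R b) - F b 0) / h) \<longlongrightarrow> \<phi> 0 * Zf 0) (at 0)"
          by (rule Lim_transform_eventually)
        then show ?thesis using x0 by (simp add: DERIV_def F'_def)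
      qed
    qed
  qed
  obtain C1 where C1: "\<And>x. x \<in> K \<Longrightarrow> \<bar>\<phi> x\<bar> \<le> C1" using bnd[OF c\<phi>K] by blast
  obtain C2 where C2: "\<And>x. x \<in> K \<Longrightarrow> \<bar>Zf (x \<bullet> x)\<bar> \<le> C2" using bnd[OF cZK] by blast
  obtain C3 where C3: "\<And>x. x \<in> K \<Longrightarrow> \<bar>ka (x \<bullet> x)\<bar> \<le> C3" using bnd[OF ckK] by blast
  have F'b: "\<exists>C. \<forall>x. \<bar>F' b x\<bar> \<le> C" if b: "b \<in> Basis" for b
  proof -
    obtain C4 where C4: "\<And>x. x \<in> K \<Longrightarrow> \<bar>frechet_derivative \<phi> (at x) b\<bar> \<le> C4" using bnd[OF cDK] by blast
    define C where "C = \<bar>C4\<bar> * (\<bar>C2\<bar> * 1) + \<bar>C1\<bar> * (\<bar>C2\<bar> + (\<bar>C3\<bar> + real DIM('a) * \<bar>C2\<bar>))"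
    have "\<bar>F' b x\<bar> \<le> C" for x
    proof (cases "x \<in> K")
      case True
      define s where "s = x \<bullet> x"
      have s: "s \<in> {0..<1}" using KS[OF True] by (simp add: s_def)
      have xb: "(x \<bullet> b)\<^sup>2 \<le> s"
      proof -
        have "\<bar>x \<bullet> b\<bar> \<le> norm x" using Basis_le_norm[OF b] .
        then have "\<bar>x \<bullet> b\<bar>\<^sup>2 \<le> (norm x)\<^sup>2" by (intro power_mono) auto
        then show ?thesis by (simp add: s_def power2_norm_eq_inner)
      qed
      have xb1: "\<bar>x \<bullet> b\<bar> \<le> 1" using xb s by (simp add: abs_square_le_1[symmetric])
      \<comment> \<open>\<open>Zf'\<close> may be unbounded near s = 0; it enters only with a factor
        at most s, and 2 s Zf' is bounded through \<open>ode\<close>.\<close>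
      have "\<bar>2 * Zf' s * (x \<bullet> b)\<^sup>2\<bar> \<le> \<bar>2 * Zf' s\<bar> * s" using xb by (simp add: abs_mult mult_left_mono)
      also have "\<dots> = \<bar>2 * s * Zf' s\<bar>" using s by (simp add: abs_mult)
      also have "2 * s * Zf' s = ka s - real DIM('a) * Zf s" using ode[OF s] by simp
      also have "\<bar>\<dots>\<bar> \<le> \<bar>ka s\<bar> + real DIM('a) * \<bar>Zf s\<bar>" by (rule order_trans[OF abs_triangle_ineq4]) (simp add: abs_mult)
      also have "\<dots> \<le> \<bar>C3\<bar> + real DIM('a) * \<bar>C2\<bar>" using C2[OF True] C3[OF True] by (intro add_mono mult_left_mono) (auto simp: s_def)
      finally have 1: "\<bar>2 * Zf' s * (x \<bullet> b)\<^sup>2\<bar> \<le> \<bar>C3\<bar> + real DIM('a) * \<bar>C2\<bar>" .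
      have "\<bar>F' b x\<bar> \<le> \<bar>frechet_derivative \<phi> (at x) b\<bar> * (\<bar>Zf s\<bar> * \<bar>x \<bullet> b\<bar>) + \<bar>\<phi> x\<bar> * (\<bar>Zf s\<bar> + \<bar>2 * Zf' s * (x \<bullet> b)\<^sup>2\<bar>)"
      proof -
        have "\<bar>F' b x\<bar> \<le> \<bar>frechet_derivative \<phi> (at x) b * (Zf s * (x \<bullet> b))\<bar> + \<bar>\<phi> x * (Zf s + 2 * Zf' s * (x \<bullet> b)\<^sup>2)\<bar>"
          unfolding F'_def s_def[symmetric] by (rule abs_triangle_ineq)
        also have "\<bar>\<phi> x * (Zf s + 2 * Zf' s * (x \<bullet> b)\<^sup>2)\<bar> \<le> \<bar>\<phi> x\<bar> * (\<bar>Zf s\<bar> + \<bar>2 * Zf' s * (x \<bullet> b)\<^sup>2\<bar>)"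
          unfolding abs_mult[of "\<phi> x"] by (intro mult_left_mono abs_triangle_ineq) simp
        finally show ?thesis by (simp add: abs_mult)
      qed
      also have "\<dots> \<le> C" unfolding C_def
        using C1[OF True] C2[OF True] C4[OF True] 1 xb1 by (intro add_mono mult_mono) (auto simp: s_def)
      finally show ?thesis .
    next
      case False
      then have "F' b x = 0" by (simp add: F'_def z zd)
      moreover have "C \<ge> 0" by (simp add: C_def)
      ultimately show ?thesis by simp
    qed
    then show ?thesis by blast
  qed
  have FI: "integrable lborel (F b)" for b
  proof -
    have "continuous_on K (F b)" unfolding F_def by (intro continuous_intros c\<phi>K cZK)
    from borel_integrable_compact[OF K(1) this] show ?thesis
      by (rule Bochner_Integration.integrable_cong[THEN iffD1, rotated -1]) (auto simp: F_def z indicator_def)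
  qed
  have Fs: "F b x = 0" if "norm x \<ge> 1" for b x
  proof -
    have "x \<notin> K" using K(2) that by (auto simp: hyp_ball_def)
    then show ?thesis by (simp add: F_def z)
  qed
  have r: "integrable lborel (F' b)" "(\<integral>x. F' b x \<partial>lborel) = 0" if b: "b \<in> Basis" for b
  proof -
    obtain C where "\<And>x. \<bar>F' b x\<bar> \<le> C" using F'b[OF b] by blast
    then show "integrable lborel (F' b)" "(\<integral>x. F' b x \<partial>lborel) = 0"
      using integral_directional_derivative[OF dF[OF b] _ Fs FI] b by (auto simp: norm_Basis)
  qed
  have "(\<Sum>b\<in>Basis. F' b x) = Zf (x \<bullet> x) * (x \<bullet> egrad \<phi> x) + ka (x \<bullet> x) * \<phi> x" for x
  proof -
    have "(\<Sum>b\<in>Basis. F' b x) = Zf (x \<bullet> x) * (\<Sum>b\<in>Basis. frechet_derivative \<phi> (at x) b * (x \<bullet> b))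
        + \<phi> x * (real DIM('a) * Zf (x \<bullet> x) + 2 * Zf' (x \<bullet> x) * (\<Sum>b\<in>Basis. (x \<bullet> b)\<^sup>2))"
      by (simp add: F'_def sum.distrib sum_distrib_left distrib_left mult_ac)
    also have "(\<Sum>b\<in>Basis. (x \<bullet> b)\<^sup>2) = x \<bullet> x" by (subst euclidean_inner[of x x]) (simp add: power2_eq_square)
    also have "(\<Sum>b\<in>Basis. frechet_derivative \<phi> (at x) b * (x \<bullet> b)) = x \<bullet> egrad \<phi> x"
      by (simp add: egrad_def inner_sum_right)
    also have "\<phi> x * (real DIM('a) * Zf (x \<bullet> x) + 2 * Zf' (x \<bullet> x) * (x \<bullet> x)) = ka (x \<bullet> x) * \<phi> x"
    proof (cases "x \<in> K")
      case True
      then show ?thesis using ode[OF KS[OF True]] by (simp add: algebra_simps)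
    qed (simp add: z)
    finally show ?thesis .
  qed
  then have "(\<integral>x. Zf (x \<bullet> x) * (x \<bullet> egrad \<phi> x) + ka (x \<bullet> x) * \<phi> x \<partial>lborel) = (\<integral>x. (\<Sum>b\<in>Basis. F' b x) \<partial>lborel)" by simp
  also have "\<dots> = (\<Sum>b\<in>Basis. \<integral>x. F' b x \<partial>lborel)" by (rule Bochner_Integration.integral_sum) (use r in auto)
  also have "\<dots> = 0" by (simp add: r)
  finally show ?thesis .
qed

lemma hyp_integral_compact:
  fixes f :: "'a::euclidean_space \<Rightarrow> real"
  assumes c: "continuous_on hyp_ball f" and K: "compact K" "K \<subseteq> hyp_ball" and z: "\<And>x. x \<notin> K \<Longrightarrow> f x = 0"
  shows "integrable hyp_vol f" "integrable lborel (\<lambda>x. hyp_conf x ^ DIM('a) * f x)"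
    "(\<integral>x. f x \<partial>hyp_vol) = (\<integral>x. hyp_conf x ^ DIM('a) * f x \<partial>lborel)"
proof -
  let ?g = "\<lambda>x. hyp_conf x ^ DIM('a) * f x"
  have "continuous_on K ?g" using K(2) c hyp_conf_continuous
    by (intro continuous_intros) (auto intro: continuous_on_subset)
  from borel_integrable_compact[OF K(1) this] show g: "integrable lborel ?g"
    by (rule Bochner_Integration.integrable_cong[THEN iffD1, rotated -1]) (auto simp: z indicator_def)
  then have gm: "?g \<in> borel_measurable lborel" by (rule borel_measurable_integrable)
  have gl: "integrable lebesgue ?g" "(\<integral>x. ?g x \<partial>lebesgue) = (\<integral>x. ?g x \<partial>lborel)"
    using g integrable_completion[OF gm] integral_completion[OF gm] by auto
  have fm: "f \<in> borel_measurable (lebesgue_on hyp_ball)"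
    by (rule continuous_imp_measurable_on_sets_lebesgue[OF c hyp_ball_sets])
  have nn: "AE x in lebesgue_on (hyp_ball::'a set). 0 \<le> hyp_conf x ^ DIM('a)"
    by (rule AE_I2) (auto intro!: zero_le_power less_imp_le[OF hyp_conf_pos])
  have e: "(\<lambda>x. indicator hyp_ball x *\<^sub>R (hyp_conf x ^ DIM('a) *\<^sub>R f x)) = ?g"
    using K(2) z by (auto simp: fun_eq_iff indicator_def)
  have s: "(hyp_ball::'a set) \<inter> space lebesgue \<in> sets lebesgue" using hyp_ball_sets by simp
  show "integrable hyp_vol f"
    unfolding hyp_vol_def integrable_density[OF fm hyp_conf_power_measurable nn] integrable_restrict_space[OF s] e by (rule gl)
  show "(\<integral>x. f x \<partial>hyp_vol) = (\<integral>x. ?g x \<partial>lborel)"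
    unfolding hyp_vol_def integral_density[OF fm hyp_conf_power_measurable nn] integral_restrict_space[OF s] e by (rule gl)
qed

section \<open>From radial solutions to weak solutions\<close>

text \<open>On the ball the conformal factor is at least 1, so hyperbolic volume dominates Lebesgue
  measure.\<close>

lemma open_hyp_vol_pos:
  fixes S :: "'a::euclidean_space set"
  assumes "open S" "S \<noteq> {}" "S \<subseteq> hyp_ball"
  shows "S \<in> sets hyp_vol" "emeasure hyp_vol S > 0"
proof -
  have Sl: "S \<in> sets lebesgue" using assms(1) by simp
  have Sr: "S \<in> sets (lebesgue_on hyp_ball)" using Sl assms(3) hyp_ball_sets by (simp add: sets_restrict_space_iff)
  then show "S \<in> sets hyp_vol" by (simp add: hyp_vol_def)
  obtain x e where x: "e > 0" "ball x e \<subseteq> S" using assms(1,2) by (meson ex_in_conv openE)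
  have "measure lborel (ball x e) \<noteq> 0" using content_ball_pos[OF x(1), of x] by simp
  then have "0 < emeasure lborel (ball x e)" by (metis measure_eq_0_null_sets null_setsI sets_lborel borel_open open_ball not_gr_zero)
  also have "\<dots> = emeasure lebesgue (ball x e)" by simp
  also have "\<dots> \<le> emeasure lebesgue S" using x Sl by (intro emeasure_mono) auto
  also have "\<dots> = emeasure (lebesgue_on hyp_ball) S"
    using assms(3) hyp_ball_sets by (subst emeasure_restrict_space) auto
  also have "\<dots> = (\<integral>\<^sup>+ x. indicator S x \<partial>lebesgue_on hyp_ball)" using Sr by simp
  also have "\<dots> \<le> (\<integral>\<^sup>+ x. ennreal (hyp_conf x ^ DIM('a)) * indicator S x \<partial>lebesgue_on hyp_ball)"
  proof (rule nn_integral_mono)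
    fix x :: 'a assume "x \<in> space (lebesgue_on hyp_ball)"
    then have "x \<bullet> x < 1" by (simp add: in_hyp_ball)
    then have "1 \<le> hyp_conf x" by (simp add: hyp_conf_def power2_norm_eq_inner field_simps)
    then have "1 \<le> hyp_conf x ^ DIM('a)" by (rule one_le_power)
    then show "indicator S x \<le> ennreal (hyp_conf x ^ DIM('a)) * indicator S x" by (auto simp: indicator_def)
  qed
  also have "\<dots> = emeasure hyp_vol S" unfolding hyp_vol_def
    by (rule emeasure_density[symmetric]) (use Sr in auto)
  finally show "emeasure hyp_vol S > 0" .
qed

text \<open>The hyperbolic distance to the origin in terms of s = |x|^2: sinh r = 2 |x| / (1 -
  |x|^2).\<close>

definition rr :: "real \<Rightarrow> real" where "rr s = arsinh (2 * sqrt s / (1 - s))"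

lemma rr_0: "rr 0 = 0" by (simp add: rr_def)

lemma sinh_rr: "sinh (rr s) = 2 * sqrt s / (1 - s)" by (simp add: rr_def)

lemma rr_nonneg: "0 \<le> s \<Longrightarrow> s < 1 \<Longrightarrow> rr s \<ge> 0" by (simp add: rr_def arsinh_real_nonneg)

lemma rr_pos: "0 < s \<Longrightarrow> s < 1 \<Longrightarrow> rr s > 0" by (simp add: rr_def)

lemma cosh_rr: assumes "0 \<le> s" "s < 1" shows "cosh (rr s) = (1 + s) / (1 - s)"
proof -
  have "cosh (rr s) = sqrt ((2 * sqrt s / (1 - s))\<^sup>2 + 1)" by (simp only: rr_def cosh_arsinh_real)
  also have "(2 * sqrt s / (1 - s))\<^sup>2 + 1 = ((1 + s) / (1 - s))\<^sup>2"
    using assms by (simp add: power_divide power_mult_distrib divide_simps) (simp add: power2_eq_square algebra_simps)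
  also have "sqrt \<dots> = (1 + s) / (1 - s)" using assms by simp
  finally show ?thesis .
qed

text \<open>With a = sqrt s the left side is (1 - a)^2 / (1 - s), while (1 - s)^2 = (1 - a)^2 (1 +
  a)^2. It turns exponential decay in r into powers of 1 - s.\<close>

lemma exp_minus_rr: assumes "0 \<le> s" "s < 1" shows "exp (- rr s) \<le> 1 - s"
proof -
  have "exp (- rr s) = cosh (rr s) - sinh (rr s)" by (simp add: cosh_field_def sinh_field_def field_simps)
  also have "\<dots> = (1 + s - 2 * sqrt s) / (1 - s)" using assms by (simp add: cosh_rr sinh_rr diff_divide_distrib)
  also have "\<dots> \<le> 1 - s"
  proof -
    have s1: "sqrt s < 1" "0 \<le> sqrt s" using assms by auto
    have s2: "s = (sqrt s)\<^sup>2" using assms by simp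
    have "1 + s - 2 * sqrt s = (1 - sqrt s)\<^sup>2" by (subst s2) (simp add: power2_eq_square algebra_simps)
    moreover have "(1 - s) * (1 - s) = (1 - sqrt s)\<^sup>2 * (1 + sqrt s)\<^sup>2"
      by (subst (1 2) s2) (simp add: power2_eq_square algebra_simps)
    moreover have "(1 - sqrt s)\<^sup>2 * 1 \<le> (1 - sqrt s)\<^sup>2 * (1 + sqrt s)\<^sup>2" using s1 by (intro mult_left_mono one_le_power) auto
    ultimately have "1 + s - 2 * sqrt s \<le> (1 - s) * (1 - s)" by simp
    then show ?thesis using assms by (simp add: divide_le_eq)
  qed
  finally show ?thesis .
qed

lemma rr_continuous: "continuous_on {0..<1} rr"
  unfolding rr_def[abs_def] by (intro continuous_intros) auto

lemma rr_deriv: assumes "0 < s" "s < 1" shows "(rr has_real_derivative 1 / (sqrt s * (1 - s))) (at s)"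
proof -
  have q: "((\<lambda>s. 2 * sqrt s / (1 - s)) has_real_derivative (1 + s) / (sqrt s * (1 - s)\<^sup>2)) (at s)"
  proof -
    have "((\<lambda>s. 2 * sqrt s / (1 - s)) has_real_derivative
        (2 * (inverse (sqrt s) / 2) * (1 - s) - 2 * sqrt s * (0 - 1)) / ((1 - s) * (1 - s))) (at s)"
      using assms by (intro DERIV_divide DERIV_cmult DERIV_real_sqrt DERIV_diff DERIV_const DERIV_ident) auto
    moreover have "(2 * (inverse (sqrt s) / 2) * (1 - s) - 2 * sqrt s * (0 - 1)) / ((1 - s) * (1 - s)) = (1 + s) / (sqrt s * (1 - s)\<^sup>2)"
      using assms by (simp add: divide_simps power2_eq_square)
    ultimately show ?thesis by simp
  qed
  have "(rr has_real_derivative 1 / sqrt ((2 * sqrt s / (1 - s))\<^sup>2 + 1) * ((1 + s) / (sqrt s * (1 - s)\<^sup>2))) (at s)"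
    unfolding rr_def[abs_def] by (rule DERIV_chain2[OF arsinh_real_has_field_derivative q])
  moreover have "sqrt ((2 * sqrt s / (1 - s))\<^sup>2 + 1) = (1 + s) / (1 - s)"
    using cosh_rr[of s] assms unfolding rr_def cosh_arsinh_real by simp
  moreover have "1 / ((1 + s) / (1 - s)) * ((1 + s) / (sqrt s * (1 - s)\<^sup>2)) = 1 / (sqrt s * (1 - s))"
    using assms by (simp add: divide_simps power2_eq_square)
  ultimately show ?thesis by simp
qed

lemma rr_tanh: "rr ((tanh (r / 2))\<^sup>2) = r" if "r \<ge> 0" for r
proof -
  have c: "cosh (r / 2) > 0" by simp
  have "1 - (tanh (r / 2))\<^sup>2 = 1 / (cosh (r / 2))\<^sup>2"
  proof -
    have "(tanh (r / 2))\<^sup>2 = (sinh (r / 2))\<^sup>2 / (cosh (r / 2))\<^sup>2" by (simp add: tanh_def power_divide)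
    also have "(sinh (r / 2))\<^sup>2 = (cosh (r / 2))\<^sup>2 - 1" by (simp add: cosh_square_eq)
    finally show ?thesis using c by (simp add: diff_divide_distrib)
  qed
  moreover have "sqrt ((tanh (r / 2))\<^sup>2) = tanh (r / 2)" using that by simp
  ultimately have "2 * sqrt ((tanh (r / 2))\<^sup>2) / (1 - (tanh (r / 2))\<^sup>2) = 2 * sinh (r / 2) * cosh (r / 2)"
    using c by (simp add: tanh_def power2_eq_square)
  also have "\<dots> = sinh r" using sinh_double[of "r / 2"] by simp
  finally show ?thesis by (simp add: rr_def arsinh_sinh_real)
qed

definition rlift :: "(real \<Rightarrow> real) \<Rightarrow> 'a::euclidean_space \<Rightarrow> real" where
  "rlift w x = w (rr (x \<bullet> x))"

context hyp_bn begin

context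
  fixes w z :: "real \<Rightarrow> real"
  assumes fast: "fast_sol w z"
begin

lemma fsol: "radial_sol dd hh w z" and fw0: "w 0 > 0"
  using fast by (auto simp: fast_sol_def)

text \<open>One more power of sinh than in \<open>vv\<close> is divided out, to account for the
  vector x in the field Zf (|x|^2) x. The value at 0 is the limit given by l'Hopital's rule.\<close>

definition "qz r = (if r = 0 then hh (w 0) / real N else z r / sinh r ^ N)"

lemma N_minus_1: "N - Suc 0 = dd" by (simp add: dd_def)

lemma pow_N: "x ^ N = x * x ^ dd" for x :: real
proof -
  have "x ^ N = x ^ Suc (N - 1)" using N7 by simp
  then show ?thesis by (simp only: power_Suc dd_def)
qed

lemma qz_continuous: "continuous_on {0..} qz"
proof -
  have cz': "continuous_on {0..} z" by (rule cz[OF fsol fw0])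
  have "(qz \<longlongrightarrow> hh (w 0) / real N) (at_right 0)"
  proof -
    have ch: "((\<lambda>r. hh (w r)) \<longlongrightarrow> hh (w 0)) (at_right 0)"
    proof -
      have "continuous_on {0..} (\<lambda>r. hh (w r))" by (rule cont_hw[OF fsol fw0])
      then have "((\<lambda>r. hh (w r)) \<longlongrightarrow> hh (w 0)) (at 0 within {0..})" by (auto simp: continuous_on_def)
      then show ?thesis by (rule tendsto_within_subset) auto
    qed
    have "((\<lambda>r. z r / sinh r ^ N) \<longlongrightarrow> hh (w 0) / real N) (at_right 0)"
    proof (rule lhopital_right_0[where f' = "\<lambda>r. sinh r ^ dd * hh (w r)" and g' = "\<lambda>r. real N * sinh r ^ dd * cosh r"])
      have "(z \<longlongrightarrow> z 0) (at 0 within {0..})" using cz' by (auto simp: continuous_on_def)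
      then show "(z \<longlongrightarrow> 0) (at_right 0)" unfolding z0[OF fsol fw0] by (rule tendsto_within_subset) auto
      show "((\<lambda>r::real. sinh r ^ N) \<longlongrightarrow> 0) (at_right 0)" using N7 by (auto intro!: tendsto_eq_intros)
      have ev: "\<forall>\<^sub>F r in at_right (0::real). r > 0" by (auto simp: eventually_at_filter)
      show "\<forall>\<^sub>F r in at_right (0::real). sinh r ^ N \<noteq> 0" using ev by eventually_elim simp
      show "\<forall>\<^sub>F r in at_right (0::real). real N * sinh r ^ dd * cosh r \<noteq> 0"
        using ev by eventually_elim (use N7 in simp)
      show "\<forall>\<^sub>F r in at_right 0. (z has_real_derivative sinh r ^ dd * hh (w r)) (at r)"
        using ev by eventually_elim (rule dz[OF fsol fw0])
      show "\<forall>\<^sub>F r in at_right (0::real). ((\<lambda>r. sinh r ^ N) has_real_derivative real N * sinh r ^ dd * cosh r) (at r)"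
        by (rule always_eventually) (auto intro!: derivative_eq_intros simp: N_minus_1)
      have "((\<lambda>r. hh (w r) / (real N * cosh r)) \<longlongrightarrow> hh (w 0) / (real N * cosh 0)) (at_right 0)"
        using N7 by (intro tendsto_intros ch) auto
      then have "((\<lambda>r. hh (w r) / (real N * cosh r)) \<longlongrightarrow> hh (w 0) / real N) (at_right 0)" by simp
      moreover have "\<forall>\<^sub>F r in at_right 0. hh (w r) / (real N * cosh r) = sinh r ^ dd * hh (w r) / (real N * sinh r ^ dd * cosh r)"
        using ev by eventually_elim simp
      ultimately show "((\<lambda>r. sinh r ^ dd * hh (w r) / (real N * sinh r ^ dd * cosh r)) \<longlongrightarrow> hh (w 0) / real N) (at_right 0)"
        by (rule Lim_transform_eventually)
    qed
    moreover have "\<forall>\<^sub>F r in at_right 0. z r / sinh r ^ N = qz r" by (auto simp: eventually_at_filter qz_def)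
    ultimately show ?thesis by (rule Lim_transform_eventually)
  qed
  moreover have "at_right (0::real) = at 0 within {0..}"
    unfolding at_within_def by (rule arg_cong[where f = "\<lambda>S. inf (nhds 0) (principal S)"]) auto
  ultimately have c0: "continuous (at 0 within {0..}) qz" by (simp add: continuous_within qz_def)
  have "continuous (at r within {0..}) qz" if "r > 0" for r
  proof -
    have "continuous_on {0<..} (\<lambda>r. z r / sinh r ^ N)"
      by (intro continuous_intros continuous_on_subset[OF cz']) auto
    then have "isCont (\<lambda>r. z r / sinh r ^ N) r" using that by (simp add: continuous_on_eq_continuous_at)
    moreover have "\<forall>\<^sub>F x in nhds r. z x / sinh x ^ N = qz x"
    proof -
      have "\<forall>\<^sub>F x in nhds r. x \<in> {0<..}" by (rule eventually_nhds_in_open) (use that in auto)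
      then show ?thesis by eventually_elim (simp add: qz_def)
    qed
    ultimately have "isCont qz r" using isCont_cong[of "\<lambda>x. z x / sinh x ^ N" qz r] by simp
    then show ?thesis by (rule continuous_at_imp_continuous_at_within)
  qed
  then have "continuous (at r within {0..}) qz" if "r \<ge> 0" for r using c0 that by (cases "r = 0") auto
  then show ?thesis by (simp add: continuous_on_eq_continuous_within)
qed

definition "om s = w (rr s)"
text \<open>For u = \<open>rlift w\<close> the field conf^(N - 2) grad u equals - Zf (|x|^2)
  x.\<close>

definition "Zf s = (2 / (1 - s)) ^ N * qz (rr s)"
definition "ka s = (2 / (1 - s)) ^ N * hh (om s)"
text \<open>Read off from the divergence equation; at s = 0, where the division yields 0, it only
  occurs multiplied by s.\<close>

definition "Zf' s = (ka s - real N * Zf s) / (2 * s)"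
text \<open>Expressed through \<open>Zf\<close>, which is continuous up to s = 0, whereas the
  formula with \<open>vv\<close> has sqrt s in the denominator.\<close>

definition "om' s = - ((1 - s) ^ (N - 2) / 2 ^ (N - 1)) * Zf s"

lemma rr_image: "rr ` {0..<1} \<subseteq> {0..}" using rr_nonneg by auto

lemma om_continuous: "continuous_on {0..<1} om"
  unfolding om_def[abs_def] by (rule continuous_on_compose2[OF cw[OF fsol fw0] rr_continuous rr_image])

lemma ka_continuous: "continuous_on {0..<1} ka"
  unfolding ka_def[abs_def]
  by (intro continuous_intros continuous_on_compose2[OF cont_hh[of UNIV] om_continuous]) auto

lemma Zf_continuous: "continuous_on {0..<1} Zf"
  unfolding Zf_def[abs_def]
  by (intro continuous_intros continuous_on_compose2[OF qz_continuous rr_continuous rr_image]) auto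

lemma om'_continuous: "continuous_on {0..<1} om'"
  unfolding om'_def[abs_def] by (intro continuous_intros Zf_continuous) auto

text \<open>At s = 0 it reads N Zf 0 = ka 0, which is what the value hh (w 0) / N in
  \<open>qz\<close> achieves.\<close>

lemma Zf_ode: assumes "s \<in> {0..<1}" shows "2 * s * Zf' s + real N * Zf s = ka s"
proof (cases "s = 0")
  case True
  then show ?thesis using N7 by (simp add: Zf_def ka_def qz_def rr_0 om_def)
qed (simp add: Zf'_def)

lemma Zf_eq: assumes "0 < s" "s < 1" shows "Zf s = z (rr s) / sqrt s ^ N"
  using rr_pos[OF assms] assms by (simp add: Zf_def qz_def sinh_rr power_divide power_mult_distrib)

lemma Zf_deriv: assumes "s \<in> {0<..<1}" shows "(Zf has_real_derivative Zf' s) (at s)"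
proof -
  have s: "0 < s" "s < 1" "sqrt s > 0" using assms by auto
  define q where "q = sqrt s"
  have q: "q > 0" "q\<^sup>2 = s" using s by (auto simp: q_def)
  have dz': "((\<lambda>s. z (rr s)) has_real_derivative (sinh (rr s) ^ dd * hh (w (rr s))) * (1 / (sqrt s * (1 - s)))) (at s)"
    by (rule DERIV_chain2[OF dz[OF fsol fw0 rr_pos[OF s(1,2)]] rr_deriv[OF s(1,2)]])
  have dq: "((\<lambda>s. sqrt s ^ N) has_real_derivative real N * sqrt s ^ dd * (inverse (sqrt s) / 2)) (at s)"
    using s by (auto intro!: derivative_eq_intros simp: N_minus_1)
  have "((\<lambda>s. z (rr s) / sqrt s ^ N) has_real_derivative
      ((sinh (rr s) ^ dd * hh (w (rr s))) * (1 / (sqrt s * (1 - s))) * sqrt s ^ N - z (rr s) * (real N * sqrt s ^ dd * (inverse (sqrt s) / 2)))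
        / (sqrt s ^ N * sqrt s ^ N)) (at s)"
    using s by (intro DERIV_divide dz' dq) auto
  moreover have "((sinh (rr s) ^ dd * hh (w (rr s))) * (1 / (sqrt s * (1 - s))) * sqrt s ^ N - z (rr s) * (real N * sqrt s ^ dd * (inverse (sqrt s) / 2)))
        / (sqrt s ^ N * sqrt s ^ N) = Zf' s"
  proof -
    define H Y T where "H = hh (w (rr s))" and "Y = z (rr s)" and "T = 1 - s"
    have T: "T > 0" using s by (simp add: T_def)
    have "sinh (rr s) ^ dd = 2 ^ dd * q ^ dd / T ^ dd" by (simp add: sinh_rr q_def T_def power_divide power_mult_distrib)
    moreover have "Zf' s = ((2 / T) ^ N * H - real N * (Y / q ^ N)) / (2 * q\<^sup>2)"
      by (simp add: Zf'_def ka_def om_def H_def Y_def T_def Zf_eq[OF s(1,2), folded q_def] q(2))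
    moreover have "((2 ^ dd * q ^ dd / T ^ dd * H) * (1 / (q * T)) * q ^ N - Y * (real N * q ^ dd * (inverse q / 2))) / (q ^ N * q ^ N)
        = ((2 / T) ^ N * H - real N * (Y / q ^ N)) / (2 * q\<^sup>2)"
    proof -
      have "((P * A / B * H) * (1 / (q * T)) * (q * A) - Y * (n * A * (inverse q / 2))) / ((q * A) * (q * A))
          = ((2 / T * (P / B)) * H - n * (Y / (q * A))) / (2 * q\<^sup>2)" if "A > 0" "B > 0" "P > 0" for A B P n :: real
        using q(1) T that by (simp add: divide_simps power2_eq_square) algebra
      from this[of "q ^ dd" "T ^ dd" "2 ^ dd" "real N"] show ?thesis using q T
        by (simp only: pow_N power_divide) simp
    qed
    ultimately show ?thesis unfolding H_def[symmetric] Y_def[symmetric] T_def[symmetric] q_def[symmetric] by simp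
  qed
  ultimately have "((\<lambda>s. z (rr s) / sqrt s ^ N) has_real_derivative Zf' s) (at s)" by simp
  moreover have "\<forall>\<^sub>F x in nhds s. Zf x = z (rr x) / sqrt x ^ N"
  proof -
    have "\<forall>\<^sub>F x in nhds s. x \<in> {0<..<1}" by (rule eventually_nhds_in_open) (use s in auto)
    then show ?thesis by eventually_elim (use Zf_eq in auto)
  qed
  ultimately show ?thesis by (subst DERIV_cong_ev[OF refl _ refl]) auto
qed

lemma om'_eq: assumes "0 < s" "s < 1" shows "om' s = - vv z (rr s) / (sqrt s * (1 - s))"
proof -
  define q T where "q = sqrt s" and "T = 1 - s"
  have q: "q > 0" "T > 0" using assms by (auto simp: q_def T_def)
  have N2: "N - 2 = dd - 1" "N - 1 = dd" by (auto simp: dd_def)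
  have Tp: "T ^ dd = T * T ^ (dd - 1)" using dd1 by (cases dd) auto
  have "vv z (rr s) = z (rr s) / (2 * q / T) ^ dd" by (simp add: vv_def sinh_rr q_def T_def)
  then have v: "vv z (rr s) = z (rr s) * (T * T ^ (dd - 1)) / (2 ^ dd * q ^ dd)"
    by (simp only: power_divide power_mult_distrib Tp) simp
  have Z: "Zf s = z (rr s) / (q * q ^ dd)" using Zf_eq[OF assms] by (simp only: q_def pow_N)
  show ?thesis using q
    unfolding om'_def v Z N2 q_def[symmetric] T_def[symmetric] by (simp add: divide_simps)
qed

lemma om_deriv: assumes "s \<in> {0<..<1}" shows "(om has_real_derivative om' s) (at s)"
proof -
  have s: "0 < s" "s < 1" using assms by auto
  have "(om has_real_derivative (- vv z (rr s)) * (1 / (sqrt s * (1 - s)))) (at s)"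
    unfolding om_def[abs_def] by (rule DERIV_chain2[OF dw[OF fsol fw0 rr_pos[OF s]] rr_deriv[OF s]])
  then show ?thesis by (simp add: om'_eq[OF s])
qed

text \<open>For s \<ge> 1/4 the derivative inherits the decay of \<open>vv\<close>, as sqrt s \<ge>
  1/2; near 0, where that formula is singular, continuity of \<open>om'\<close> on a compact
  interval suffices.\<close>

lemma om_decay:
  obtains C where "\<And>s. s \<in> {0..<1} \<Longrightarrow> \<bar>om s\<bar> \<le> C * (1 - s) powr ex"
    "\<And>s. s \<in> {0..<1} \<Longrightarrow> \<bar>om' s\<bar> * (1 - s) \<le> C * (1 - s) powr ex"
proof -
  obtain C where C: "\<And>r. r \<ge> 0 \<Longrightarrow> \<bar>w r\<bar> \<le> C * exp (- ex * r)" "\<And>r. r \<ge> 0 \<Longrightarrow> \<bar>vv z r\<bar> \<le> C * exp (- ex * r)"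
    using fast by (auto simp: fast_sol_def)
  have C0: "C \<ge> 0" using C(1)[of 0] by simp
  have ex0: "ex > 0" using ex_gt by (smt (verit) divide_nonneg_nonneg of_nat_0_le_iff)
  have e: "exp (- ex * rr s) \<le> (1 - s) powr ex" if "s \<in> {0..<1}" for s
  proof -
    have "exp (- ex * rr s) = exp (- rr s) powr ex" by (simp add: powr_def)
    also have "\<dots> \<le> (1 - s) powr ex" using exp_minus_rr[of s] that ex0 by (intro powr_mono2) auto
    finally show ?thesis .
  qed
  have "compact (om' ` {0..1/4})"
    by (intro compact_continuous_image continuous_on_subset[OF om'_continuous]) auto
  then have "bounded (om' ` {0..1/4})" by (rule compact_imp_bounded)
  then obtain M where M: "\<And>s. s \<in> {0..1/4} \<Longrightarrow> \<bar>om' s\<bar> \<le> M"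
    unfolding bounded_iff by fastforce
  have M0: "M \<ge> 0" using M[of 0] by simp
  define C' where "C' = 2 * C + M / (3/4) powr ex"
  have C': "C \<le> C'" "2 * C \<le> C'" "M / (3/4) powr ex \<le> C'" using C0 M0 by (auto simp: C'_def)
  show ?thesis
  proof (rule that[of C'])
    fix s :: real assume s: "s \<in> {0..<1}"
    have "\<bar>om s\<bar> \<le> C * exp (- ex * rr s)" using C(1)[of "rr s"] rr_nonneg[of s] s by (simp add: om_def)
    also have "\<dots> \<le> C' * (1 - s) powr ex" using C0 C' e[OF s] by (intro mult_mono) auto
    finally show "\<bar>om s\<bar> \<le> C' * (1 - s) powr ex" .
    show "\<bar>om' s\<bar> * (1 - s) \<le> C' * (1 - s) powr ex"
    proof (cases "s \<le> 1/4")
      case True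
      have "\<bar>om' s\<bar> * (1 - s) \<le> M * 1" using M[of s] s True M0 by (intro mult_mono) auto
      also have "\<dots> = M / (3/4) powr ex * (3/4) powr ex" by simp
      also have "\<dots> \<le> C' * (1 - s) powr ex"
        using C' True ex0 M0 C0 by (intro mult_mono powr_mono2) (auto simp: C'_def)
      finally show ?thesis .
    next
      case False
      then have sp: "0 < s" "s < 1" using s by auto
      have "sqrt (1/4) \<le> sqrt s" using False by (intro real_sqrt_le_mono) simp
      then have q: "1/2 \<le> sqrt s" by (simp add: real_sqrt_divide)
      have "\<bar>om' s\<bar> * (1 - s) = \<bar>vv z (rr s)\<bar> / sqrt s" using sp by (simp add: om'_eq[OF sp] abs_mult)
      also have "\<dots> \<le> \<bar>vv z (rr s)\<bar> / (1/2)" using q sp by (intro divide_left_mono) auto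
      also have "\<dots> \<le> 2 * (C * exp (- ex * rr s))" using C(2)[of "rr s"] rr_nonneg[of s] s by simp
      also have "\<dots> \<le> C' * (1 - s) powr ex" using mult_mono[OF C'(2) e[OF s]] C0 C' by simp
      finally show ?thesis .
    qed
  qed
qed

lemma rlift_om: "rlift w x = om (x \<bullet> x)" by (simp add: rlift_def om_def)

lemma rlift_continuous: "continuous_on hyp_ball (rlift w :: 'a::euclidean_space \<Rightarrow> real)"
proof -
  have "continuous_on hyp_ball (\<lambda>x::'a. om (x \<bullet> x))"
    by (rule continuous_on_compose2[OF om_continuous]) (auto intro!: continuous_intros simp: in_hyp_ball)
  then show ?thesis by (simp add: rlift_om[abs_def])
qed

text \<open>Compact support of \<phi> turns the hyperbolic integrals into Lebesgue integrals; their
  integrands combine pointwise to the negative of the integrand in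
  \<open>radial_divergence\<close>.\<close>

lemma rlift_weak:
  assumes N: "N = DIM('a::euclidean_space)"
  shows "weak_solution lam (rlift w :: 'a \<Rightarrow> real)"
proof -
  define G where "G x = (2 * om' (x \<bullet> x)) *\<^sub>R x" for x :: 'a
  obtain C where C: "\<And>s. s \<in> {0..<1} \<Longrightarrow> \<bar>om s\<bar> \<le> C * (1 - s) powr ex"
    "\<And>s. s \<in> {0..<1} \<Longrightarrow> \<bar>om' s\<bar> * (1 - s) \<le> C * (1 - s) powr ex"
    using om_decay by blast
  have "ex > (real DIM('a) - 1) / 2" using ex_gt N7 by (simp add: dd_def of_nat_diff N[symmetric])
  moreover from this have "ex \<ge> 0" using N7 N by simp
  ultimately have H1: "H1_with_grad (rlift w :: 'a \<Rightarrow> real) G"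
    using H1_radial[OF _ _ om_continuous om'_continuous om_deriv C] by (simp add: G_def[abs_def] rlift_om[abs_def])
  have crit: "crit_exp DIM('a) - 2 = qq" using N7 by (simp add: crit_exp_def qq_def N[symmetric] field_simps)
  have "integrable hyp_vol (\<lambda>x. ((1 - (norm x)\<^sup>2) / 2)\<^sup>2 * (G x \<bullet> egrad \<phi> x)) \<and>
        integrable hyp_vol (\<lambda>x. rlift w x * \<phi> x) \<and>
        integrable hyp_vol (\<lambda>x. \<bar>rlift w x\<bar> powr qq * rlift w x * \<phi> x) \<and>
        (\<integral>x. ((1 - (norm x)\<^sup>2) / 2)\<^sup>2 * (G x \<bullet> egrad \<phi> x) \<partial>hyp_vol) - lam * (\<integral>x. rlift w x * \<phi> x \<partial>hyp_vol)
        = (\<integral>x. \<bar>rlift w x\<bar> powr qq * rlift w x * \<phi> x \<partial>hyp_vol)" if test: "test_fun \<phi>" for \<phi> :: "'a \<Rightarrow> real"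
  proof -
    obtain K where K: "compact K" "K \<subseteq> (hyp_ball :: 'a set)" and z\<phi>: "\<And>x. x \<notin> K \<Longrightarrow> \<phi> x = 0"
      and zd: "\<And>x. x \<notin> K \<Longrightarrow> frechet_derivative \<phi> (at x) = (\<lambda>_. 0)"
      and c\<phi>: "continuous_on hyp_ball \<phi>" and cD: "\<And>v. continuous_on hyp_ball (\<lambda>x. frechet_derivative \<phi> (at x) v)"
      using test_fun_facts[OF test] by metis
    have ce: "continuous_on hyp_ball (egrad \<phi>)" unfolding egrad_def[abs_def] by (intro continuous_intros cD)
    have ze: "egrad \<phi> x = 0" if "x \<notin> K" for x using that by (simp add: egrad_def zd)
    have com': "continuous_on hyp_ball (\<lambda>x::'a. om' (x \<bullet> x))"
      by (rule continuous_on_compose2[OF om'_continuous]) (auto intro!: continuous_intros simp: in_hyp_ball)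
    define f1 where "f1 x = ((1 - (norm x)\<^sup>2) / 2)\<^sup>2 * (G x \<bullet> egrad \<phi> x)" for x
    define f2 where "f2 x = rlift w x * \<phi> x" for x
    define f3 where "f3 x = \<bar>rlift w x\<bar> powr qq * rlift w x * \<phi> x" for x
    have c1: "continuous_on hyp_ball f1" unfolding f1_def[abs_def] G_def by (intro continuous_intros com' ce) auto
    have c2: "continuous_on hyp_ball f2" unfolding f2_def[abs_def] by (intro continuous_intros rlift_continuous c\<phi>)
    have "continuous_on hyp_ball (\<lambda>x::'a. hh (rlift w x))"
      by (rule continuous_on_compose2[OF cont_hh[of UNIV] rlift_continuous]) auto
    then have "continuous_on hyp_ball (\<lambda>x::'a. (hh (rlift w x) - lam * rlift w x) * \<phi> x)"
      by (intro continuous_intros rlift_continuous c\<phi>)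
    then have c3: "continuous_on hyp_ball f3" by (simp add: f3_def[abs_def] hh_def)
    have z1: "f1 x = 0" and z2: "f2 x = 0" and z3: "f3 x = 0" if "x \<notin> K" for x
      using that by (auto simp: f1_def f2_def f3_def ze z\<phi>)
    note h1 = hyp_integral_compact[OF c1 K z1]
    note h2 = hyp_integral_compact[OF c2 K z2]
    note h3 = hyp_integral_compact[OF c3 K z3]
    have eq: "hyp_conf x ^ DIM('a) * f1 x - lam * (hyp_conf x ^ DIM('a) * f2 x) - hyp_conf x ^ DIM('a) * f3 x
        = - (Zf (x \<bullet> x) * (x \<bullet> egrad \<phi> x) + ka (x \<bullet> x) * \<phi> x)" for x
    proof (cases "x \<in> K")
      case True
      define s where "s = x \<bullet> x"
      have s: "s < 1" using True K(2) by (auto simp: s_def in_hyp_ball)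
      define T where "T = 1 - s"
      have T: "T > 0" using s by (simp add: T_def)
      define Q where "Q = T ^ (N - 2)"
      have Q: "Q > 0" using T by (simp add: Q_def)
      have "2 + (N - 2) = N" using N7 by simp
      then have TN: "T ^ N = T\<^sup>2 * Q" by (simp only: Q_def power_add[symmetric])
      have "Suc (N - 1) = N" using N7 by simp
      then have P2: "(2::real) ^ N = 2 * 2 ^ (N - 1)" by (simp only: power_Suc[symmetric])
      have conf: "hyp_conf x ^ DIM('a) = 2 ^ N / T ^ N"
        by (simp add: hyp_conf_def power2_norm_eq_inner s_def T_def power_divide N)
      have "hyp_conf x ^ DIM('a) * f1 x = (2 ^ N / T ^ N) * ((T / 2)\<^sup>2 * (2 * om' s * (x \<bullet> egrad \<phi> x)))"
        unfolding conf by (simp add: f1_def G_def power2_norm_eq_inner s_def T_def)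
      also have "\<dots> = - (Zf s * (x \<bullet> egrad \<phi> x))"
      proof -
        have "(2 * P / (T\<^sup>2 * Q)) * ((T / 2)\<^sup>2 * (2 * (- (Q / P) * Zf s) * y)) = - (Zf s * y)" if "P > 0" for P y
          using T Q that by (simp add: field_simps power2_eq_square)
        from this[of "2 ^ (N - 1)"] show ?thesis unfolding om'_def TN P2 T_def[symmetric] Q_def[symmetric] by simp
      qed
      finally have 1: "hyp_conf x ^ DIM('a) * f1 x = - (Zf s * (x \<bullet> egrad \<phi> x))" .
      have "lam * (hyp_conf x ^ DIM('a) * f2 x) + hyp_conf x ^ DIM('a) * f3 x = hyp_conf x ^ DIM('a) * hh (om s) * \<phi> x"
        by (simp add: f2_def f3_def hh_def rlift_om s_def algebra_simps)
      also have "\<dots> = ka s * \<phi> x" unfolding conf ka_def T_def by (simp add: power_divide)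
      finally show ?thesis using 1 by (simp add: s_def)
    next
      case False
      then show ?thesis by (simp add: z1 z2 z3 ze z\<phi>)
    qed
    have div: "(\<integral>x. Zf (x \<bullet> x) * (x \<bullet> egrad \<phi> x) + ka (x \<bullet> x) * \<phi> x \<partial>lborel) = 0"
      by (rule radial_divergence[OF Zf_continuous ka_continuous Zf_deriv _ test]) (use Zf_ode in \<open>auto simp: N[symmetric]\<close>)
    have "(\<integral>x. f1 x \<partial>hyp_vol) - lam * (\<integral>x. f2 x \<partial>hyp_vol) - (\<integral>x. f3 x \<partial>hyp_vol)
        = (\<integral>x. hyp_conf x ^ DIM('a) * f1 x - lam * (hyp_conf x ^ DIM('a) * f2 x) - hyp_conf x ^ DIM('a) * f3 x \<partial>lborel)"
      using h1 h2 h3 by simp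
    also have "\<dots> = - (\<integral>x. Zf (x \<bullet> x) * (x \<bullet> egrad \<phi> x) + ka (x \<bullet> x) * \<phi> x \<partial>lborel)"
      unfolding eq by (rule Bochner_Integration.integral_minus)
    also have "\<dots> = 0" by (simp only: div minus_zero)
    finally have "(\<integral>x. f1 x \<partial>hyp_vol) - lam * (\<integral>x. f2 x \<partial>hyp_vol) = (\<integral>x. f3 x \<partial>hyp_vol)" by simp
    then show ?thesis using h1(1) h2(1) h3(1) unfolding f1_def[abs_def] f2_def[abs_def] f3_def[abs_def] by blast
  qed
  then show ?thesis unfolding weak_solution_def crit using H1 by blast
qed

lemma rlift_radial: "radial (rlift w :: 'a::euclidean_space \<Rightarrow> real)"
  by (auto simp: radial_def rlift_def power2_norm_eq_inner[symmetric])

lemma rlift_value: assumes "r \<ge> 0" shows "\<exists>x\<in>hyp_ball. (rlift w (x::'a::euclidean_space)) = w r"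
proof -
  obtain b :: 'a where b: "b \<in> Basis" using nonempty_Basis by blast
  define x where "x = tanh (r / 2) *\<^sub>R b"
  have xx: "x \<bullet> x = (tanh (r / 2))\<^sup>2" using b by (simp add: x_def power2_eq_square inner_same_Basis)
  have "(tanh (r / 2))\<^sup>2 < 1" using tanh_real_bounds[of "r / 2"] by (simp add: abs_square_less_1 abs_less_iff)
  then have "x \<in> hyp_ball" by (simp add: in_hyp_ball xx)
  moreover have "rlift w x = w r" by (simp add: rlift_def xx rr_tanh[OF assms])
  ultimately show ?thesis by blast
qed

lemma rlift_sign_changing:
  assumes "r \<ge> 0" "w r > 0" "r' \<ge> 0" "w r' < 0"
  shows "sign_changing (rlift w :: 'a::euclidean_space \<Rightarrow> real)" "nontrivial (rlift w :: 'a \<Rightarrow> real)"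
proof -
  have o: "open {x \<in> hyp_ball. rlift w (x::'a) > 0}" "open {x \<in> hyp_ball. rlift w (x::'a) < 0}"
    using continuous_open_preimage[OF rlift_continuous[where 'a = 'a], of "{0<..}"]
      continuous_open_preimage[OF rlift_continuous[where 'a = 'a], of "{..<0}"]
    by (simp_all add: hyp_ball_def vimage_def Int_def)
  have p: "emeasure hyp_vol {x \<in> hyp_ball. rlift w (x::'a) > 0} > 0"
    by (rule open_hyp_vol_pos(2)[OF o(1)]) (use rlift_value[OF assms(1), where 'a = 'a] assms(2) in fastforce)+
  have n: "emeasure hyp_vol {x \<in> hyp_ball. rlift w (x::'a) < 0} > 0"
    by (rule open_hyp_vol_pos(2)[OF o(2)]) (use rlift_value[OF assms(3), where 'a = 'a] assms(4) in fastforce)+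
  show "sign_changing (rlift w :: 'a \<Rightarrow> real)" using p n by (simp add: sign_changing_def space_hyp_vol)
  show "nontrivial (rlift w :: 'a \<Rightarrow> real)" unfolding nontrivial_def
  proof
    assume "AE x in hyp_vol. rlift w (x::'a) = 0"
    then have "AE x in hyp_vol. \<not> rlift w (x::'a) > 0" by eventually_elim simp
    moreover have "{x \<in> hyp_ball. rlift w (x::'a) > 0} \<in> sets hyp_vol"
      by (rule open_hyp_vol_pos(1)[OF o(1)]) (use rlift_value[OF assms(1), where 'a = 'a] assms(2) in fastforce)+
    ultimately have "emeasure hyp_vol {x \<in> hyp_ball. rlift w (x::'a) > 0} = 0"
      by (subst (asm) AE_iff_measurable) (auto simp: space_hyp_vol)
    then show False using p by simp
  qed
qed

end

lemma positive_negative_of_alternates: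
  assumes "alternates w 1 r" shows "\<exists>r r'. r \<ge> 0 \<and> w r > 0 \<and> r' \<ge> 0 \<and> w r' < 0"
proof -
  obtain s where s: "s < r" "s > 0" "w r * w s < 0" using assms by auto
  then have "r \<ge> 0" "s \<ge> 0" by auto
  then show ?thesis using s(3) unfolding mult_less_0_iff by blast
qed

text \<open>The two lifts are continuous and differ at the origin, hence on an open set, which has
  positive volume.\<close>

lemma rlift_distinct:
  assumes f1: "fast_sol w1 z1" and f2: "fast_sol w2 z2" and ne: "w1 0 \<noteq> w2 0"
  shows "\<not> (AE x in hyp_vol. rlift w1 (x::'a::euclidean_space) = rlift w2 x)"
proof
  assume ae: "AE x in hyp_vol. rlift w1 (x::'a) = rlift w2 x"
  have "continuous_on hyp_ball (\<lambda>x::'a. rlift w1 x - rlift w2 x)"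
    by (intro continuous_intros rlift_continuous[OF f1] rlift_continuous[OF f2])
  then have o: "open {x \<in> hyp_ball. rlift w1 (x::'a) \<noteq> rlift w2 x}"
    using continuous_open_preimage[of hyp_ball "\<lambda>x::'a. rlift w1 x - rlift w2 x" "- {0}"]
    by (simp add: hyp_ball_def vimage_def Int_def open_Compl)
  have "(0::'a) \<in> {x \<in> hyp_ball. rlift w1 x \<noteq> rlift w2 x}" using ne by (simp add: rlift_def rr_0 hyp_ball_def)
  then have S: "{x \<in> hyp_ball. rlift w1 (x::'a) \<noteq> rlift w2 x} \<noteq> {}" "{x \<in> hyp_ball. rlift w1 (x::'a) \<noteq> rlift w2 x} \<subseteq> hyp_ball" by auto
  note p = open_hyp_vol_pos[OF o S]
  have "emeasure hyp_vol {x \<in> hyp_ball. rlift w1 (x::'a) \<noteq> rlift w2 x} = 0"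
    using ae by (subst (asm) AE_iff_measurable[OF p(1)]) (auto simp: space_hyp_vol)
  then show False using p(2) by simp
qed

end

theorem theorem1p3:
  fixes lam :: real
  assumes "DIM('a::euclidean_space) \<ge> 7"
    and "real DIM('a) * (real DIM('a) - 2) / 4 < lam"
    and "lam < ((real DIM('a) - 1) / 2)\<^sup>2"
  shows "\<exists>U :: nat \<Rightarrow> 'a \<Rightarrow> real.
           (\<forall>k. weak_solution lam (U k) \<and> nontrivial (U k) \<and> radial (U k) \<and> sign_changing (U k)) \<and>
           (\<forall>i j. i \<noteq> j \<longrightarrow> \<not> (AE x in hyp_vol. U i x = U j x))"
proof -
  interpret hyp_bn "DIM('a)" lam by unfold_locales (use assms in auto)
  obtain A where A: "A > 0" "\<And>w z. radial_sol dd hh w z \<Longrightarrow> w 0 \<ge> A \<Longrightarrow> \<exists>r. alternates w 1 r"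
    using many_sign_changes[of 1] by blast
  \<comment> \<open>Collecting initial values instead of solutions makes infinity immediate from
    unboundedness, and different values already give different lifts. One alternation, guaranteed
    above A, is enough for a change of sign.\<close>
  define S where "S = {\<alpha>. \<alpha> \<ge> A \<and> (\<exists>w z. fast_sol w z \<and> w 0 = \<alpha>)}"
  have "\<exists>\<alpha>\<in>S. \<alpha> \<ge> M" for M
  proof -
    obtain w z where "fast_sol w z" "w 0 \<ge> max A M"
      using fast_unbounded[of "max A M"] A(1) by (metis less_max_iff_disj)
    then show ?thesis by (intro bexI[of _ "w 0"]) (auto simp: S_def)
  qed
  then have "\<not> bdd_above S" unfolding bdd_above_def by (metis gt_ex leD order_less_le_trans)
  then have "infinite S" by (meson bdd_above_finite)
  then obtain f :: "nat \<Rightarrow> real" where f: "inj f" "range f \<subseteq> S" using infinite_countable_subset by blast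
  have fS: "f k \<in> S" for k using f(2) by auto
  then have "\<exists>w. \<exists>z. fast_sol w z \<and> w 0 = f k" for k unfolding S_def by blast
  then obtain W where "\<And>k. \<exists>z. fast_sol (W k) z \<and> W k 0 = f k" by metis
  then obtain Z where W: "\<And>k. fast_sol (W k) (Z k)" "\<And>k. W k 0 = f k" by metis
  have sgn: "\<exists>r r'. r \<ge> 0 \<and> W k r > 0 \<and> r' \<ge> 0 \<and> W k r' < 0" for k
  proof -
    have "W k 0 \<ge> A" using fS[of k] W(2)[of k] by (simp add: S_def)
    then show ?thesis using A(2)[OF fsol[OF W(1)]] positive_negative_of_alternates by blast
  qed
  show ?thesis
  proof (intro exI[of _ "\<lambda>k. rlift (W k) :: 'a \<Rightarrow> real"] conjI allI impI)
    fix k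
    show "weak_solution lam (rlift (W k) :: 'a \<Rightarrow> real)" by (rule rlift_weak[OF W(1) refl])
    show "radial (rlift (W k) :: 'a \<Rightarrow> real)" by (rule rlift_radial[OF W(1)])
    obtain r r' where "r \<ge> 0" "W k r > 0" "r' \<ge> 0" "W k r' < 0" using sgn by blast
    from rlift_sign_changing[OF W(1) this]
    show "nontrivial (rlift (W k) :: 'a \<Rightarrow> real)" "sign_changing (rlift (W k) :: 'a \<Rightarrow> real)" by auto
  next
    fix i j :: nat assume "i \<noteq> j"
    then have "W i 0 \<noteq> W j 0" using f(1) W(2) by (simp add: inj_eq)
    then show "\<not> (AE x in hyp_vol. rlift (W i) (x::'a) = rlift (W j) x)" by (rule rlift_distinct[OF W(1) W(1)])
  qed
qed

end
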